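(* For every $n\ge3$, neither $\mathcal{R}^+(n)\subset\mathcal{A}(n)$ nor $\mathcal{A}(n)\subset\mathcal{R}^+(n)$.
   Context: $R_{a,b}(z)=\sum_{j=1}^n a_j/(z-b_j)$. $\mathcal{R}(n)$ is the set of $(a,b)\in\mathbb{C}^n\times\mathbb{C}^n$ with $\sum_jb_j=0$ such that $R_{a,b}$ has degree $n$ and $R_{a,b}^{-1}(\mathbb{D})$ is connected and bounded by $n$ disjoint analytic Jordan curves. $\mathcal{R}^+(n)=\mathcal{R}(n)\cap((\mathbb{R}_{>0})^n\times\mathbb{C}^n)$. Ahlfors function on a domain $X\ni\infty$: the unique holomorphic $f:X\to\mathbb{D}$ with $f'(\infty):=\lim_{z\to\infty}z(f(z)-f(\infty))$ equal to $\sup\{|g'(\infty)|:g:X\to\overline{\mathbb{D}}\text{ holomorphic}\}$. $\mathcal{A}(n)$ is the set of $(a,b)\in\mathcal{R}(n)$ such that $R_{a,b}$ is the Ahlfors function on $R_{a,b}^{-1}(\mathbb{D})$. *)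

theory Defs
  imports "HOL-Analysis.Analysis" "HOL-Computational_Algebra.Polynomial"
begin

definition Rab :: "complex list \<Rightarrow> complex list \<Rightarrow> complex \<Rightarrow> complex" where
  "Rab a b z = (\<Sum>j<length a. a ! j / (z - b ! j))"

definition rat_fun_degree :: "(complex \<Rightarrow> complex) \<Rightarrow> nat \<Rightarrow> bool" where
  "rat_fun_degree R d \<longleftrightarrow>
     (\<exists>p q :: complex poly. q \<noteq> 0 \<and> coprime p q \<and>
        (\<forall>z. poly q z \<noteq> 0 \<longrightarrow> R z = poly p z / poly q z) \<and>
        d = max (degree p) (degree q))"

text \<open>Finite part of R^{-1}(D); the point at infinity always belongs to R^{-1}(D) since R(inf)=0.\<close>
definition preimage_disk :: "complex list \<Rightarrow> complex list \<Rightarrow> complex set" where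
  "preimage_disk a b = {z. z \<notin> set b \<and> cmod (Rab a b z) < 1}"

definition analytic_jordan_curve :: "complex set \<Rightarrow> bool" where
  "analytic_jordan_curve C \<longleftrightarrow>
     (\<exists>f A. open A \<and> sphere 0 1 \<subseteq> A \<and> f holomorphic_on A \<and> inj_on f A \<and> C = f ` sphere 0 1)"

definition Rset :: "nat \<Rightarrow> (complex list \<times> complex list) set" where
  "Rset n = {(a, b). length a = n \<and> length b = n \<and> sum_list b = 0 \<and>
      rat_fun_degree (Rab a b) n \<and>
      connected (preimage_disk a b) \<and>
      (\<exists>C :: nat \<Rightarrow> complex set.
          (\<forall>i<n. analytic_jordan_curve (C i)) \<and>
          (\<forall>i<n. \<forall>j<n. i \<noteq> j \<longrightarrow> C i \<inter> C j = {}) \<and>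
          frontier (preimage_disk a b) = (\<Union>i<n. C i))}"

definition Rplus :: "nat \<Rightarrow> (complex list \<times> complex list) set" where
  "Rplus n = Rset n \<inter> {(a, b). \<forall>j<length a. a ! j \<in> \<real> \<and> Re (a ! j) > 0}"

text \<open>A function on X = U \<union> {\<infinity>} (U \<subseteq> C) is a pair (g, c), c being its value at infinity.
  It is holomorphic on X if g is holomorphic on U and w \<mapsto> g(1/w) (with value c at 0)
  is holomorphic near 0 (U containing a punctured neighbourhood of infinity).\<close>
definition holo_inf :: "complex set \<Rightarrow> (complex \<Rightarrow> complex) \<Rightarrow> complex \<Rightarrow> bool" where
  "holo_inf U g c \<longleftrightarrow> g holomorphic_on U \<and>
     (\<exists>r>0. (\<forall>w. 0 < cmod w \<and> cmod w < r \<longrightarrow> 1 / w \<in> U) \<and>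
            (\<lambda>w. if w = 0 then c else g (1 / w)) holomorphic_on ball 0 r)"

definition deriv_inf :: "(complex \<Rightarrow> complex) \<Rightarrow> complex \<Rightarrow> complex" where
  "deriv_inf g c = Lim at_infinity (\<lambda>z. z * (g z - c))"

definition is_ahlfors :: "complex set \<Rightarrow> (complex \<Rightarrow> complex) \<Rightarrow> complex \<Rightarrow> bool" where
  "is_ahlfors U f c \<longleftrightarrow> holo_inf U f c \<and> (\<forall>z\<in>U. cmod (f z) < 1) \<and> cmod c < 1 \<and>
     deriv_inf f c = complex_of_real (Sup {cmod (deriv_inf g d) | g d.
        holo_inf U g d \<and> (\<forall>z\<in>U. cmod (g z) \<le> 1) \<and> cmod d \<le> 1})"

definition Aset :: "nat \<Rightarrow> (complex list \<times> complex list) set" where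
  "Aset n = {(a, b) \<in> Rset n. is_ahlfors (preimage_disk a b) (Rab a b) 0}"

end

theory Submission
  imports Defs "HOL-Complex_Analysis.Complex_Analysis" "HOL-Computational_Algebra.Fundamental_Theorem_Algebra"
begin

text \<open>
  Fix distinct poles and let all residues be of small size \<open>e\<close>, so that the holes of the domain are nearly
  round discs around the poles. Duality: \<open>R\<close> is the Ahlfors function as soon as there is a holomorphic
  \<open>psi\<close> on the domain with \<open>psi(\<infinity>) = 1\<close> for which \<open>R psi dz / i\<close> is a positive measure on the boundary.
  In the coordinate \<open>w = 1/R\<close> on each hole this is an integral equation for the boundary density,
  with a kernel of norm \<open>O(n^2 e)\<close>, so it is solved by contraction, up to one real obstruction per hole. If poles and
  residues are symmetric under conjugation and all poles but one conjugate pair are real, a single obstruction is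
  left, and the intermediate value theorem removes it by turning the argument of the residues of the pair.
  If on the other hand all residues are equal to \<open>e\<close>, the obstruction is a nonzero multiple of \<open>e^3\<close> to leading order:
  an explicit rational perturbation of \<open>R\<close> with the same poles is a better competitor.
  Hence equal residues give a positive example that is not Ahlfors, and the residues found by the intermediate
  value theorem are not all equal to \<open>e\<close>, hence not all real.
\<close>

subsection \<open>Integrals over circles\<close>

text \<open>The density on hole k is sought as the boundary value of
  \<open>V k v + cnj (V k (1 / cnj v)) - cnj (V k 0)\<close> with \<open>V k\<close> holomorphic on
  \<open>ball 0 2\<close>. Such an expression continues analytically across the circle and is real
  on it exactly when \<open>Im (V k 0) = 0\<close>: this is the real obstruction of the hole.
  Conjugation preserves the holes at real poles, where the obstruction therefore vanishes, and swaps
  the other two, whose obstructions are opposite numbers.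

  The order e^3 has this origin. Turning residues by \<open>\<i> * \<beta> k\<close> leaves the real
  part of the derivative at infinity unchanged, and so do poles of order 2 and 3; these changes are
  free. What they leave of the first variation of the boundary modulus at hole k is 2 e^2 Q_k to
  leading order, where Q_k is \<open>Re (cnj (SS k) * AA k 0)\<close>. A real shift of the residues,
  proportional to -e^3 \<open>\<eta> k\<close> with \<open>\<eta> k\<close> above 2 Q_k, makes the
  variation negative. The derivative at infinity grows if the sum of the \<open>\<eta> k\<close> is
  negative, which can be arranged once the sum of the Q_k is. That sum is linear in
  \<open>\<beta>\<close>, so only its nonvanishing matters; for two poles it is zero, and a third
  pole makes the difference.\<close>

abbreviation uc :: "real \<Rightarrow> complex" where "uc t \<equiv> cis (2 * pi * t)"

text \<open>Morera's theorem: Fubini exchanges the integral over a triangle with the integral over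
  the parameter, and Cauchy's theorem annihilates each slice.\<close>

lemma holomorphic_on_integral_param:
  fixes f :: "complex \<Rightarrow> real \<Rightarrow> complex"
  assumes S: "open S"
    and cont: "continuous_on (S \<times> {0..1}) (\<lambda>(z, t). f z t)"
    and hol: "\<And>t. t \<in> {0..1} \<Longrightarrow> (\<lambda>z. f z t) holomorphic_on S"
  shows "(\<lambda>z. integral {0..1} (f z)) holomorphic_on S"
proof (rule analytic_imp_holomorphic, rule Morera_triangle[OF _ S], goal_cases)
  case 1
  show ?case
    using integral_continuous_on_param[of S 0 "1::real" f] cont by (simp add: cbox_interval)
next
  case (2 a b c)
  have seg: "contour_integral (linepath p q) (\<lambda>z. integral {0..1} (f z)) =
       integral {0..1} (\<lambda>t. contour_integral (linepath p q) (\<lambda>z. f z t))"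
      "(\<lambda>t. contour_integral (linepath p q) (\<lambda>z. f z t)) integrable_on {0..1}"
    if pq: "closed_segment p q \<subseteq> S" for p q
  proof -
    have lp: "linepath p q x \<in> S" if "x \<in> {0..1}" for x
      using that pq linepath_in_path[of x p q] by auto
    have c1: "continuous_on ({0..1} \<times> {0..1}) (\<lambda>(x, t). f (linepath p q x) t * (q - p))"
    proof -
      have "continuous_on ({0..1} \<times> {0..1}) (\<lambda>p'. (\<lambda>(z,t). f z t) (linepath p q (fst p'), snd p'))"
      proof (rule continuous_on_compose2[OF cont])
        show "continuous_on ({0..1} \<times> {0..1}) (\<lambda>p'. (linepath p q (fst p'), snd p'))"
          unfolding linepath_def by (intro continuous_intros)
      qed (use lp in auto)
      then show ?thesis by (auto simp: case_prod_unfold intro!: continuous_intros)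
    qed
    have c2: "continuous_on ({0..1} \<times> {0..1}) (\<lambda>(t, x). f (linepath p q x) t * (q - p))"
    proof -
      have "continuous_on ({0..1} \<times> {0..1}) (\<lambda>p'. (\<lambda>(x,t). f (linepath p q x) t * (q - p)) (snd p', fst p'))"
        by (rule continuous_on_compose2[OF c1]) (auto intro!: continuous_intros)
      then show ?thesis by (simp add: case_prod_unfold)
    qed
    have "integral (cbox 0 1) (\<lambda>x. integral (cbox 0 1) (\<lambda>t. f (linepath p q x) t * (q - p))) =
          integral (cbox 0 1) (\<lambda>t. integral (cbox 0 1) (\<lambda>x. f (linepath p q x) t * (q - p)))"
      by (rule integral_swap_continuous, unfold cbox_Pair_eq box_real) (rule c1)
    then show "contour_integral (linepath p q) (\<lambda>z. integral {0..1} (f z)) =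
       integral {0..1} (\<lambda>t. contour_integral (linepath p q) (\<lambda>z. f z t))"
      by (simp add: contour_integral_integral cbox_interval)
    have "continuous_on {0..1} (\<lambda>t. integral (cbox 0 1) (\<lambda>x. f (linepath p q x) t * (q - p)))"
      by (rule integral_continuous_on_param) (use c2 in \<open>simp add: cbox_interval\<close>)
    then show "(\<lambda>t. contour_integral (linepath p q) (\<lambda>z. f z t)) integrable_on {0..1}"
      by (auto simp: contour_integral_integral cbox_interval intro: integrable_continuous_real)
  qed
  show ?case
  proof
    assume hull: "convex hull {a, b, c} \<subseteq> S"
    have ab: "closed_segment a b \<subseteq> S" "closed_segment b c \<subseteq> S" "closed_segment c a \<subseteq> S"
      using hull hull_mono[of "{a,b}" "{a,b,c}" convex] hull_mono[of "{b,c}" "{a,b,c}" convex]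
        hull_mono[of "{c,a}" "{a,b,c}" convex]
      by (auto simp: segment_convex_hull)
    have z: "contour_integral (linepath a b) (\<lambda>z. f z t) + contour_integral (linepath b c) (\<lambda>z. f z t)
        + contour_integral (linepath c a) (\<lambda>z. f z t) = 0" if t: "t \<in> {0..1}" for t
    proof -
      have "(\<lambda>z. f z t) holomorphic_on (convex hull {a,b,c})"
        using hol[OF t] hull holomorphic_on_subset by blast
      from Cauchy_theorem_triangle[OF this]
      have hz: "((\<lambda>z. f z t) has_contour_integral 0) (linepath a b +++ linepath b c +++ linepath c a)" .
      have i: "(\<lambda>z. f z t) contour_integrable_on linepath p q" if "closed_segment p q \<subseteq> S" for p q
        using hol[OF t] that
        by (meson contour_integrable_continuous_linepath holomorphic_on_imp_continuous_on continuous_on_subset)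
      show ?thesis
        using contour_integral_unique[OF hz] i ab by (simp add: add.assoc)
    qed
    show "contour_integral (linepath a b) (\<lambda>z. integral {0..1} (f z)) +
      contour_integral (linepath b c) (\<lambda>z. integral {0..1} (f z)) +
      contour_integral (linepath c a) (\<lambda>z. integral {0..1} (f z)) = 0"
      unfolding seg(1)[OF ab(1)] seg(1)[OF ab(2)] seg(1)[OF ab(3)]
      using integral_cong[of "{0..1}", OF z]
      by (simp add: seg ab flip: integral_add add: integrable_add)
  qed
qed

text \<open>Up to the factor \<open>2 * pi * \<i>\<close>, contour integrals over circles are means
  of \<open>F (r * uc t) * (r * uc t)\<close>. The circle integrals below are written in this
  normalised form, in which Cauchy's formula has no constant.\<close>

lemma contour_integral_circlepath_eq:
  "contour_integral (circlepath 0 r) F = 2 * pi * \<i> * integral {0..1} (\<lambda>t. F (r * uc t) * (r * uc t))"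
proof -
  have "contour_integral (circlepath 0 r) F =
     integral {0..1} (\<lambda>t. (2 * pi * \<i>) * (F (r * uc t) * (r * uc t)))"
    unfolding contour_integral_integral
    by (intro integral_cong, unfold vector_derivative_circlepath)
       (simp add: circlepath cis_conv_exp mult_ac)
  then show ?thesis by simp
qed

lemma circle_Cauchy:
  assumes V: "V holomorphic_on ball 0 R" and r: "0 < r" "r < R" and v: "cmod v < r"
  shows "integral {0..1} (\<lambda>t. V (r * uc t) / (r * uc t - v) * (r * uc t)) = V v"
proof -
  have "((\<lambda>u. V u/(u-v)) has_contour_integral (2 * of_real pi * \<i> * V v)) (circlepath 0 r)"
    by (rule Cauchy_integral_circlepath_simple)
       (use V r v in \<open>auto intro!: holomorphic_on_subset[OF V]\<close>)
  from contour_integral_unique[OF this] show ?thesis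
    by (simp add: contour_integral_circlepath_eq)
qed

lemma circle_Cauchy0:
  fixes r R :: real
  assumes V: "V holomorphic_on ball 0 R" and r: "0 < r" "r < R"
  shows "integral {0..1} (\<lambda>t. V (r * uc t) * (r * uc t)) = 0"
proof -
  have "(V has_contour_integral 0) (circlepath 0 r)"
    by (rule Cauchy_theorem_disc_simple[OF V]) (use r in auto)
  from contour_integral_unique[OF this] show ?thesis
    by (simp add: contour_integral_circlepath_eq)
qed

lemma circle_annulus:
  fixes p q r r' :: real
  assumes F: "F holomorphic_on {v. p < cmod v \<and> cmod v < q}" and p: "0 < p"
    and r: "p < r" "r < q" "p < r'" "r' < q"
  shows "integral {0..1} (\<lambda>t. F (r * uc t) * (r * uc t)) = integral {0..1} (\<lambda>t. F (r' * uc t) * (r' * uc t))"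
proof -
  have op: "open {v::complex. p < cmod v \<and> cmod v < q}"
    by (intro open_Collect_conj open_Collect_less continuous_intros)
  have "homotopic_loops {v. p < cmod v \<and> cmod v < q} (circlepath 0 r) (circlepath 0 r')"
  proof (rule homotopic_loops_linear)
    fix t :: real assume "t \<in> {0..1}"
    show "closed_segment (circlepath 0 r t) (circlepath 0 r' t) \<subseteq> {v. p < cmod v \<and> cmod v < q}"
    proof
      fix x assume "x \<in> closed_segment (circlepath 0 r t) (circlepath 0 r' t)"
      then obtain u where u: "0 \<le> u" "u \<le> 1" "x = (1 - u) *\<^sub>R circlepath 0 r t + u *\<^sub>R circlepath 0 r' t"
        by (auto simp: closed_segment_def)
      have unit_exp: "cmod (exp (2 * of_real pi * \<i> * of_real t)) = 1"
        by (simp add: norm_exp_eq_Re)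
      have "x = of_real ((1-u) * r + u * r') * exp (2 * of_real pi * \<i> * of_real t)"
        unfolding u(3) circlepath by (simp add: algebra_simps scaleR_conv_of_real)
      then have "cmod x = \<bar>(1-u) * r + u * r'\<bar>"
        by (metis norm_mult norm_of_real unit_exp mult_1_right)
      moreover have "p < (1-u) * r + u * r'"
        using convex_bound_lt[of "-r" "-p" "-r'" "1-u" u] r u by simp
      moreover have "(1-u) * r + u * r' < q"
        using convex_bound_lt[of r q r' "1-u" u] r u by simp
      ultimately show "x \<in> {v. p < cmod v \<and> cmod v < q}" using p by auto
    qed
  qed auto
  from Cauchy_theorem_homotopic_loops[OF this op F]
  have "contour_integral (circlepath 0 r) F = contour_integral (circlepath 0 r') F" by simp
  then show ?thesis by (simp add: contour_integral_circlepath_eq)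
qed

lemma uc_nz [simp]: "cmod (uc t) = 1" "uc t \<noteq> 0" by auto

text \<open>Write the real density as \<open>V + cnj V - c\<close> on the circle. For v outside, the
  Cauchy integrals of \<open>V\<close> and of the constant c vanish. In the conjugate part
  \<open>cnj u = 1 / u\<close> moves the pole to the reflected point \<open>1 / cnj v\<close> inside
  the disc, where Cauchy's formula applies.\<close>

lemma Plemelj_outside:
  assumes V: "V holomorphic_on ball 0 R" and R: "1 < R" and v: "1 < cmod v"
  shows "integral {0..1} (\<lambda>t. uc t / (uc t - v) * of_real (2 * Re (V (uc t)) - c)) =
     cnj (V 0) - cnj (V (1 / cnj v))"
proof -
  define p where "p = 1 / cnj v"
  have v0: "v \<noteq> 0" using v by auto
  have p: "cmod p < 1" "p \<noteq> 0" using v by (auto simp: p_def norm_divide divide_simps)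
  have cV: "continuous_on {0..1} (\<lambda>t. V (uc t))"
    by (rule continuous_on_compose2[OF holomorphic_on_imp_continuous_on[OF V]])
       (use R in \<open>auto intro!: continuous_intros\<close>)
  have nv: "uc t - v \<noteq> 0" for t using v uc_nz(1)[of t] by auto
  have np: "uc t - p \<noteq> 0" for t using p uc_nz(1)[of t] by auto
  define m where "m = (1 + cmod v) / 2"
  have m: "1 < m" "m < cmod v" "0 < m" using v by (auto simp: m_def)
  have hol: "(\<lambda>w. 1 / (w - v)) holomorphic_on ball 0 (min m R)" "(\<lambda>w. V w / (w - v)) holomorphic_on ball 0 (min m R)"
    using m by (auto intro!: holomorphic_intros holomorphic_on_subset[OF V])
  have i1: "integral {0..1} (\<lambda>t. V (uc t) / (uc t - v) * uc t) = 0"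
    using circle_Cauchy0[OF hol(2), of 1] R m by simp
  have i2: "integral {0..1} (\<lambda>t. 1 / (uc t - v) * uc t) = 0"
    using circle_Cauchy0[OF hol(1), of 1] R m by simp
  have i3: "integral {0..1} (\<lambda>t. V (uc t)) = V 0"
    using circle_Cauchy[OF V, of 1 0] R by simp
  have i4: "integral {0..1} (\<lambda>t. V (uc t) / (uc t - p) * uc t) = V p"
    using circle_Cauchy[OF V, of 1 p] R p by simp
  have key: "uc t / (uc t - v) * of_real (2 * Re (V (uc t)) - c) =
     V (uc t) / (uc t - v) * uc t - c * (1 / (uc t - v) * uc t)
     + cnj (V (uc t) - V (uc t) / (uc t - p) * uc t)" for t
  proof -
    have a: "of_real (2 * Re (V (uc t)) - c) = V (uc t) + cnj (V (uc t)) - of_real c"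
      by (simp add: complex_add_cnj)
    have u: "cnj (uc t) = 1 / uc t" by (simp only: cis_cnj cis_inverse divide_inverse mult_1_left)
    have b: "cnj (uc t / (uc t - p)) = 1 - uc t / (uc t - v)"
    proof -
      have "cnj (uc t / (uc t - p)) = (1 / uc t) / (1 / uc t - 1 / v)"
        unfolding p_def complex_cnj_divide complex_cnj_diff u by simp
      also have "\<dots> = v / (v - uc t)"
        using v0 nv[of t] uc_nz(2)[of t] by (simp add: field_simps)
      also have "\<dots> = 1 - uc t / (uc t - v)" using nv[of t] by (simp add: field_simps)
      finally show ?thesis .
    qed
    have d: "cnj (V (uc t) - V (uc t) / (uc t - p) * uc t) = cnj (V (uc t)) * (1 - cnj (uc t / (uc t - p)))"
      by (simp add: algebra_simps)
    show ?thesis unfolding a d b by (simp add: algebra_simps divide_inverse)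
  qed
  have c1: "(\<lambda>t. V (uc t) / (uc t - v) * uc t) integrable_on {0..1}"
      "(\<lambda>t. 1 / (uc t - v) * uc t) integrable_on {0..1}"
      "(\<lambda>t. V (uc t)) integrable_on {0..1}"
      "(\<lambda>t. V (uc t) / (uc t - p) * uc t) integrable_on {0..1}"
    using nv np by (auto intro!: integrable_continuous_real continuous_intros cV)
  note h1 = integrable_integral[OF c1(1), unfolded i1] integrable_integral[OF c1(2), unfolded i2]
    integrable_integral[OF c1(3), unfolded i3] integrable_integral[OF c1(4), unfolded i4]
  have "((\<lambda>t. V (uc t) / (uc t - v) * uc t - of_real c * (1 / (uc t - v) * uc t)
     + cnj (V (uc t) - V (uc t) / (uc t - p) * uc t)) has_integral 0 - of_real c * 0 + cnj (V 0 - V p)) {0..1}"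
    by (intro has_integral_add has_integral_diff has_integral_mult_right h1
      has_integral_linear[OF has_integral_diff[OF h1(3,4)] bounded_linear_cnj, unfolded o_def])
  from integral_unique[OF this] show ?thesis unfolding key by (simp add: p_def)
qed

subsection \<open>Local geometry at the poles\<close>

text \<open>Distance 1 between the poles is a normalisation. The constant 1/20000 is chosen for the
  contraction: the kernel is bounded by 500 n e for each pair of holes, hence the sum over n holes
  by 500 n^2 e, which is at most 1/40.\<close>

locale poles =
  fixes n :: nat and b :: "nat \<Rightarrow> complex" and e :: real
  assumes sep: "\<And>i j. i < n \<Longrightarrow> j < n \<Longrightarrow> i \<noteq> j \<Longrightarrow> 1 \<le> cmod (b i - b j)"
    and e_pos: "0 < e" and n_pos: "0 < n"
    and n2e: "real n * (real n * e) \<le> 1 / 20000"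
begin

lemma ne: "real n * e \<le> 1 / 20000"
proof -
  have "1 * (real n * e) \<le> real n * (real n * e)"
    using n_pos e_pos by (intro mult_right_mono) auto
  with n2e show ?thesis by linarith
qed

lemma e_small: "e \<le> 1 / 20000"
proof -
  have "1 * e \<le> real n * e" using n_pos e_pos by (intro mult_right_mono) auto
  with ne show ?thesis by linarith
qed

text \<open>The real part is pinned to \<open>e\<close>, so that the only real admissible residues
  are all equal to \<open>e\<close>. The range of the imaginary part leaves room for the turning of
  the residues in \<open>as\<close>.\<close>

definition adm :: "(nat \<Rightarrow> complex) \<Rightarrow> bool" where
  "adm a \<longleftrightarrow> (\<forall>j<n. Re (a j) = e \<and> \<bar>Im (a j)\<bar> \<le> e / 2)"

text \<open>In the local coordinate \<open>x = z - b k\<close> one has \<open>ff a z = ph a k x / x\<close>. The factor \<open>Gam\<close> is the divided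
  difference of \<open>x / ph a k x\<close> up to nonvanishing factors, and \<open>zt\<close> is the derivative of the inverse \<open>Z\<close>
  of \<open>x / ph a k x\<close>. The difference \<open>b k - b j\<close> is at least \<open>1\<close>, whereas \<open>x\<close> has size \<open>e\<close>.\<close>
definition gg where "gg a k x = (\<Sum>j\<in>{..<n}-{k}. a j / (x + b k - b j))"
definition ph where "ph a k x = a k + x * gg a k x"
definition mm where "mm a k x y = (\<Sum>j\<in>{..<n}-{k}. a j / ((x + b k - b j) * (y + b k - b j)))"
definition Gam where "Gam a k x y = a k + x * y * mm a k x y"
text \<open>\<open>m1\<close> is the divided difference of \<open>ph a k\<close>, and
  \<open>y * m2 a k x y\<close> is that of \<open>Gam a k\<close> in its first argument, taken
  between x and y. They serve to remove the singularity of the diagonal kernel.\<close>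

definition m1 where
  "m1 a k x y = (\<Sum>j\<in>{..<n}-{k}. a j * (b k - b j) / ((x + b k - b j) * (y + b k - b j)))"
definition m2 where
  "m2 a k x y = (\<Sum>j\<in>{..<n}-{k}. a j * (b k - b j) / ((x + b k - b j) * (y + b k - b j)^2))"
definition zt where "zt a k y = (ph a k y)\<^sup>2 / Gam a k y y"
definition ff where "ff a z = (\<Sum>j<n. a j / (z - b j))"

lemma adm_bounds:
  assumes "adm a" "k < n" shows "e \<le> cmod (a k)" "cmod (a k) \<le> 2 * e" "a k \<noteq> 0"
proof -
  have r: "Re (a k) = e" "\<bar>Im (a k)\<bar> \<le> e / 2" using assms by (auto simp: adm_def)
  show "e \<le> cmod (a k)" using complex_Re_le_cmod[of "a k"] r by simp
  show "cmod (a k) \<le> 2 * e" using cmod_le[of "a k"] r e_pos by simp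
  show "a k \<noteq> 0" using r e_pos by auto
qed

section \<open>Size estimates near a pole\<close>

lemma dist_lower:
  assumes "k < n" "j \<in> {..<n} - {k}" "cmod x \<le> 1/2"
  shows "1/2 \<le> cmod (x + b k - b j)" "cmod (b k - b j) \<le> 2 * cmod (x + b k - b j)" "x + b k - b j \<noteq> 0"
proof -
  have s: "1 \<le> cmod (b k - b j)" using sep[of k j] assms by auto
  have "cmod (b k - b j) \<le> cmod (x + b k - b j) + cmod x"
    using norm_triangle_ineq4[of "x + b k - b j" x] by (simp add: algebra_simps)
  then show "1/2 \<le> cmod (x + b k - b j)" "cmod (b k - b j) \<le> 2 * cmod (x + b k - b j)"
    using s assms by linarith+
  then show "x + b k - b j \<noteq> 0" by auto
qed

lemma sum_bound:
  assumes "\<And>j. j \<in> {..<n} - {k} \<Longrightarrow> cmod (f j) \<le> c" "0 \<le> c"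
  shows "cmod (\<Sum>j\<in>{..<n}-{k}. f j) \<le> real n * c"
proof -
  have "cmod (\<Sum>j\<in>{..<n}-{k}. f j) \<le> real (card ({..<n}-{k})) * c"
    by (rule sum_norm_bound) (use assms in auto)
  also have "\<dots> \<le> real n * c"
    using card_mono[of "{..<n}" "{..<n}-{k}"] assms(2) by (intro mult_right_mono) auto
  finally show ?thesis .
qed

lemma quot_bound:
  fixes p q :: complex
  assumes "cmod p \<le> A" "B \<le> cmod q" "0 < B" shows "cmod (p / q) \<le> A / B"
  unfolding norm_divide using assms norm_ge_zero[of p] by (intro frac_le) linarith+

lemma gg_bound:
  assumes "adm a" "k < n" "cmod x \<le> 1/2" shows "cmod (gg a k x) \<le> 4 * (real n * e)"
proof -
  have "cmod (gg a k x) \<le> real n * (2 * e / (1/2))"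
    unfolding gg_def using e_pos assms dist_lower(1) adm_bounds(2)
    by (intro sum_bound quot_bound) auto
  then show ?thesis by simp
qed

lemma mm_bound:
  assumes "adm a" "k < n" "cmod x \<le> 1/2" "cmod y \<le> 1/2" shows "cmod (mm a k x y) \<le> 8 * (real n * e)"
proof -
  have "cmod (mm a k x y) \<le> real n * (2 * e / (1/2 * (1/2)))"
    unfolding mm_def
  proof (intro sum_bound quot_bound)
    fix j assume j: "j \<in> {..<n} - {k}"
    show "1/2 * (1/2) \<le> cmod ((x + b k - b j) * (y + b k - b j))"
      unfolding norm_mult using dist_lower(1)[OF assms(2) j] assms by (intro mult_mono) auto
  qed (use e_pos assms adm_bounds(2) in auto)
  then show ?thesis by simp
qed

lemma m1_bound:
  assumes "adm a" "k < n" "cmod x \<le> 1/2" "cmod y \<le> 1/2" shows "cmod (m1 a k x y) \<le> 8 * (real n * e)"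
proof -
  have "cmod (m1 a k x y) \<le> real n * (8 * e)"
    unfolding m1_def
  proof (intro sum_bound)
    fix j assume j: "j \<in> {..<n} - {k}"
    note d = dist_lower[OF assms(2) j]
    have "cmod (a j / (y + b k - b j)) \<le> 2 * e / (1/2)"
      using d(1) adm_bounds(2)[of a j] assms j by (intro quot_bound) auto
    \<comment> \<open>The difference \<open>b k - b j\<close> has no upper bound, so it is never
      estimated alone; together with one denominator it contributes at most the factor 2.\<close>
    moreover have "cmod ((b k - b j) / (x + b k - b j)) \<le> 2"
      using d[of x] assms by (simp add: norm_divide divide_simps)
    ultimately have "cmod (a j / (y + b k - b j)) * cmod ((b k - b j) / (x + b k - b j)) \<le> (2 * e / (1/2)) * 2"
      using e_pos by (intro mult_mono) auto
    then show "cmod (a j * (b k - b j) / ((x + b k - b j) * (y + b k - b j))) \<le> 8 * e"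
      by (simp add: norm_mult norm_divide mult_ac)
  qed (use e_pos in auto)
  then show ?thesis by simp
qed

lemma m2_bound:
  assumes "adm a" "k < n" "cmod x \<le> 1/2" "cmod y \<le> 1/2" shows "cmod (m2 a k x y) \<le> 16 * (real n * e)"
proof -
  have "cmod (m2 a k x y) \<le> real n * (16 * e)"
    unfolding m2_def
  proof (intro sum_bound)
    fix j assume j: "j \<in> {..<n} - {k}"
    note d = dist_lower[OF assms(2) j]
    have "1/2 * (1/2) \<le> cmod ((y + b k - b j)^2)"
      unfolding power2_eq_square norm_mult using d(1)[of y] assms by (intro mult_mono) auto
    then have "cmod (a j / (y + b k - b j)^2) \<le> 2 * e / (1/2 * (1/2))"
      using adm_bounds(2)[of a j] assms j by (intro quot_bound) auto
    moreover have "cmod ((b k - b j) / (x + b k - b j)) \<le> 2"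
      using d[of x] assms by (simp add: norm_divide divide_simps)
    ultimately have "cmod (a j / (y + b k - b j)^2) * cmod ((b k - b j) / (x + b k - b j)) \<le> (2 * e / (1/2*(1/2))) * 2"
      using e_pos by (intro mult_mono) auto
    then show "cmod (a j * (b k - b j) / ((x + b k - b j) * (y + b k - b j)^2)) \<le> 16 * e"
      by (simp add: norm_mult norm_divide mult_ac)
  qed (use e_pos in auto)
  then show ?thesis by simp
qed

lemma small_half: "cmod x \<le> 10 * e \<Longrightarrow> cmod x \<le> 1/2"
  using e_small by simp

text \<open>On the disc of radius \<open>10 * e\<close> the correction \<open>x * gg a k x\<close>
  is at most e/500, far below the size of the residue. The radius is generous: a solution of
  \<open>x = v * ph a k x\<close> in this disc with \<open>cmod v \<le> 2\<close> has size at most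
  4.2 e.\<close>

lemma ph_bounds:
  assumes "adm a" "k < n" "cmod x \<le> 10 * e"
  shows "cmod (ph a k x - a k) \<le> e / 50" "9/10 * e \<le> cmod (ph a k x)" "cmod (ph a k x) \<le> 21/10 * e" "ph a k x \<noteq> 0"
proof -
  have "cmod (x * gg a k x) \<le> (10 * e) * (4 * (1/20000))"
    unfolding norm_mult using gg_bound[OF assms(1,2) small_half[OF assms(3)]] ne assms e_pos
    by (intro mult_mono) auto
  then show *: "cmod (ph a k x - a k) \<le> e / 50" using e_pos by (simp add: ph_def)
  show "9/10 * e \<le> cmod (ph a k x)"
    using * norm_triangle_ineq2[of "a k" "a k - ph a k x"] adm_bounds[OF assms(1,2)] e_pos
    by (simp add: norm_minus_commute)
  then show "ph a k x \<noteq> 0" using e_pos by auto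
  show "cmod (ph a k x) \<le> 21/10 * e"
    using * norm_triangle_ineq[of "a k" "ph a k x - a k"] adm_bounds[OF assms(1,2)] e_pos by simp
qed

lemma Gam_bounds:
  assumes "adm a" "k < n" "cmod x \<le> 10 * e" "cmod y \<le> 10 * e"
  shows "cmod (Gam a k x y - a k) \<le> e / 1000" "9/10 * e \<le> cmod (Gam a k x y)" "cmod (Gam a k x y) \<le> 21/10 * e"
    "Gam a k x y \<noteq> 0"
proof -
  have "cmod (x * y * mm a k x y) \<le> ((10 * e) * (10 * (1/20000))) * (8 * (1/20000))"
    unfolding norm_mult using mm_bound[OF assms(1,2) small_half[OF assms(3)] small_half[OF assms(4)]]
      ne assms e_pos e_small by (intro mult_mono) auto
  then show *: "cmod (Gam a k x y - a k) \<le> e / 1000" using e_pos by (simp add: Gam_def)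
  show "9/10 * e \<le> cmod (Gam a k x y)"
    using * norm_triangle_ineq2[of "a k" "a k - Gam a k x y"] adm_bounds[OF assms(1,2)] e_pos
    by (simp add: norm_minus_commute)
  then show "Gam a k x y \<noteq> 0" using e_pos by auto
  show "cmod (Gam a k x y) \<le> 21/10 * e"
    using * norm_triangle_ineq[of "a k" "Gam a k x y - a k"] adm_bounds[OF assms(1,2)] e_pos by simp
qed

section \<open>The local inverse of the reciprocal of the rational function\<close>

lemma gg_diff:
  assumes "k < n" "cmod x \<le> 1/2" "cmod y \<le> 1/2"
  shows "gg a k y - gg a k x = (x - y) * mm a k x y"
  unfolding gg_def mm_def sum_distrib_left sum_subtractf[symmetric]
proof (rule sum.cong[OF refl])
  fix j assume j: "j \<in> {..<n} - {k}"
  show "a j / (y + b k - b j) - a j / (x + b k - b j) = (x - y) * (a j / ((x + b k - b j) * (y + b k - b j)))"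
    using dist_lower(3)[OF assms(1) j assms(2)] dist_lower(3)[OF assms(1) j assms(3)]
    by (simp add: divide_simps) (simp add: algebra_simps)
qed

text \<open>Dividing by \<open>ph a k x * ph a k y\<close> gives the difference of
  \<open>x / ph a k x\<close>, which is \<open>1 / ff a\<close> in the local coordinate. Since
  \<open>Gam\<close> does not vanish, injectivity, the Lipschitz estimate and the derivative of the
  inverse all follow from this one identity.\<close>

lemma ph_diff:
  assumes "k < n" "cmod x \<le> 1/2" "cmod y \<le> 1/2"
  shows "x * ph a k y - y * ph a k x = (x - y) * Gam a k x y"
proof -
  have "x * ph a k y - y * ph a k x = (x - y) * a k + x * y * (gg a k y - gg a k x)"
    by (simp add: ph_def algebra_simps)
  then show ?thesis unfolding gg_diff[OF assms] by (simp add: Gam_def algebra_simps)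
qed

text \<open>The inverse of \<open>1 / ff a\<close> near the pole \<open>b k\<close>, in the
  coordinate centred there. It is meaningful for \<open>cmod v \<le> 2\<close>: the closed unit disc
  gives the hole, the unit circle its boundary, and the annulus up to radius 2 a collar inside the
  domain.\<close>

definition Z where "Z a k v = (SOME x. cmod x < 10 * e \<and> x = v * ph a k x)"

lemma continuous_on_gg: "k < n \<Longrightarrow> continuous_on (cball 0 (1/2)) (gg a k)"
  unfolding gg_def using dist_lower(3)
  by (intro continuous_intros) auto

lemma Z_props:
  assumes "adm a" "k < n" "cmod v \<le> 2"
  shows "cmod (Z a k v) < 10 * e" "Z a k v = v * ph a k (Z a k v)"
proof -
  have *: "cball 0 (9 * e) \<subseteq> cball (0::complex) (1/2)" using e_small by auto
  \<comment> \<open>Brouwer gives existence only; uniqueness comes from \<open>Gam\<close> being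
    nonzero. The map sends the disc into radius 2 * 2.1 e, and the radius \<open>9 * e\<close> makes
    the bound \<open>10 * e\<close> strict.\<close>
  obtain x where x: "x \<in> cball 0 (9 * e)" "v * ph a k x = x"
  proof (rule brouwer_ball[of "9 * e" 0 "\<lambda>x. v * ph a k x"])
    show "continuous_on (cball 0 (9 * e)) (\<lambda>x. v * ph a k x)"
      unfolding ph_def
      by (intro continuous_intros continuous_on_subset[OF continuous_on_gg[OF assms(2)] *])
    show "(\<lambda>x. v * ph a k x) \<in> cball 0 (9 * e) \<rightarrow> cball 0 (9 * e)"
    proof
      fix x :: complex assume "x \<in> cball 0 (9 * e)"
      then have "cmod x \<le> 10 * e" using e_pos by simp
      from ph_bounds(3)[OF assms(1,2) this] have "cmod v * cmod (ph a k x) \<le> 2 * (21/10 * e)"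
        using assms(3) by (intro mult_mono) auto
      then show "v * ph a k x \<in> cball 0 (9 * e)" using e_pos by (simp add: norm_mult)
    qed
  qed (use e_pos in auto)
  then have "cmod x < 10 * e \<and> x = v * ph a k x" using e_pos by auto
  from someI[of "\<lambda>x. cmod x < 10 * e \<and> x = v * ph a k x", OF this]
  show "cmod (Z a k v) < 10 * e" "Z a k v = v * ph a k (Z a k v)" by (auto simp: Z_def)
qed

lemma Z_half: "adm a \<Longrightarrow> k < n \<Longrightarrow> cmod v \<le> 2 \<Longrightarrow> cmod (Z a k v) \<le> 1/2"
  using Z_props(1) small_half less_imp_le by blast

lemma Z_le: "adm a \<Longrightarrow> k < n \<Longrightarrow> cmod v \<le> 2 \<Longrightarrow> cmod (Z a k v) \<le> 10 * e"
  using Z_props(1) less_imp_le by blast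

lemma fixpoint_unique:
  assumes "adm a" "k < n" "cmod x \<le> 10 * e" "cmod y \<le> 10 * e" "x = v * ph a k x" "y = v * ph a k y"
  shows "x = y"
proof -
  have "x * ph a k y - y * ph a k x = 0"
    using assms(5,6) by (metis diff_self mult.commute mult.left_commute)
  with ph_diff[OF assms(2) small_half[OF assms(3)] small_half[OF assms(4)], of a]
    Gam_bounds(4)[OF assms(1-4)] show ?thesis by simp
qed

lemma Z_eqI:
  assumes "adm a" "k < n" "cmod v \<le> 2" "cmod x \<le> 10 * e" "x = v * ph a k x"
  shows "Z a k v = x"
  using fixpoint_unique[OF assms(1,2) Z_le[OF assms(1-3)] assms(4) Z_props(2)[OF assms(1-3)] assms(5)] .

lemma Z_0 [simp]: "adm a \<Longrightarrow> k < n \<Longrightarrow> Z a k 0 = 0"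
  by (rule Z_eqI) (use e_pos in auto)

lemma Z_inverse:
  assumes "adm a" "k < n" "cmod v \<le> 2" shows "v = Z a k v / ph a k (Z a k v)"
  using Z_props(2)[OF assms] ph_bounds(4)[OF assms(1,2) Z_le[OF assms]] by (metis nonzero_mult_div_cancel_right)

lemma Z_inj: "adm a \<Longrightarrow> k < n \<Longrightarrow> cmod v \<le> 2 \<Longrightarrow> cmod w \<le> 2 \<Longrightarrow> Z a k v = Z a k w \<Longrightarrow> v = w"
  using Z_inverse by metis

lemma Z_nz: "adm a \<Longrightarrow> k < n \<Longrightarrow> cmod v \<le> 2 \<Longrightarrow> v \<noteq> 0 \<Longrightarrow> Z a k v \<noteq> 0"
  using Z_inj[of a k v 0] by auto

lemma Z_diff:
  assumes "adm a" "k < n" "cmod v \<le> 2" "cmod w \<le> 2"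
  shows "Z a k w - Z a k v = (w - v) * (ph a k (Z a k w) * ph a k (Z a k v) / Gam a k (Z a k w) (Z a k v))"
proof -
  let ?x = "Z a k w" and ?y = "Z a k v"
  note le = Z_le[OF assms(1,2)]
  have "(?x - ?y) * Gam a k ?x ?y = (w * ph a k ?x) * ph a k ?y - (v * ph a k ?y) * ph a k ?x"
    using ph_diff[OF assms(2) Z_half[OF assms(1,2,4)] Z_half[OF assms(1,2,3)], of a]
      Z_props(2)[OF assms(1,2,3)] Z_props(2)[OF assms(1,2,4)] by simp
  then show ?thesis using Gam_bounds(4)[OF assms(1,2) le[OF assms(4)] le[OF assms(3)]]
    by (simp add: field_simps)
qed

text \<open>The identity for \<open>Z_diff\<close>, with a second error term for the change of
  residues. It yields joint continuity in the point and the residues, which the later dependence on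
  a parameter needs. The constant is 3 * 4, where 3 bounds the quotient of \<open>ph\<close> by
  \<open>Gam\<close>.\<close>

lemma Z_lipschitz:
  assumes a: "adm a" "adm a'" and k: "k < n" and w: "cmod w \<le> 2" "cmod w' \<le> 2"
  shows "cmod (Z a k w - Z a' k w') \<le> cmod (w - w') + 12 * (\<Sum>j<n. cmod (a j - a' j))"
proof -
  let ?x = "Z a k w" and ?y = "Z a' k w'"
  define S where "S = (\<Sum>j<n. cmod (a j - a' j))"
  have S0: "0 \<le> S" by (simp add: S_def sum_nonneg)
  have xl: "cmod ?x \<le> 10 * e" "cmod ?x \<le> 1/2" and yl: "cmod ?y \<le> 10 * e" "cmod ?y \<le> 1/2"
    using Z_le Z_half a k w by auto
  have "(?x - ?y) * Gam a k ?x ?y = ?x * ph a k ?y - ?y * ph a k ?x"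
    using ph_diff[OF k xl(2) yl(2), of a] by simp
  also have "\<dots> = (w * ph a k ?x) * ph a k ?y - (w' * ph a' k ?y) * ph a k ?x"
    using Z_props(2)[OF a(1) k w(1)] Z_props(2)[OF a(2) k w(2)] by simp
  also have "\<dots> = ph a k ?x * ((w - w') * ph a k ?y + w' * (ph a k ?y - ph a' k ?y))"
    by (simp add: algebra_simps)
  finally have eq: "?x - ?y = ph a k ?x / Gam a k ?x ?y * ((w - w') * ph a k ?y + w' * (ph a k ?y - ph a' k ?y))"
    using Gam_bounds(4)[OF a(1) k xl(1) yl(1)] by (simp add: field_simps)
  have q: "cmod (ph a k ?x / Gam a k ?x ?y) \<le> (21/10*e) / (9/10*e)"
    using ph_bounds[OF a(1) k xl(1)] Gam_bounds[OF a(1) k xl(1) yl(1)] e_pos by (intro quot_bound) auto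
  have d: "cmod (ph a k ?y - ph a' k ?y) \<le> 2 * S"
  proof -
    have "gg a k ?y - gg a' k ?y = (\<Sum>j\<in>{..<n}-{k}. (a j - a' j) / (?y + b k - b j))"
      by (simp add: gg_def sum_subtractf diff_divide_distrib)
    also have "cmod \<dots> \<le> (\<Sum>j\<in>{..<n}-{k}. 2 * cmod (a j - a' j))"
    proof (rule sum_norm_le)
      fix j assume j: "j \<in> {..<n}-{k}"
      from quot_bound[of "a j - a' j", OF order_refl dist_lower(1)[OF k j yl(2)]]
      show "cmod ((a j - a' j) / (?y + b k - b j)) \<le> 2 * cmod (a j - a' j)" by (simp add: mult.commute)
    qed
    also have "\<dots> \<le> 2 * S"
      unfolding S_def sum_distrib_left by (rule sum_mono2) auto
    finally have "cmod ?y * cmod (gg a k ?y - gg a' k ?y) \<le> 1/2 * (2 * S)"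
      using yl(2) by (intro mult_mono) auto
    moreover have "cmod (a k - a' k) \<le> S"
      unfolding S_def using k by (intro member_le_sum) auto
    moreover have "ph a k ?y - ph a' k ?y = (a k - a' k) + ?y * (gg a k ?y - gg a' k ?y)"
      by (simp add: ph_def algebra_simps)
    ultimately show ?thesis
      using norm_triangle_ineq[of "a k - a' k" "?y * (gg a k ?y - gg a' k ?y)"] by (simp add: norm_mult)
  qed
  have "cmod ((w - w') * ph a k ?y + w' * (ph a k ?y - ph a' k ?y)) \<le> cmod (w - w') * (21/10*e) + 2 * (2 * S)"
  proof (rule order_trans[OF norm_triangle_ineq add_mono])
    show "cmod ((w - w') * ph a k ?y) \<le> cmod (w - w') * (21/10*e)"
      unfolding norm_mult by (rule mult_left_mono[OF ph_bounds(3)[OF a(1) k yl(1)]]) simp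
    show "cmod (w' * (ph a k ?y - ph a' k ?y)) \<le> 2 * (2 * S)"
      unfolding norm_mult by (rule mult_mono[OF w(2) d]) auto
  qed
  then have "cmod (?x - ?y) \<le> ((21/10*e) / (9/10*e)) * (cmod (w - w') * (21/10*e) + 2 * (2 * S))"
    unfolding eq norm_mult using q e_pos by (intro mult_mono) auto
  also have "\<dots> \<le> 3 * (cmod (w - w') * (1/20) + 2 * (2 * S))"
  proof (intro mult_mono add_mono mult_left_mono)
    show "(21/10*e) / (9/10*e) \<le> 3" using e_pos by (simp add: divide_simps)
    show "21/10*e \<le> 1/20" using e_small by simp
  qed (use S0 e_pos in auto)
  also have "\<dots> \<le> cmod (w - w') + 12 * S" by simp
  finally show ?thesis by (simp add: S_def)
qed

lemma continuous_on_Z: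
  fixes A :: "'p::topological_space \<Rightarrow> nat \<Rightarrow> complex"
  assumes adm: "\<And>p. p \<in> S \<Longrightarrow> adm (A p)" and k: "k < n"
    and A: "\<And>j. j < n \<Longrightarrow> continuous_on S (\<lambda>p. A p j)"
    and w: "continuous_on S w" "\<And>p. p \<in> S \<Longrightarrow> cmod (w p) \<le> 2"
  shows "continuous_on S (\<lambda>p. Z (A p) k (w p))"
  unfolding continuous_on_def
proof
  fix q assume q: "q \<in> S"
  have "((\<lambda>p. cmod (w p - w q) + 12 * (\<Sum>j<n. cmod (A p j - A q j))) \<longlongrightarrow>
      cmod (w q - w q) + 12 * (\<Sum>j<n. cmod (A q j - A q j))) (at q within S)"
    using w A q by (intro tendsto_intros) (auto simp: continuous_on_def)
  then have "((\<lambda>p. cmod (w p - w q) + 12 * (\<Sum>j<n. cmod (A p j - A q j))) \<longlongrightarrow> 0) (at q within S)" by simp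
  then have "((\<lambda>p. Z (A p) k (w p) - Z (A q) k (w q)) \<longlongrightarrow> 0) (at q within S)"
    by (rule Lim_null_comparison[rotated])
       (use adm k w q in \<open>auto simp: eventually_at_filter intro!: always_eventually Z_lipschitz\<close>)
  then show "((\<lambda>p. Z (A p) k (w p)) \<longlongrightarrow> Z (A q) k (w q)) (at q within S)"
    by (simp add: LIM_zero_iff)
qed

lemma continuous_on_Z1: "adm a \<Longrightarrow> k < n \<Longrightarrow> continuous_on (cball 0 2) (Z a k)"
  using continuous_on_Z[of "cball 0 2" "\<lambda>_. a" k "\<lambda>v. v"] by auto

text \<open>The difference quotient is explicit by \<open>Z_diff\<close>, so its limit at equal
  arguments can be read off.\<close>

lemma Z_deriv:
  assumes a: "adm a" and k: "k < n" and v: "cmod v < 2"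
  shows "(Z a k has_field_derivative zt a k (Z a k v)) (at v)"
proof -
  have op: "open (ball (0::complex) 2)" by simp
  have vb: "v \<in> ball 0 2" using v by simp
  have cZ: "continuous_on (ball 0 2) (Z a k)"
    by (rule continuous_on_subset[OF continuous_on_Z1[OF a k]]) auto
  have h: "Z a k w \<in> cball 0 (1/2)" if "w \<in> ball 0 2" for w using Z_half[OF a k] that by simp
  have cph: "continuous_on (ball 0 2) (\<lambda>w. ph a k (Z a k w))"
    unfolding ph_def
    by (intro continuous_intros cZ continuous_on_compose2[OF continuous_on_gg[OF k] cZ]) (use h in auto)
  have cG: "continuous_on (ball 0 2) (\<lambda>w. Gam a k (Z a k w) (Z a k v))"
    unfolding Gam_def mm_def
    by (intro continuous_intros cZ) (use h[OF vb] h dist_lower(3)[OF k] in auto)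
  have lim: "((\<lambda>w. ph a k (Z a k w) * ph a k (Z a k v) / Gam a k (Z a k w) (Z a k v)) \<longlongrightarrow>
     ph a k (Z a k v) * ph a k (Z a k v) / Gam a k (Z a k v) (Z a k v)) (at v)"
    using cph cG vb op Gam_bounds(4)[OF a k Z_le[OF a k] Z_le[OF a k]] v
    by (intro tendsto_intros) (auto simp: continuous_on_eq_continuous_at[OF op] isCont_def)
  show ?thesis
    unfolding has_field_derivative_iff
  proof (rule Lim_transform_within_open[OF _ op vb])
    show "((\<lambda>w. ph a k (Z a k w) * ph a k (Z a k v) / Gam a k (Z a k w) (Z a k v)) \<longlongrightarrow> zt a k (Z a k v)) (at v)"
      using lim by (simp add: zt_def power2_eq_square)
    fix w assume "w \<in> ball 0 2" "w \<noteq> v"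
    then show "ph a k (Z a k w) * ph a k (Z a k v) / Gam a k (Z a k w) (Z a k v) = (Z a k w - Z a k v) / (w - v)"
      using Z_diff[OF a k, of v w] v by simp
  qed
qed

lemma Z_holo: "adm a \<Longrightarrow> k < n \<Longrightarrow> Z a k holomorphic_on ball 0 2"
  unfolding holomorphic_on_open[OF open_ball] using Z_deriv by force

lemma ff_local:
  assumes "k < n" "x \<noteq> 0" shows "ff a (b k + x) = ph a k x / x"
proof -
  have "ff a (b k + x) = a k / (b k + x - b k) + (\<Sum>j\<in>{..<n}-{k}. a j / (b k + x - b j))"
    unfolding ff_def using assms by (subst sum.remove[of _ k]) auto
  also have "\<dots> = a k / x + gg a k x" by (simp add: gg_def add.commute)
  also have "\<dots> = ph a k x / x" using assms by (simp add: ph_def field_simps)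
  finally show ?thesis .
qed

lemma ff_Z:
  assumes "adm a" "k < n" "cmod v \<le> 2" "v \<noteq> 0" shows "ff a (b k + Z a k v) = 1 / v"
proof -
  have "ph a k (Z a k v) / Z a k v = 1 / (Z a k v / ph a k (Z a k v))" by simp
  also have "Z a k v / ph a k (Z a k v) = v" by (rule Z_inverse[OF assms(1-3), symmetric])
  finally show ?thesis using ff_local[OF assms(2) Z_nz[OF assms]] by simp
qed

lemma far_small:
  assumes "adm a" "\<And>k. k < n \<Longrightarrow> 1/2 \<le> cmod (z - b k)" shows "cmod (ff a z) \<le> 1/1000"
proof -
  have "cmod (ff a z) \<le> real (card {..<n}) * (2 * e / (1/2))"
    unfolding ff_def
  proof (rule sum_norm_bound)
    fix k assume "k \<in> {..<n}"
    then show "cmod (a k / (z - b k)) \<le> 2 * e / (1/2)"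
      using assms adm_bounds(2)[of a k] by (intro quot_bound) auto
  qed
  then show ?thesis using ne by simp
qed

text \<open>A bootstrap: far from all poles \<open>ff a\<close> is tiny, so z is within 1/2 of some
  pole. Then \<open>x = v * ph a k x\<close> with \<open>cmod v < 2\<close> bounds x by 4 e plus a
  small multiple of its own modulus, hence by \<open>10 * e\<close>, where \<open>Z\<close> is the
  unique solution.\<close>

lemma near_pole:
  assumes a: "adm a" and z: "\<And>k. k < n \<Longrightarrow> z \<noteq> b k" and big: "1/2 < cmod (ff a z)"
  obtains k v where "k < n" "cmod v < 2" "v \<noteq> 0" "z = b k + Z a k v" "ff a z = 1 / v"
proof -
  obtain k where k: "k < n" "cmod (z - b k) < 1/2"
    using far_small[OF a, of z] big by fastforce
  define x where "x = z - b k"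
  have x: "x \<noteq> 0" "cmod x \<le> 1/2" "z = b k + x" using k z[of k] by (auto simp: x_def)
  have f: "ff a z = ph a k x / x" using ff_local[OF k(1) x(1)] x(3) by simp
  have p0: "ph a k x \<noteq> 0" using f big by auto
  define v where "v = x / ph a k x"
  have xv: "x = v * ph a k x" using p0 by (simp add: v_def)
  have fv: "ff a z = 1 / v" using f by (simp add: v_def)
  have v0: "v \<noteq> 0" using xv x(1) by auto
  have v2: "cmod v < 2" using big v0 unfolding fv by (simp add: norm_divide divide_simps)
  have "cmod (ph a k x) \<le> cmod (a k) + cmod x * cmod (gg a k x)"
    unfolding ph_def using norm_triangle_ineq by (metis norm_mult)
  also have "\<dots> \<le> 2 * e + cmod x * (4 * (1/20000))"
    using adm_bounds(2)[OF a k(1)] gg_bound[OF a k(1) x(2)] ne by (intro add_mono mult_left_mono) auto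
  finally have "cmod v * cmod (ph a k x) \<le> 2 * (2 * e + cmod x * (4 * (1/20000)))"
    using v2 by (intro mult_mono) auto
  moreover have "cmod x = cmod v * cmod (ph a k x)"
    using arg_cong[OF xv, of cmod] by (simp only: norm_mult)
  ultimately have "cmod x \<le> 2 * (2 * e + cmod x * (4 * (1/20000)))" by linarith
  then have "cmod x \<le> 10 * e" using e_pos by simp
  then have "Z a k v = x" using Z_eqI[OF a k(1) _ _ xv] v2 by simp
  then show ?thesis using that[OF k(1) v2 v0] x(3) fv by simp
qed

lemma Z_disjoint:
  assumes "adm a" "k < n" "j < n" "cmod v \<le> 2" "cmod w \<le> 2" "b k + Z a k v = b j + Z a j w"
  shows "k = j" "v = w"
proof -
  show kj: "k = j"
  proof (rule ccontr)
    assume "k \<noteq> j"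
    then have "1 \<le> cmod (b k - b j)" using sep assms by simp
    also have "b k - b j = Z a j w - Z a k v" using assms(6) by (simp add: algebra_simps)
    also have "cmod \<dots> \<le> cmod (Z a j w) + cmod (Z a k v)" by (rule norm_triangle_ineq4)
    also have "\<dots> \<le> 20 * e" using Z_le[OF assms(1,2,4)] Z_le[OF assms(1,3,5)] by simp
    finally show False using e_small by simp
  qed
  then show "v = w" using Z_inj[OF assms(1,2,4,5)] assms(6) by simp
qed

end

subsection \<open>Domains with small residues\<close>

text \<open>In the coordinate w = 1/z the limit at infinity is an ordinary derivative at 0. This
  guarantees that the \<open>Lim\<close> in \<open>deriv_inf\<close> is a genuine limit.\<close>

lemma deriv_inf_eq:
  assumes "holo_inf U g c"
  obtains D where "((\<lambda>z. z * (g z - c)) \<longlongrightarrow> D) at_infinity" "deriv_inf g c = D"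
    "((\<lambda>w. if w = 0 then c else g (1 / w)) has_field_derivative D) (at 0)"
proof -
  let ?G = "\<lambda>w. if w = 0 then c else g (1 / w)"
  obtain r where r: "0 < r" "?G holomorphic_on ball 0 r" using assms by (auto simp: holo_inf_def)
  define D where "D = deriv ?G 0"
  have d: "(?G has_field_derivative D) (at 0)"
    unfolding D_def using r by (intro holomorphic_derivI[OF r(2)]) auto
  then have "((\<lambda>h. (?G h - ?G 0) / h) \<longlongrightarrow> D) (at 0)"
    by (simp add: has_field_derivative_iff)
  then have "((\<lambda>h. (1 / h) * (g (1 / h) - c)) \<longlongrightarrow> D) (at 0)"
    by (rule Lim_transform_eventually) (auto simp: eventually_at_filter)
  then have lim: "((\<lambda>z. z * (g z - c)) \<longlongrightarrow> D) at_infinity"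
    unfolding lim_at_infinity_0 by (simp add: o_def inverse_eq_divide)
  show ?thesis
    by (rule that[OF lim _ d]) (simp add: deriv_inf_def tendsto_Lim[OF trivial_limit_at_infinity lim])
qed

text \<open>Janiszewski's theorem adds one set at a time; its hypothesis on the intersection holds
  because the intersection is empty.\<close>

lemma connected_Compl_disjoint_Union:
  fixes E :: "nat \<Rightarrow> complex set"
  assumes "\<And>k. k < m \<Longrightarrow> compact (E k)" "\<And>k. k < m \<Longrightarrow> connected (- E k)"
    and "\<And>i j. i < m \<Longrightarrow> j < m \<Longrightarrow> i \<noteq> j \<Longrightarrow> E i \<inter> E j = {}"
  shows "connected (- (\<Union>k<m. E k))"
  using assms
proof (induction m)
  case (Suc m)
  have "connected (- (E m \<union> (\<Union>k<m. E k)))"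
  proof (rule Janiszewski_connected)
    show "closed (\<Union>k<m. E k)" using Suc.prems by (intro closed_UN) (auto intro: compact_imp_closed)
    have "E m \<inter> E k = {}" if "k < m" for k using Suc.prems(3)[of m k] that by simp
    then have "E m \<inter> (\<Union>k<m. E k) = {}" by blast
    then show "connected (E m \<inter> (\<Union>k<m. E k))" by simp
  qed (use Suc in auto)
  moreover have "(\<Union>k<Suc m. E k) = E m \<union> (\<Union>k<m. E k)" by (auto simp: less_Suc_eq)
  ultimately show ?case by simp
qed auto

context poles
begin

text \<open>The poles have to be excluded by hand: since division by zero gives 0,
  \<open>ff a\<close> takes a small value at each of them.\<close>

definition X where "X a = {z. (\<forall>k<n. z \<noteq> b k) \<and> cmod (ff a z) < 1}"

abbreviation al where "al a \<equiv> map a [0..<n]"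
abbreviation bl where "bl \<equiv> map b [0..<n]"

lemma Rab_eq: "Rab (al a) bl z = ff a z"
  by (simp add: Rab_def ff_def)

lemma preimage_disk_eq: "preimage_disk (al a) bl = X a"
  by (auto simp: preimage_disk_def X_def Rab_eq)

lemma X_local:
  assumes "adm a" "k < n" "cmod v \<le> 2" shows "b k + Z a k v \<in> X a \<longleftrightarrow> 1 < cmod v"
proof (cases "v = 0")
  case True
  then show ?thesis using assms by (auto simp: X_def)
next
  case False
  have "b k + Z a k v \<noteq> b j" if "j < n" for j
    using Z_disjoint[OF assms(1,2) that assms(3), of 0] assms(1) that False by auto
  moreover have "cmod (ff a (b k + Z a k v)) = 1 / cmod v"
    unfolding ff_Z[OF assms False] by (simp add: norm_divide)
  ultimately show ?thesis using False by (auto simp: X_def)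
qed

definition E where "E a k = (\<lambda>v. b k + Z a k v) ` cball 0 1"

lemma X_Compl: assumes "adm a" shows "- X a = (\<Union>k<n. E a k)"
proof (intro equalityI subsetI)
  fix z assume z: "z \<in> - X a"
  show "z \<in> (\<Union>k<n. E a k)"
  proof (cases "\<exists>k<n. z = b k")
    case True
    then obtain k where k: "k < n" "z = b k + Z a k 0" using assms by auto
    have "z \<in> E a k" unfolding E_def k(2) by (intro imageI) simp
    then show ?thesis using k(1) by blast
  next
    case False
    then have f: "1 \<le> cmod (ff a z)" using z by (auto simp: X_def)
    obtain k v where kv: "k < n" "cmod v < 2" "v \<noteq> 0" "z = b k + Z a k v" "ff a z = 1 / v"
      using near_pole[OF assms, of z] False f by auto
    have "cmod v \<le> 1" using f kv(3,5) by (simp add: norm_divide divide_simps)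
    then have "z \<in> E a k" unfolding E_def kv(4) by (intro imageI) simp
    then show ?thesis using kv(1) by blast
  qed
next
  fix z assume "z \<in> (\<Union>k<n. E a k)"
  then obtain k v where "k < n" "cmod v \<le> 1" "z = b k + Z a k v" by (auto simp: E_def)
  then show "z \<in> - X a" using X_local[OF assms, of k v] by auto
qed

lemma contin_bZ: "adm a \<Longrightarrow> k < n \<Longrightarrow> continuous_on (cball 0 2) (\<lambda>v. b k + Z a k v)"
  by (intro continuous_intros continuous_on_Z1)

lemma holo_bZ: "adm a \<Longrightarrow> k < n \<Longrightarrow> (\<lambda>v. b k + Z a k v) holomorphic_on ball 0 2"
  by (intro holomorphic_intros Z_holo)

lemma inj_bZ: "adm a \<Longrightarrow> k < n \<Longrightarrow> inj_on (\<lambda>v. b k + Z a k v) (cball 0 2)"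
  by (rule inj_onI) (auto dest: Z_inj)

lemma compact_E: "adm a \<Longrightarrow> k < n \<Longrightarrow> compact (E a k)"
  unfolding E_def by (rule compact_continuous_image[OF continuous_on_subset[OF contin_bZ]]) auto

lemma E_disjoint: "adm a \<Longrightarrow> i < n \<Longrightarrow> j < n \<Longrightarrow> i \<noteq> j \<Longrightarrow> E a i \<inter> E a j = {}"
  unfolding E_def using Z_disjoint(1)[of a i j] by fastforce

lemma connected_Compl_E: assumes "adm a" "k < n" shows "connected (- E a k)"
proof (rule connected_complement_homeomorphic_convex_compact)
  have "cball (0::complex) 1 homeomorphic E a k"
    by (rule homeomorphic_compact[of _ "\<lambda>v. b k + Z a k v"])
       (use assms in \<open>auto simp: E_def intro!: continuous_on_subset[OF contin_bZ] inj_on_subset[OF inj_bZ]\<close>)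
  then show "E a k homeomorphic cball (0::complex) 1" using homeomorphic_sym by blast
qed auto

lemma connected_X: assumes "adm a" shows "connected (X a)"
proof -
  have "connected (- (\<Union>k<n. E a k))"
    by (rule connected_Compl_disjoint_Union)
       (use assms compact_E connected_Compl_E E_disjoint in auto)
  then show ?thesis using X_Compl[OF assms] by (metis double_complement)
qed

lemma bounded_Compl_X: "adm a \<Longrightarrow> bounded (- X a)"
  unfolding X_Compl by (intro bounded_UN) (auto intro: compact_imp_bounded compact_E)

lemma open_X: assumes "adm a" shows "open (X a)"
proof -
  have "closed (- X a)" unfolding X_Compl[OF assms]
    by (intro closed_UN) (auto intro: compact_imp_closed compact_E assms)
  then show ?thesis by (simp add: closed_def)
qed

text \<open>The image of the open unit disc is open by the open mapping theorem and misses
  \<open>X a\<close>, so only \<open>cmod v = 1\<close> remains; conversely such points are limits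
  of points with \<open>cmod v > 1\<close>.\<close>

lemma frontier_X:
  assumes "adm a" shows "frontier (X a) = (\<Union>k<n. (\<lambda>v. b k + Z a k v) ` sphere 0 1)"
proof -
  have fr: "frontier (X a) = closure (X a) - X a"
    using open_X[OF assms] by (simp add: frontier_def interior_open)
  show ?thesis unfolding fr
  proof (intro equalityI subsetI)
    fix z assume z: "z \<in> closure (X a) - X a"
    then have "z \<in> (\<Union>k<n. E a k)" using X_Compl[OF assms] by blast
    then obtain k v where kv: "k < n" "cmod v \<le> 1" "z = b k + Z a k v" by (auto simp: E_def)
    have "cmod v = 1"
    proof (rule ccontr)
      assume "cmod v \<noteq> 1"
      then have v: "v \<in> ball 0 1" using kv by simp
      have op: "open ((\<lambda>v. b k + Z a k v) ` ball 0 1)"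
        by (rule open_mapping_thm3)
          (use assms kv in \<open>auto intro: holomorphic_on_subset[OF holo_bZ] inj_on_subset[OF inj_bZ]\<close>)
      moreover have "(\<lambda>v. b k + Z a k v) ` ball 0 1 \<inter> X a = {}"
        using X_local[OF assms kv(1)] by auto
      ultimately have "(\<lambda>v. b k + Z a k v) ` ball 0 1 \<inter> closure (X a) = {}"
        using open_Int_closure_eq_empty by blast
      moreover have "z \<in> (\<lambda>v. b k + Z a k v) ` ball 0 1" unfolding kv(3) using v by (rule imageI)
      ultimately show False using z by blast
    qed
    then have "z \<in> (\<lambda>v. b k + Z a k v) ` sphere 0 1" unfolding kv(3) by (intro imageI) simp
    then show "z \<in> (\<Union>k<n. (\<lambda>v. b k + Z a k v) ` sphere 0 1)" using kv(1) by blast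
  next
    fix z assume "z \<in> (\<Union>k<n. (\<lambda>v. b k + Z a k v) ` sphere 0 1)"
    then obtain k v where kv: "k < n" "cmod v = 1" "z = b k + Z a k v" by auto
    have n: "z \<notin> X a" using X_local[OF assms kv(1), of v] kv by simp
    have "(\<lambda>v. b k + Z a k v) ` closure {w. 1 < cmod w \<and> cmod w < 2} \<subseteq> closure (X a)"
    proof (rule image_closure_subset)
      have "closure {w::complex. 1 < cmod w \<and> cmod w < 2} \<subseteq> cball 0 2"
        by (rule closure_minimal) auto
      then show "continuous_on (closure {w. 1 < cmod w \<and> cmod w < 2}) (\<lambda>v. b k + Z a k v)"
        by (rule continuous_on_subset[OF contin_bZ[OF assms kv(1)]])
      have "b k + Z a k w \<in> X a" if "1 < cmod w \<and> cmod w < 2" for w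
        using X_local[OF assms kv(1), of w] that by simp
      then show "(\<lambda>v. b k + Z a k v) ` {w. 1 < cmod w \<and> cmod w < 2} \<subseteq> closure (X a)"
        using closure_subset by blast
    qed auto
    moreover have "v \<in> closure {w. 1 < cmod w \<and> cmod w < 2}"
    proof (rule closure_sequential[THEN iffD2], intro exI conjI allI)
      fix m :: nat
      \<comment> \<open>The shift by 2 keeps the factor at most 3/2, inside the range of
        \<open>Z\<close>.\<close>
      have "cmod ((1 + 1 / real (m + 2)) *\<^sub>R v) = 1 + 1 / real (m + 2)" using kv by simp
      then show "(1 + 1 / real (m + 2)) *\<^sub>R v \<in> {w. 1 < cmod w \<and> cmod w < 2}"
        unfolding mem_Collect_eq by (auto simp: field_simps)
    next
      have "(\<lambda>m. 1 / real (m + 2)) \<longlonglongrightarrow> 0"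
        by (rule LIMSEQ_ignore_initial_segment[OF lim_1_over_n])
      then have "(\<lambda>m. (1 + 1 / real (m + 2)) *\<^sub>R v) \<longlonglongrightarrow> (1 + 0) *\<^sub>R v"
        by (intro tendsto_intros)
      then show "(\<lambda>m. (1 + 1 / real (m + 2)) *\<^sub>R v) \<longlonglongrightarrow> v" by simp
    qed
    ultimately have "z \<in> closure (X a)" unfolding kv(3) by blast
    then show "z \<in> closure (X a) - X a" using n by blast
  qed
qed

lemma degree_ff: assumes "adm a" shows "rat_fun_degree (ff a) n"
proof -
  define L where "L i = [:- b i, 1:]" for i
  define P where "P = (\<Sum>j<n. smult (a j) (\<Prod>i\<in>{..<n}-{j}. L i))"
  define Q where "Q = (\<Prod>i<n. L i)"
  have pQ: "poly Q z = (\<Prod>i<n. z - b i)" for z by (simp add: Q_def L_def poly_prod)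
  have pP: "poly P z = (\<Sum>j<n. a j * (\<Prod>i\<in>{..<n}-{j}. z - b i))" for z
    by (simp add: P_def L_def poly_sum poly_prod)
  have L0: "L i \<noteq> 0" for i by (simp add: L_def)
  have Q0: "Q \<noteq> 0" using L0 by (simp add: Q_def)
  have dQ: "degree Q = n"
    unfolding Q_def using L0 by (subst degree_prod_eq_sum_degree) (auto simp: L_def)
  have dP: "degree P \<le> n" unfolding P_def
  proof (rule degree_sum_le)
    fix j assume "j \<in> {..<n}"
    have "degree (\<Prod>i\<in>{..<n}-{j}. L i) = card ({..<n} - {j})"
      using L0 by (subst degree_prod_eq_sum_degree) (auto simp: L_def)
    also have "\<dots> \<le> n" using card_mono[of "{..<n}" "{..<n}-{j}"] by auto
    finally show "degree (smult (a j) (\<Prod>i\<in>{..<n}-{j}. L i)) \<le> n"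
      using degree_smult_le order_trans by blast
  qed auto
  have Pb: "poly P (b i) \<noteq> 0" if i: "i < n" for i
  proof -
    have "poly P (b i) = a i * (\<Prod>l\<in>{..<n}-{i}. b i - b l)"
      unfolding pP
    proof (subst sum.remove[of _ i])
      have "(\<Sum>j\<in>{..<n}-{i}. a j * (\<Prod>l\<in>{..<n}-{j}. b i - b l)) = 0"
        using i by (intro sum.neutral) auto
      then show "a i * (\<Prod>l\<in>{..<n}-{i}. b i - b l) + (\<Sum>j\<in>{..<n}-{i}. a j * (\<Prod>l\<in>{..<n}-{j}. b i - b l))
         = a i * (\<Prod>l\<in>{..<n}-{i}. b i - b l)" by simp
    qed (use i in auto)
    also have "\<dots> \<noteq> 0" using adm_bounds(3)[OF assms i] sep[OF i] by force
    finally show ?thesis .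
  qed
  \<comment> \<open>A nonconstant common divisor would have a root. As a root of \<open>Q\<close> it
    is one of the poles, and there \<open>P\<close> does not vanish, its value being the residue
    times a product of pole differences.\<close>
  have cop: "coprime P Q"
  proof (rule coprimeI)
    fix c assume c: "c dvd P" "c dvd Q"
    have c0: "c \<noteq> 0" using c(2) Q0 by auto
    have "degree c = 0"
    proof (rule ccontr)
      assume "degree c \<noteq> 0"
      then have "\<not> constant (poly c)" by (simp add: constant_degree)
      then obtain z where z: "poly c z = 0" using fundamental_theorem_of_algebra by auto
      have "poly P z = 0" "poly Q z = 0" using c z by (auto elim!: dvdE)
      then show False using Pb by (auto simp: pQ)
    qed
    then show "is_unit c" using c0 by (simp add: is_unit_iff_degree)
  qed
  have "ff a z = poly P z / poly Q z" if "poly Q z \<noteq> 0" for z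
  proof -
    have z: "z - b i \<noteq> 0" if "i < n" for i using \<open>poly Q z \<noteq> 0\<close> that by (auto simp: pQ)
    have "a j / (z - b j) = a j * (\<Prod>i\<in>{..<n}-{j}. z - b i) / poly Q z" if j: "j < n" for j
    proof -
      have "poly Q z = (z - b j) * (\<Prod>i\<in>{..<n}-{j}. z - b i)"
        unfolding pQ using j by (intro prod.remove) auto
      then show ?thesis using z[OF j] that \<open>poly Q z \<noteq> 0\<close> by (simp add: divide_simps)
    qed
    then show ?thesis by (simp add: ff_def pP sum_divide_distrib)
  qed
  then show ?thesis unfolding rat_fun_degree_def
    using Q0 cop dQ dP by (intro exI[of _ P] exI[of _ Q]) auto
qed

lemma mem_Rset:
  assumes "adm a" "(\<Sum>j<n. b j) = 0" shows "(al a, bl) \<in> Rset n"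
proof -
  have R: "Rab (al a) bl = ff a" using Rab_eq by auto
  have "sum_list bl = 0" using assms(2) by (simp add: sum_list_sum_nth atLeast0LessThan)
  moreover have "\<exists>C :: nat \<Rightarrow> complex set. (\<forall>i<n. analytic_jordan_curve (C i)) \<and>
          (\<forall>i<n. \<forall>j<n. i \<noteq> j \<longrightarrow> C i \<inter> C j = {}) \<and> frontier (X a) = (\<Union>i<n. C i)"
  proof (intro exI conjI allI impI)
    show "frontier (X a) = (\<Union>k<n. (\<lambda>v. b k + Z a k v) ` sphere 0 1)" by (rule frontier_X[OF assms(1)])
    fix i assume i: "i < n"
    show "analytic_jordan_curve ((\<lambda>v. b i + Z a i v) ` sphere 0 1)"
      unfolding analytic_jordan_curve_def
      by (rule exI[of _ "\<lambda>v. b i + Z a i v"], rule exI[of _ "ball 0 2"])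
         (use assms(1) i in \<open>auto intro: holo_bZ inj_on_subset[OF inj_bZ]\<close>)
    fix j assume j: "j < n" "i \<noteq> j"
    have "(\<lambda>v. b i + Z a i v) ` sphere 0 1 \<subseteq> E a i" "(\<lambda>v. b j + Z a j v) ` sphere 0 1 \<subseteq> E a j"
      by (auto simp: E_def)
    then show "(\<lambda>v. b i + Z a i v) ` sphere 0 1 \<inter> (\<lambda>v. b j + Z a j v) ` sphere 0 1 = {}"
      using E_disjoint[OF assms(1) i j] by blast
  qed
  ultimately show ?thesis
    using degree_ff[OF assms(1)] connected_X[OF assms(1)] by (simp add: Rset_def preimage_disk_eq R)
qed

lemma ff_holo: "ff a holomorphic_on X a"
  unfolding ff_def by (intro holomorphic_intros) (auto simp: X_def)

lemma X_nhd_infinity: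
  assumes "adm a" obtains r where "0 < r" "\<And>w. 0 < cmod w \<Longrightarrow> cmod w < r \<Longrightarrow> 1 / w \<in> X a"
    "\<And>w j. cmod w < r \<Longrightarrow> j < n \<Longrightarrow> 1 - b j * w \<noteq> 0"
proof -
  obtain M where M: "0 < M" "\<And>z. z \<in> - X a \<Longrightarrow> cmod z \<le> M"
    using bounded_Compl_X[OF assms] by (meson bounded_pos)
  show ?thesis
  proof (rule that[of "1 / M"])
    fix w :: complex assume w: "0 < cmod w" "cmod w < 1 / M"
    then have "M < cmod (1 / w)" using M by (simp add: norm_divide field_simps)
    then show "1 / w \<in> X a" using M(2)[of "1 / w"] by force
  next
    fix w j assume w: "cmod w < 1 / M" "j < n"
    have "b j \<notin> X a" using w by (auto simp: X_def)
    then have "cmod (b j) \<le> M" using M(2) by auto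
    then have "cmod (b j * w) \<le> M * cmod w" by (simp add: norm_mult mult_right_mono)
    also have "\<dots> < 1" using w M by (simp add: field_simps)
    finally show "1 - b j * w \<noteq> 0" by auto
  qed (use M in auto)
qed

lemma holo_inf_ff: assumes "adm a" shows "holo_inf (X a) (ff a) 0"
proof -
  obtain r where r: "0 < r" "\<And>w. 0 < cmod w \<Longrightarrow> cmod w < r \<Longrightarrow> 1 / w \<in> X a"
    "\<And>w j. cmod w < r \<Longrightarrow> j < n \<Longrightarrow> 1 - b j * w \<noteq> 0" using X_nhd_infinity[OF assms] by metis
  have eq: "(if w = 0 then 0 else ff a (1 / w)) = (\<Sum>j<n. a j * w / (1 - b j * w))" if "w \<in> ball 0 r" for w
  proof (cases "w = 0")
    case False
    have "1 / w - b j = (1 - b j * w) / w" for j using False by (simp add: field_simps)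
    then show ?thesis using False by (simp add: ff_def)
  qed auto
  have "(\<lambda>w. \<Sum>j<n. a j * w / (1 - b j * w)) holomorphic_on ball 0 r"
    using r(3) by (intro holomorphic_intros) auto
  then have "(\<lambda>w. if w = 0 then 0 else ff a (1 / w)) holomorphic_on ball 0 r"
    by (rule holomorphic_transform) (use eq in auto)
  then show ?thesis using r ff_holo by (auto simp: holo_inf_def)
qed

lemma tendsto_ff: "((\<lambda>z. z * ff a z) \<longlongrightarrow> (\<Sum>j<n. a j)) at_infinity"
proof -
  have "((\<lambda>w. \<Sum>j<n. a j / (1 - b j * w)) \<longlongrightarrow> (\<Sum>j<n. a j / (1 - b j * 0))) (at 0)"
    by (intro tendsto_intros) auto
  then have "((\<lambda>w. \<Sum>j<n. a j / (1 - b j * w)) \<longlongrightarrow> (\<Sum>j<n. a j)) (at 0)" by simp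
  then have "((\<lambda>w. inverse w * ff a (inverse w)) \<longlongrightarrow> (\<Sum>j<n. a j)) (at 0)"
  proof (rule Lim_transform_eventually)
    have "(\<Sum>j<n. a j / (1 - b j * w)) = inverse w * ff a (inverse w)" if "w \<noteq> 0" for w
    proof -
      have "inverse w - b j = (1 - b j * w) / w" for j using that by (simp add: field_simps)
      then show ?thesis using that by (simp add: ff_def sum_distrib_left inverse_eq_divide)
    qed
    then show "\<forall>\<^sub>F w in at 0. (\<Sum>j<n. a j / (1 - b j * w)) = inverse w * ff a (inverse w)"
      by (auto simp: eventually_at_filter)
  qed
  then show ?thesis unfolding lim_at_infinity_0 by (simp add: o_def)
qed

lemma deriv_inf_ff: "deriv_inf (ff a) 0 = (\<Sum>j<n. a j)"
  using tendsto_Lim[OF trivial_limit_at_infinity tendsto_ff[of a]] by (simp add: deriv_inf_def)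

end

subsection \<open>The residue theorem in the exterior domain\<close>

lemma annulus_Cauchy:
  fixes p q r1 r2 :: real
  assumes Q: "Q holomorphic_on {v. p < cmod v \<and> cmod v < q}" and p: "0 < p"
    and r: "p < r1" "r1 < cmod v0" "cmod v0 < r2" "r2 < q"
  shows "integral {0..1} (\<lambda>t. Q (r2 * uc t) / (r2 * uc t - v0) * (r2 * uc t)) =
    integral {0..1} (\<lambda>t. Q (r1 * uc t) / (r1 * uc t - v0) * (r1 * uc t)) + Q v0"
proof -
  let ?S = "{v::complex. p < cmod v \<and> cmod v < q}"
  have op: "open ?S"
    by (intro open_Collect_conj open_Collect_less continuous_intros)
  let ?G = "\<lambda>z. if z = v0 then deriv Q v0 else Q z / (z - v0) - Q v0 / (z - v0)"
  have G: "?G holomorphic_on ?S"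
    by (rule pole_theorem_open[OF Q op]) auto
  have cQ: "continuous_on {0..1} (\<lambda>t. Q (r * uc t))" if "p < r" "r < q" for r :: real
    by (rule continuous_on_compose2[OF holomorphic_on_imp_continuous_on[OF Q]])
       (use that p in \<open>auto intro!: continuous_intros simp: norm_mult\<close>)
  have ne: "of_real r * uc t - v0 \<noteq> 0" if "r = r1 \<or> r = r2" for r t
  proof
    assume "of_real r * uc t - v0 = 0"
    then have "v0 = of_real r * uc t" by simp
    then have "cmod v0 = \<bar>r\<bar>" by (simp add: norm_mult)
    then show False using that r p by auto
  qed
  have split: "integral {0..1} (\<lambda>t. ?G (r * uc t) * (r * uc t)) =
      integral {0..1} (\<lambda>t. Q (r * uc t) / (r * uc t - v0) * (r * uc t))
      - Q v0 * integral {0..1} (\<lambda>t. 1 / (r * uc t - v0) * (r * uc t))"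
    if "r = r1 \<or> r = r2" for r :: real
  proof -
    have "integral {0..1} (\<lambda>t. ?G (r * uc t) * (r * uc t)) =
        integral {0..1} (\<lambda>t. Q (r * uc t) / (r * uc t - v0) * (r * uc t)
          - Q v0 * (1 / (r * uc t - v0) * (r * uc t)))"
      using ne[OF that] by (intro integral_cong) (auto simp: algebra_simps)
    also have "\<dots> = integral {0..1} (\<lambda>t. Q (r * uc t) / (r * uc t - v0) * (r * uc t))
        - integral {0..1} (\<lambda>t. Q v0 * (1 / (r * uc t - v0) * (r * uc t)))"
      using that r ne[OF that]
      by (intro integral_diff integrable_continuous_real continuous_intros cQ) auto
    finally show ?thesis by (simp only: integral_mult_right)
  qed
  have o1: "integral {0..1} (\<lambda>t. 1 / (r2 * uc t - v0) * (r2 * uc t)) = 1"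
    using circle_Cauchy[of "\<lambda>_. 1" "r2 + 1" r2 v0] r p by simp
  have o2: "integral {0..1} (\<lambda>t. 1 / (r1 * uc t - v0) * (r1 * uc t)) = 0"
    by (rule circle_Cauchy0[of "\<lambda>v. 1 / (v - v0)" "cmod v0" r1])
       (use r p in \<open>auto intro!: holomorphic_intros\<close>)
  have "integral {0..1} (\<lambda>t. ?G (r1 * uc t) * (r1 * uc t)) = integral {0..1} (\<lambda>t. ?G (r2 * uc t) * (r2 * uc t))"
    by (rule circle_annulus[OF G p]) (use r in auto)
  then show ?thesis using split[of r1] split[of r2] o1 o2 by (simp add: algebra_simps)
qed

lemma Cauchy_transform_holo:
  fixes c h :: "real \<Rightarrow> complex"
  assumes c: "continuous_on {0..1} c" and h: "continuous_on {0..1} h"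
    and S: "open S" and ne: "\<And>t z. t \<in> {0..1} \<Longrightarrow> z \<in> S \<Longrightarrow> c t \<noteq> z"
  shows "(\<lambda>z. integral {0..1} (\<lambda>t. h t / (c t - z))) holomorphic_on S"
proof (rule holomorphic_on_integral_param[where f = "\<lambda>z t. h t / (c t - z)", OF S])
  have "continuous_on (S \<times> {0..1}) (\<lambda>p. h (snd p) / (c (snd p) - fst p))"
    by (intro continuous_intros continuous_on_compose2[OF h] continuous_on_compose2[OF c])
       (use ne in auto)
  then show "continuous_on (S \<times> {0..1}) (\<lambda>(z, t). h t / (c t - z))" by (simp add: case_prod_unfold)
  fix t :: real assume "t \<in> {0..1}"
  then show "(\<lambda>z. h t / (c t - z)) holomorphic_on S"
    using ne by (intro holomorphic_intros) auto
qed

text \<open>With s = 1/z the integrand becomes \<open>h t / (c t * s - 1)\<close>, which is jointly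
  continuous up to s = 0.\<close>

lemma Cauchy_transform_infinity:
  fixes c h :: "real \<Rightarrow> complex"
  assumes c: "continuous_on {0..1} c" and h: "continuous_on {0..1} h"
  shows "((\<lambda>z. z * integral {0..1} (\<lambda>t. h t / (c t - z))) \<longlongrightarrow> - integral {0..1} h) at_infinity"
proof -
  have "bounded (c ` {0..1})"
    by (intro compact_imp_bounded compact_continuous_image c) auto
  then obtain M where M: "0 < M" "\<And>t. t \<in> {0..1} \<Longrightarrow> cmod (c t) \<le> M"
    by (auto simp: bounded_pos)
  let ?B = "ball (0::complex) (1 / M)"
  have ne: "c t * s - 1 \<noteq> 0" if "t \<in> {0..1}" "s \<in> ?B" for t s
  proof
    assume "c t * s - 1 = 0"
    then have "cmod (c t) * cmod s = 1" by (metis norm_mult norm_one eq_iff_diff_eq_0)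
    moreover have "cmod (c t) * cmod s \<le> M * cmod s" using M that by (intro mult_right_mono) auto
    moreover have "M * cmod s < 1" using that M by (simp add: field_simps)
    ultimately show False by simp
  qed
  have "continuous_on (?B \<times> {0..1}) (\<lambda>p. h (snd p) / (c (snd p) * fst p - 1))"
    by (intro continuous_intros continuous_on_compose2[OF h] continuous_on_compose2[OF c])
       (use ne in auto)
  then have "continuous_on ?B (\<lambda>s. integral (cbox 0 1) (\<lambda>t. h t / (c t * s - 1)))"
    by (intro integral_continuous_on_param) (simp add: case_prod_unfold)
  then have "isCont (\<lambda>s. integral {0..1} (\<lambda>t. h t / (c t * s - 1))) 0"
    using M by (simp add: continuous_on_eq_continuous_at)
  then have lim: "((\<lambda>s. integral {0..1} (\<lambda>t. h t / (c t * s - 1))) \<longlongrightarrow> - integral {0..1} h) (at 0)"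
    by (simp add: isCont_def)
  have "((\<lambda>s. inverse s * integral {0..1} (\<lambda>t. h t / (c t - inverse s))) \<longlongrightarrow> - integral {0..1} h) (at 0)"
  proof (rule Lim_transform_eventually[OF lim])
    have "integral {0..1} (\<lambda>t. h t / (c t * s - 1)) = inverse s * integral {0..1} (\<lambda>t. h t / (c t - inverse s))"
      if "s \<noteq> 0" for s
    proof -
      have "h t / (c t * s - 1) = inverse s * (h t / (c t - inverse s))" for t
        using that by (simp add: divide_simps)
      then show ?thesis by (simp only: integral_mult_right)
    qed
    then show "\<forall>\<^sub>F s in at 0. integral {0..1} (\<lambda>t. h t / (c t * s - 1)) =
        inverse s * integral {0..1} (\<lambda>t. h t / (c t - inverse s))"
      by (auto simp: eventually_at_filter)
  qed
  then show ?thesis unfolding lim_at_infinity_0 by (simp add: o_def)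
qed

context poles
begin

lemma holo_ztZ: assumes "adm a" "k < n" shows "(\<lambda>v. zt a k (Z a k v)) holomorphic_on ball 0 2"
proof -
  have "deriv (Z a k) holomorphic_on ball 0 2" by (intro holomorphic_deriv Z_holo assms) auto
  then show ?thesis
    by (rule holomorphic_transform) (use Z_deriv[OF assms] in \<open>auto intro!: DERIV_imp_deriv\<close>)
qed

lemma zt_nz: assumes "adm a" "k < n" "cmod x \<le> 10 * e" shows "zt a k x \<noteq> 0"
  using ph_bounds(4)[OF assms] Gam_bounds(4)[OF assms assms(3)] by (simp add: zt_def)

text \<open>The contour integrals around the holes extend \<open>H\<close> to an entire function, which vanishes by Liouville.\<close>
lemma residue_infinity0:
  fixes r :: real
  assumes a: "adm a" and H: "H holomorphic_on X a"
    and L: "((\<lambda>z. z * H z) \<longlongrightarrow> L) at_infinity" and r: "1 < r" "r < 2"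
  shows "(\<Sum>k<n. integral {0..1} (\<lambda>t. H (b k + Z a k (r * uc t)) * zt a k (Z a k (r * uc t)) * (r * uc t))) = L"
proof -
  define c where "c k v = b k + Z a k v" for k v
  define P where "P k v = H (c k v) * zt a k (Z a k v)" for k v
  define An where "An = {v::complex. 1 < cmod v \<and> cmod v < 2}"
  have hc: "c k holomorphic_on ball 0 2" if "k < n" for k
    unfolding c_def by (rule holo_bZ[OF a that])
  have cX: "c k v \<in> X a" if "k < n" "v \<in> An" for k v
    unfolding c_def using X_local[OF a that(1), of v] that(2) by (auto simp: An_def)
  have hP: "P k holomorphic_on An" if "k < n" for k
  proof -
    have sub: "An \<subseteq> ball 0 2" by (auto simp: An_def)
    have "(H \<circ> c k) holomorphic_on An"
      by (rule holomorphic_on_compose_gen[OF holomorphic_on_subset[OF hc[OF that] sub] H])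
         (use cX that in auto)
    then show ?thesis unfolding P_def
      using holomorphic_on_subset[OF holo_ztZ[OF a that] sub]
      by (intro holomorphic_on_mult) (auto simp: o_def)
  qed
  have circ: "continuous_on {0..1} (\<lambda>t. F (s * uc t))" if "F holomorphic_on An" "1 < s" "s < 2" for F and s :: real
    by (rule continuous_on_compose2[OF holomorphic_on_imp_continuous_on[OF that(1)]])
       (use that in \<open>auto intro!: continuous_intros simp: An_def norm_mult\<close>)
  have hcA: "c k holomorphic_on An" if "k < n" for k
    by (rule holomorphic_on_subset[OF hc[OF that]]) (auto simp: An_def)
  \<comment> \<open>The sum of the Cauchy transforms of \<open>H\<close> along the image curves of
    the circles of radius s, pulled back by \<open>dz = zt dv\<close>.\<close>
  define C where "C s z = (\<Sum>k<n. integral {0..1} (\<lambda>t. (P k (s * uc t) * (s * uc t)) / (c k (s * uc t) - z)))"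
    for s :: real and z
  have hC: "C s holomorphic_on S"
    if S: "open S" "\<And>k v z. k < n \<Longrightarrow> cmod v = s \<Longrightarrow> z \<in> S \<Longrightarrow> c k v \<noteq> z" and s: "1 < s" "s < 2" for s :: real and S
    unfolding C_def
  proof (intro holomorphic_on_sum Cauchy_transform_holo[OF _ _ S(1)])
    fix k assume "k \<in> {..<n}"
    then have k: "k < n" by simp
    show "continuous_on {0..1} (\<lambda>t. c k (s * uc t))"
      "continuous_on {0..1} (\<lambda>t. P k (s * uc t) * (s * uc t))"
      using circ[OF hcA[OF k] s] circ[OF hP[OF k] s] by (auto intro!: continuous_intros)
    show "\<And>t z. t \<in> {0..1} \<Longrightarrow> z \<in> S \<Longrightarrow> c k (s * uc t) \<noteq> z"
      using S(2)[OF k] s by (auto simp: norm_mult)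
  qed
  have tC: "((\<lambda>z. z * C s z) \<longlongrightarrow> - (\<Sum>k<n. integral {0..1} (\<lambda>t. P k (s * uc t) * (s * uc t)))) at_infinity"
    if s: "1 < s" "s < 2" for s :: real
    unfolding C_def sum_distrib_left sum_negf[symmetric]
  proof (intro tendsto_sum Cauchy_transform_infinity)
    fix k assume "k \<in> {..<n}"
    then have k: "k < n" by simp
    show "continuous_on {0..1} (\<lambda>t. c k (s * uc t))"
      "continuous_on {0..1} (\<lambda>t. P k (s * uc t) * (s * uc t))"
      using circ[OF hcA[OF k] s] circ[OF hP[OF k] s] by (auto intro!: continuous_intros)
  qed
  define r2 where "r2 = (r + 2) / 2"
  have r2: "r < r2" "r2 < 2" "1 < r2" using r by (auto simp: r2_def field_simps)
  \<comment> \<open>Moving the integration curve of hole k across z changes the Cauchy transform by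
    \<open>H z\<close>. The other holes contribute no change, because z does not lie in their
    collars.\<close>
  have jump: "C r2 z = H z + C r z" if k: "k < n" and v0: "r < cmod v0" "cmod v0 < r2" and z: "z = c k v0" for k v0 z
  proof -
    let ?I = "\<lambda>j s. integral {0..1} (\<lambda>t. (P j (s * uc t) * (s * uc t)) / (c j (s * uc t) - z))"
    have other: "?I j r2 = ?I j r" if "j < n" "j \<noteq> k" for j
    proof -
      have "c j v \<noteq> z" if "v \<in> An" for v
        using Z_disjoint(1)[OF a \<open>j < n\<close> k, of v v0] that v0 r2 \<open>j \<noteq> k\<close> by (auto simp: c_def z An_def)
      then have "(\<lambda>v. P j v / (c j v - z)) holomorphic_on An"
        using hP[OF that(1)] hcA[OF that(1)] by (intro holomorphic_intros) auto
      from circle_annulus[OF this[unfolded An_def], of r2 r] r r2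
      show ?thesis by simp
    qed
    \<comment> \<open>The divided difference of \<open>Z\<close> at v and v0. Factoring it out turns
      the kernel into \<open>1 / (v - v0)\<close>, so that \<open>annulus_Cauchy\<close> applies in
      the flat coordinate; its value at v0 is \<open>zt\<close>, which cancels the factor in
      \<open>P\<close>.\<close>
    define q where "q v = ph a k (Z a k v) * ph a k (Z a k v0) / Gam a k (Z a k v) (Z a k v0)" for v
    have v02: "cmod v0 \<le> 2" using v0 r2 by simp
    have A2: "cmod v \<le> 2" if "v \<in> An" for v using that by (simp add: An_def)
    have q0: "q v \<noteq> 0" if "v \<in> An" for v
      unfolding q_def using ph_bounds(4)[OF a k Z_le[OF a k]] Gam_bounds(4)[OF a k Z_le[OF a k] Z_le[OF a k]] A2[OF that] v02
      by simp
    have cd: "c k v - z = (v - v0) * q v" if "v \<in> An" for v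
      using Z_diff[OF a k v02 A2[OF that]] by (simp add: c_def z q_def)
    have sub: "An \<subseteq> ball 0 2" by (auto simp: An_def)
    have hZ: "Z a k holomorphic_on An" by (rule holomorphic_on_subset[OF Z_holo[OF a k] sub])
    have half: "cmod (Z a k v) \<le> 1/2" if "v \<in> An" for v using Z_half[OF a k A2[OF that]] .
    have hq: "q holomorphic_on An"
      unfolding q_def ph_def Gam_def gg_def mm_def
    proof (intro holomorphic_intros hZ)
      fix v assume v: "v \<in> An"
      show "a k + Z a k v * Z a k v0 * (\<Sum>j\<in>{..<n} - {k}. a j / ((Z a k v + b k - b j) * (Z a k v0 + b k - b j))) \<noteq> 0"
        using Gam_bounds(4)[OF a k Z_le[OF a k A2[OF v]] Z_le[OF a k v02]] by (simp add: Gam_def mm_def)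
    qed (use dist_lower(3)[OF k _ half] dist_lower(3)[OF k _ Z_half[OF a k v02]] in auto)
    have hQ: "(\<lambda>v. P k v / q v) holomorphic_on An"
      using hP[OF k] hq q0 by (intro holomorphic_intros) auto
    have v0A: "v0 \<in> An" using v0 r r2 by (auto simp: An_def)
    have "P k v0 / q v0 = H z"
    proof -
      have "q v0 = zt a k (Z a k v0)" by (simp add: q_def zt_def power2_eq_square)
      then show ?thesis using zt_nz[OF a k Z_le[OF a k v02]] by (simp add: P_def z)
    qed
    moreover have "?I k s = integral {0..1} (\<lambda>t. P k (s * uc t) / q (s * uc t) / (s * uc t - v0) * (s * uc t))"
      if "1 < s" "s < 2" for s :: real
    proof (rule integral_cong)
      fix t :: real
      have "of_real s * uc t \<in> An" using that by (simp add: An_def norm_mult)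
      from cd[OF this] show "P k (s * uc t) * (s * uc t) / (c k (s * uc t) - z) =
          P k (s * uc t) / q (s * uc t) / (s * uc t - v0) * (s * uc t)" by simp
    qed
    ultimately have self: "?I k r2 = ?I k r + H z"
      using annulus_Cauchy[OF hQ[unfolded An_def], of r v0 r2] r r2 v0 by simp
    have "C r2 z = ?I k r2 + (\<Sum>j\<in>{..<n}-{k}. ?I j r2)" unfolding C_def using k by (intro sum.remove) auto
    also have "\<dots> = H z + (?I k r + (\<Sum>j\<in>{..<n}-{k}. ?I j r))" using self other by simp
    also have "?I k r + (\<Sum>j\<in>{..<n}-{k}. ?I j r) = C r z"
      unfolding C_def using k by (intro sum.remove[symmetric]) auto
    finally show ?thesis .
  qed
  define O1 where "O1 = - (\<Union>k<n. c k ` cball 0 r)"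
  define O2 where "O2 = (\<Union>k<n. c k ` ball 0 r2)"
  have injc: "inj_on (c k) (cball 0 2)" if "k < n" for k using inj_bZ[OF a that] by (simp add: c_def[abs_def])
  have contc: "continuous_on (cball 0 2) (c k)" if "k < n" for k using contin_bZ[OF a that] by (simp add: c_def[abs_def])
  have compc: "compact (c k ` cball 0 r)" if "k < n" for k
    by (intro compact_continuous_image continuous_on_subset[OF contc[OF that]]) (use r in auto)
  have "closed (\<Union>k<n. c k ` cball 0 r)"
    by (intro closed_UN ballI compact_imp_closed compc) auto
  then have o1: "open O1" unfolding O1_def by (rule open_Compl)
  have o2: "open O2" unfolding O2_def
  proof (intro open_UN ballI)
    fix k assume "k \<in> {..<n}"
    then have k: "k < n" by simp
    show "open (c k ` ball 0 r2)"
      by (intro open_mapping_thm3 holomorphic_on_subset[OF hc[OF k]] inj_on_subset[OF injc[OF k]])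
         (use r2 in auto)
  qed
  have O1X: "O1 \<subseteq> X a"
  proof
    fix z assume z: "z \<in> O1"
    show "z \<in> X a"
    proof (rule ccontr)
      assume "z \<notin> X a"
      then have "z \<in> (\<Union>k<n. E a k)" using X_Compl[OF a] by blast
      then obtain k v where kv: "k < n" "cmod v \<le> 1" "z = c k v" by (auto simp: E_def c_def)
      have "z \<in> c k ` cball 0 r" unfolding kv(3) using kv(2) r by (intro imageI) simp
      then show False using z kv(1) unfolding O1_def by blast
    qed
  qed
  \<comment> \<open>By \<open>jump\<close> the two formulas agree on the overlap of
    \<open>O1\<close> and \<open>O2\<close>, so the function is entire. It tends to 0 at infinity,
    and \<open>z * G z\<close> tends to L minus the sum of the contour integrals;
    \<open>G = 0\<close> then gives the claim.\<close>
  define G where "G z = (if z \<in> O1 then H z + C r z else C r2 z)" for z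
  have "C r holomorphic_on O1"
  proof (rule hC[OF o1 _ r])
    fix k v z assume kv: "k < n" "cmod v = r" "z \<in> O1"
    have "c k v \<in> c k ` cball 0 r" using kv(2) by (intro imageI) simp
    then show "c k v \<noteq> z" using kv unfolding O1_def by blast
  qed
  from holomorphic_on_add[OF holomorphic_on_subset[OF H O1X] this]
  have G1: "G holomorphic_on O1"
    by (rule holomorphic_transform) (simp add: G_def)
  have G2: "G holomorphic_on O2"
  proof (rule holomorphic_transform[OF hC[OF o2 _ r2(3,2)]])
    fix k v z assume kv: "k < n" "cmod v = r2" "z \<in> O2"
    then obtain j w where jw: "j < n" "cmod w < r2" "z = c j w" by (auto simp: O2_def)
    show "c k v \<noteq> z"
      using Z_disjoint(2)[OF a kv(1) jw(1), of v w] Z_disjoint(1)[OF a kv(1) jw(1), of v w] kv jw r2 by (auto simp: c_def)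
  next
    fix z assume "z \<in> O2"
    then obtain j w where jw: "j < n" "cmod w < r2" "z = c j w" by (auto simp: O2_def)
    show "C r2 z = G z"
    proof (cases "z \<in> O1")
      case True
      have "w \<notin> cball 0 r"
      proof
        assume "w \<in> cball 0 r"
        then have "z \<in> c j ` cball 0 r" unfolding jw(3) by (rule imageI)
        with True jw(1) show False unfolding O1_def by blast
      qed
      then have "r < cmod w" by simp
      from jump[OF jw(1) this jw(2,3)] True show ?thesis by (simp add: G_def)
    qed (simp add: G_def)
  qed
  have cover: "O1 \<union> O2 = UNIV"
  proof -
    have "z \<in> O2" if "z \<notin> O1" for z
    proof -
      from that obtain k v where kv: "k < n" "cmod v \<le> r" "z = c k v" by (auto simp: O1_def)
      have "z \<in> c k ` ball 0 r2" unfolding kv(3) using kv(2) r2 by (intro imageI) simp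
      then show ?thesis using kv(1) unfolding O2_def by blast
    qed
    then show ?thesis by blast
  qed
  have G: "G holomorphic_on UNIV"
    using holomorphic_on_Un[OF G1 G2 o1 o2] cover by simp
  have "bounded (- O1)" unfolding O1_def double_complement
    by (intro bounded_UN ballI compact_imp_bounded compc) auto
  then obtain M where M: "\<And>z. z \<in> - O1 \<Longrightarrow> cmod z \<le> M" by (auto simp: bounded_iff)
  have ev: "\<forall>\<^sub>F z in at_infinity. z \<in> O1"
    unfolding eventually_at_infinity using M by (intro exI[of _ "M + 1"]) force
  have "((\<lambda>z. z * H z + z * C r z) \<longlongrightarrow> L - (\<Sum>k<n. integral {0..1} (\<lambda>t. P k (r * uc t) * (r * uc t)))) at_infinity"
    using tendsto_add[OF L tC[OF r]] by simp
  then have zG: "((\<lambda>z. z * G z) \<longlongrightarrow> L - (\<Sum>k<n. integral {0..1} (\<lambda>t. P k (r * uc t) * (r * uc t)))) at_infinity"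
    by (rule Lim_transform_eventually) (use ev in \<open>auto elim!: eventually_mono simp: G_def algebra_simps\<close>)
  have "((\<lambda>z. inverse z * (z * G z)) \<longlongrightarrow> 0 * (L - (\<Sum>k<n. integral {0..1} (\<lambda>t. P k (r * uc t) * (r * uc t))))) at_infinity"
    by (intro tendsto_mult zG tendsto_inverse_0)
  then have "((\<lambda>z. inverse z * (z * G z)) \<longlongrightarrow> 0) at_infinity" by simp
  moreover have "\<forall>\<^sub>F z in at_infinity. inverse z * (z * G z) = G z"
    unfolding eventually_at_infinity
  proof (intro exI allI impI)
    fix z :: complex assume "1 \<le> cmod z"
    then have "z \<noteq> 0" by auto
    then show "inverse z * (z * G z) = G z" by simp
  qed
  ultimately have "(G \<longlongrightarrow> 0) at_infinity" by (rule Lim_transform_eventually)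
  then have "G z = 0" for z using Liouville_weak[OF G] by blast
  then have "((\<lambda>z::complex. 0::complex) \<longlongrightarrow> L - (\<Sum>k<n. integral {0..1} (\<lambda>t. P k (r * uc t) * (r * uc t)))) at_infinity"
    using zG by simp
  then have "L - (\<Sum>k<n. integral {0..1} (\<lambda>t. P k (r * uc t) * (r * uc t))) = 0"
    using tendsto_unique[OF trivial_limit_at_infinity _ tendsto_const] by blast
  then show ?thesis by (simp add: P_def c_def)
qed

text \<open>Subtracting the value c at infinity reduces to the previous case; c times
  \<open>zt\<close> integrates to zero over each circle, since \<open>zt\<close> after
  \<open>Z\<close> is holomorphic on the whole disc.\<close>

lemma residue_infinity:
  fixes r :: real
  assumes a: "adm a" and H: "H holomorphic_on X a"
    and L: "((\<lambda>z. z * (H z - c)) \<longlongrightarrow> L) at_infinity" and r: "1 < r" "r < 2"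
  shows "(\<Sum>k<n. integral {0..1} (\<lambda>t. H (b k + Z a k (r * uc t)) * zt a k (Z a k (r * uc t)) * (r * uc t))) = L"
proof -
  have "(\<Sum>k<n. integral {0..1} (\<lambda>t. (H (b k + Z a k (r * uc t)) - c) * zt a k (Z a k (r * uc t)) * (r * uc t))) = L"
    by (rule residue_infinity0[OF a _ L r]) (intro holomorphic_intros H)
  moreover have "integral {0..1} (\<lambda>t. (H (b k + Z a k (r * uc t)) - c) * zt a k (Z a k (r * uc t)) * (r * uc t)) =
     integral {0..1} (\<lambda>t. H (b k + Z a k (r * uc t)) * zt a k (Z a k (r * uc t)) * (r * uc t))"
    if k: "k < n" for k
  proof -
    have bnd: "of_real r * uc t \<in> ball 0 2" for t using r by (simp add: norm_mult)
    have czt: "continuous_on {0..1} (\<lambda>t. zt a k (Z a k (r * uc t)))"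
      by (rule continuous_on_compose2[OF holomorphic_on_imp_continuous_on[OF holo_ztZ[OF a k]]])
         (use bnd in \<open>auto intro!: continuous_intros\<close>)
    have bX: "b k + Z a k (r * uc t) \<in> X a" for t using X_local[OF a k, of "r * uc t"] r by (simp add: norm_mult)
    have cb: "continuous_on {0..1} (\<lambda>t. b k + Z a k (r * uc t))"
      by (rule continuous_on_compose2[OF holomorphic_on_imp_continuous_on[OF holo_bZ[OF a k]]])
         (use bnd in \<open>auto intro!: continuous_intros\<close>)
    have cH: "continuous_on {0..1} (\<lambda>t. H (b k + Z a k (r * uc t)))"
      by (rule continuous_on_compose2[OF holomorphic_on_imp_continuous_on[OF H] cb]) (use bX in auto)
    have z: "integral {0..1} (\<lambda>t. zt a k (Z a k (r * uc t)) * (r * uc t)) = 0"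
      by (rule circle_Cauchy0[OF holo_ztZ[OF a k]]) (use r in auto)
    have "integral {0..1} (\<lambda>t. (H (b k + Z a k (r * uc t)) - c) * zt a k (Z a k (r * uc t)) * (r * uc t)) =
        integral {0..1} (\<lambda>t. H (b k + Z a k (r * uc t)) * zt a k (Z a k (r * uc t)) * (r * uc t)
          - c * (zt a k (Z a k (r * uc t)) * (r * uc t)))"
      by (simp only: left_diff_distrib mult.assoc)
    also have "\<dots> =
        integral {0..1} (\<lambda>t. H (b k + Z a k (r * uc t)) * zt a k (Z a k (r * uc t)) * (r * uc t))
        - integral {0..1} (\<lambda>t. c * (zt a k (Z a k (r * uc t)) * (r * uc t)))"
      by (intro integral_diff integrable_continuous_real continuous_intros cH czt)
    also have "integral {0..1} (\<lambda>t. c * (zt a k (Z a k (r * uc t)) * (r * uc t))) = 0"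
      unfolding integral_mult_right z by simp
    finally show ?thesis by (simp only: diff_0_right)
  qed
  ultimately show ?thesis by simp
qed

end

subsection \<open>A criterion for Ahlfors functions\<close>

text \<open>The domain corresponds to radii above 1, and competitors have no boundary values.
  Identities and estimates are therefore proved for r > 1 and carried to the boundary by continuity
  of the explicit integrals.\<close>

lemma limit_at_1_eq:
  fixes F :: "real \<Rightarrow> complex"
  assumes c: "continuous_on {1..3/2} F" and e: "\<And>r. 1 < r \<Longrightarrow> r \<le> 3/2 \<Longrightarrow> F r = L"
  shows "F 1 = L"
proof -
  have "(F \<longlongrightarrow> F 1) (at 1 within {1..3/2})" using c by (simp add: continuous_on_def)
  moreover have "(F \<longlongrightarrow> L) (at 1 within {1..3/2})"
    by (rule Lim_transform_within[OF tendsto_const, of 1]) (use e in auto)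
  moreover have "at (1::real) within {1..3/2} \<noteq> bot"
    by (simp add: trivial_limit_within islimpt_Icc)
  ultimately show ?thesis using tendsto_unique by blast
qed

lemma limit_at_1_le:
  fixes F :: "real \<Rightarrow> real"
  assumes c: "continuous_on {1..3/2} F" and e: "\<And>r. 1 < r \<Longrightarrow> r \<le> 3/2 \<Longrightarrow> L \<le> F r"
  shows "L \<le> F 1"
proof (rule tendsto_lowerbound)
  show "(F \<longlongrightarrow> F 1) (at 1 within {1..3/2})" using c by (simp add: continuous_on_def)
  show "\<forall>\<^sub>F r in at 1 within {1..3/2}. L \<le> F r"
    using e by (auto simp: eventually_at_filter)
  show "at (1::real) within {1..3/2} \<noteq> bot"
    by (simp add: trivial_limit_within islimpt_Icc)
qed

lemma continuous_integral_01:
  fixes f :: "'b::topological_space \<Rightarrow> real \<Rightarrow> 'a::banach"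
  assumes "continuous_on (S \<times> {0..1}) (\<lambda>(r, t). f r t)"
  shows "continuous_on S (\<lambda>r. integral {0..1} (f r))"
  using integral_continuous_on_param[of S 0 "1::real" f] assms by simp

context poles
begin

text \<open>The Cauchy kernel \<open>w zt(v) / (z(w) - z(v))\<close> in the coordinates of the holes, minus \<open>w / (w - v)\<close> in the case
  \<open>j = k\<close>. The latter difference has a removable singularity, hence the explicit form.\<close>
definition KK where
  "KK a k j x y = (if j = k
     then x * ph a k y / (ph a k x * Gam a k y y * Gam a k x y)
       * (ph a k y * (y * m2 a k x y) - Gam a k y y * m1 a k x y)
     else x / ph a j x * zt a k y / (b j + x - (b k + y)))"

lemma ph_diff2:
  assumes k: "k < n" and h: "cmod x \<le> 1/2" "cmod y \<le> 1/2"
  shows "ph a k x - ph a k y = (x - y) * m1 a k x y"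
proof -
  have "x * gg a k x - y * gg a k y = (x - y) * m1 a k x y"
    unfolding gg_def m1_def sum_distrib_left sum_subtractf[symmetric]
  proof (rule sum.cong[OF refl])
    fix j assume j: "j \<in> {..<n} - {k}"
    show "x * (a j / (x + b k - b j)) - y * (a j / (y + b k - b j)) =
       (x - y) * (a j * (b k - b j) / ((x + b k - b j) * (y + b k - b j)))"
      using dist_lower(3)[OF k j h(1)] dist_lower(3)[OF k j h(2)]
      by (simp add: divide_simps) (simp add: algebra_simps)
  qed
  then show ?thesis by (simp add: ph_def)
qed

lemma Gam_diff:
  assumes k: "k < n" and h: "cmod x \<le> 1/2" "cmod y \<le> 1/2"
  shows "Gam a k x y - Gam a k y y = (x - y) * (y * m2 a k x y)"
proof -
  have "x * mm a k x y - y * mm a k y y = (x - y) * m2 a k x y"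
    unfolding mm_def m2_def sum_distrib_left sum_subtractf[symmetric]
  proof (rule sum.cong[OF refl])
    fix j assume j: "j \<in> {..<n} - {k}"
    have id: "x * (A / ((x + d) * (y + d))) - y * (A / ((y + d) * (y + d))) =
       (x - y) * (A * d / ((x + d) * (y + d)^2))" if "x + d \<noteq> 0" "y + d \<noteq> 0" for A d
      using that by (simp add: divide_simps power2_eq_square) (simp add: algebra_simps)
    show "x * (a j / ((x + b k - b j) * (y + b k - b j))) - y * (a j / ((y + b k - b j) * (y + b k - b j))) =
       (x - y) * (a j * (b k - b j) / ((x + b k - b j) * (y + b k - b j)^2))"
      using id[of "b k - b j" "a j"] dist_lower(3)[OF k j h(1)] dist_lower(3)[OF k j h(2)]
      by (simp add: add_diff_eq)
  qed
  then have "y * (x * mm a k x y) - y * (y * mm a k y y) = y * ((x - y) * m2 a k x y)"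
    by (metis right_diff_distrib)
  then show ?thesis by (simp add: Gam_def algebra_simps)
qed

text \<open>Over a common denominator the numerator is
  \<open>ph a k y * Gam a k x y - ph a k x * Gam a k y y\<close>, which vanishes at x = y.
  \<open>ph_diff2\<close> and \<open>Gam_diff\<close> split off the factor \<open>x - y\<close> and
  leave the expression in \<open>KK\<close>.\<close>

lemma KK_diag:
  assumes a: "adm a" and k: "k < n" and v: "cmod v \<le> 2" and w: "cmod w \<le> 2" and ne: "w \<noteq> v"
  shows "KK a k k (Z a k w) (Z a k v) = w * zt a k (Z a k v) / (Z a k w - Z a k v) - w / (w - v)"
proof -
  define x where "x = Z a k w"
  define y where "y = Z a k v"
  have h: "cmod x \<le> 1/2" "cmod y \<le> 1/2" and l: "cmod x \<le> 10 * e" "cmod y \<le> 10 * e"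
    unfolding x_def y_def by (rule Z_half[OF a k] Z_le[OF a k], fact)+
  note nz = ph_bounds(4)[OF a k l(1)] ph_bounds(4)[OF a k l(2)]
     Gam_bounds(4)[OF a k l(1,2)] Gam_bounds(4)[OF a k l(2,2)]
  have xy: "x \<noteq> y" unfolding x_def y_def using Z_inj[OF a k w v] ne by blast
  have ww: "w = x / ph a k x" unfolding x_def by (rule Z_inverse[OF a k w])
  have wv: "w - v = (x - y) * Gam a k x y / (ph a k x * ph a k y)"
    using Z_diff[OF a k v w] nz unfolding x_def[symmetric] y_def[symmetric] by (simp add: field_simps)
  have N: "ph a k y * Gam a k x y - ph a k x * Gam a k y y =
     (x - y) * (ph a k y * (y * m2 a k x y) - Gam a k y y * m1 a k x y)"
  proof -
    have "ph a k y * Gam a k x y - ph a k x * Gam a k y y =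
      ph a k y * (Gam a k x y - Gam a k y y) - (ph a k x - ph a k y) * Gam a k y y"
      by (simp add: algebra_simps)
    then show ?thesis unfolding Gam_diff[OF k h] ph_diff2[OF k h] by (simp add: algebra_simps)
  qed
  have "w * zt a k y / (x - y) - w / (w - v) =
     x * ph a k y / (ph a k x * Gam a k y y * Gam a k x y) *
      ((ph a k y * Gam a k x y - ph a k x * Gam a k y y) / (x - y))"
  proof -
    have alg: "(x / P) * (Q\<^sup>2 / G2) / (x - y) - (x / P) / ((x - y) * G1 / (P * Q)) =
        x * Q / (P * G2 * G1) * ((Q * G1 - P * G2) / (x - y))"
      if "P \<noteq> 0" "Q \<noteq> 0" "G1 \<noteq> 0" "G2 \<noteq> 0" for P Q G1 G2
      using that xy by (simp add: divide_simps power2_eq_square) (simp add: algebra_simps)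
    show ?thesis unfolding wv unfolding ww zt_def by (rule alg[OF nz])
  qed
  also have "(ph a k y * Gam a k x y - ph a k x * Gam a k y y) / (x - y) =
     ph a k y * (y * m2 a k x y) - Gam a k y y * m1 a k x y"
    unfolding N using xy by simp
  finally show ?thesis by (simp add: KK_def x_def y_def)
qed

lemma KK_off:
  assumes a: "adm a" and j: "j < n" "j \<noteq> k" and w: "cmod w \<le> 2"
  shows "KK a k j (Z a j w) y = w * zt a k y / (b j + Z a j w - (b k + y))"
  using Z_inverse[OF a j(1) w] j(2) by (simp add: KK_def)

text \<open>The Cauchy transform \<open>psi\<close> of the densities \<open>U\<close> is the Garabedian function: on the boundary
  \<open>ff a * psi dz\<close> becomes \<open>\<i> U d\<theta>\<close>.\<close>
lemma extremal:
  assumes a: "adm a"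
    and hV: "\<And>k. k < n \<Longrightarrow> V k holomorphic_on ball 0 2"
    and V0: "\<And>k. k < n \<Longrightarrow> Im (V k 0) = 0"
    and U: "\<And>k t. U k t = 2 * Re (V k (uc t)) - Re (V k 0)"
    and pos: "\<And>k t. k < n \<Longrightarrow> 0 \<le> U k t"
    and eqV: "\<And>k v. k < n \<Longrightarrow> cmod v < 2 \<Longrightarrow> V k v = zt a k (Z a k v) -
      (\<Sum>j<n. integral {0..1} (\<lambda>t. KK a k j (Z a j (uc t)) (Z a k v) * of_real (U j t)))"
  shows "is_ahlfors (X a) (ff a) 0"
proof -
  define c where "c j t = b j + Z a j (uc t)" for j t
  define h where "h j t = uc t * of_real (U j t)" for j t
  define psi where "psi z = 1 - (\<Sum>j<n. integral {0..1} (\<lambda>t. h j t / (c j t - z)))" for z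
  \<comment> \<open>The analytic continuation of \<open>U k\<close> from the unit circle to the
    collar, by reflection.\<close>
  define Uh where "Uh k v = V k v + cnj (V k (1 / cnj v)) - cnj (V k 0)" for k v
  define A where "A = (\<Sum>j<n. integral {0..1} (h j))"
  define S where "S = (\<Sum>j<n. a j)"
  define T where "T = (\<Sum>j<n. integral {0..1} (U j))"
  have cV: "continuous_on {0..1} (\<lambda>t. V k (uc t))" if "k < n" for k
    by (rule continuous_on_compose2[OF holomorphic_on_imp_continuous_on[OF hV[OF that]]])
       (auto intro!: continuous_intros)
  have cU: "continuous_on {0..1} (U k)" if "k < n" for k
  proof -
    have "U k = (\<lambda>t. 2 * Re (V k (uc t)) - Re (V k 0))" using U by auto
    then show ?thesis by (auto intro!: continuous_intros cV[OF that])
  qed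
  have cc: "continuous_on {0..1} (c k)" if "k < n" for k
    unfolding c_def
    by (rule continuous_on_compose2[OF contin_bZ[OF a that]]) (auto intro!: continuous_intros)
  have ch: "continuous_on {0..1} (h k)" if "k < n" for k
    unfolding h_def by (intro continuous_intros cU that)
  have cnX: "c k t \<notin> X a" if "k < n" for k t
    unfolding c_def using X_local[OF a that, of "uc t"] by simp
  have hpsi: "psi holomorphic_on X a"
    unfolding psi_def
  proof (intro holomorphic_on_diff holomorphic_on_sum Cauchy_transform_holo open_X[OF a] cc ch)
    fix j t z assume "j \<in> {..<n}" "z \<in> X a"
    then show "c j t \<noteq> z" using cnX by auto
  qed auto
  have psi_inf: "((\<lambda>z. z * (psi z - 1)) \<longlongrightarrow> A) at_infinity"
  proof -
    have "((\<lambda>z. - (\<Sum>j<n. z * integral {0..1} (\<lambda>t. h j t / (c j t - z)))) \<longlongrightarrow> - (\<Sum>j<n. - integral {0..1} (h j))) at_infinity"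
      by (intro tendsto_minus tendsto_sum Cauchy_transform_infinity cc ch) auto
    then show ?thesis by (simp add: psi_def A_def sum_distrib_left sum_negf)
  qed
  have psi_lim: "(psi \<longlongrightarrow> 1) at_infinity"
  proof -
    have "((\<lambda>z. inverse z * (z * (psi z - 1)) + 1) \<longlongrightarrow> 0 * A + 1) at_infinity"
      by (intro tendsto_add tendsto_mult psi_inf tendsto_inverse_0 tendsto_const)
    then have "((\<lambda>z. inverse z * (z * (psi z - 1)) + 1) \<longlongrightarrow> 1) at_infinity" by simp
    moreover have "\<forall>\<^sub>F z in at_infinity. inverse z * (z * (psi z - 1)) + 1 = psi z"
      unfolding eventually_at_infinity
    proof (intro exI allI impI)
      fix z :: complex assume "1 \<le> cmod z"
      then have "z \<noteq> 0" by auto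
      then show "inverse z * (z * (psi z - 1)) + 1 = psi z" by (simp flip: mult.assoc)
    qed
    ultimately show ?thesis by (rule Lim_transform_eventually)
  qed
  \<comment> \<open>The kernel of \<open>psi\<close> on hole k is \<open>KK\<close> plus
    \<open>uc t / (uc t - v)\<close>. The equation for \<open>V k\<close> absorbs the
    \<open>KK\<close> terms, and \<open>Plemelj_outside\<close> evaluates the rest as the reflected
    part of \<open>Uh\<close>.\<close>
  have psi_Uh: "psi (b k + Z a k v) * zt a k (Z a k v) = Uh k v" if k: "k < n" and v: "1 < cmod v" "cmod v < 2" for k v
  proof -
    define y where "y = Z a k v"
    have v2: "cmod v \<le> 2" using v by simp
    let ?K = "\<lambda>j. integral {0..1} (\<lambda>t. KK a k j (Z a j (uc t)) y * of_real (U j t))"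
    let ?J = "\<lambda>j. integral {0..1} (\<lambda>t. zt a k y * (h j t / (c j t - (b k + y))))"
    have yX: "b k + y \<in> X a" unfolding y_def using X_local[OF a k v2] v by simp
    have off: "?J j = ?K j" if "j < n" "j \<noteq> k" for j
      by (rule integral_cong) (simp add: KK_off[OF a that] c_def h_def)
    have uv: "uc t \<noteq> v" for t using v uc_nz(1)[of t] by auto
    have "?K k = integral {0..1} (\<lambda>t. zt a k y * (h k t / (c k t - (b k + y))) - uc t / (uc t - v) * of_real (U k t))"
    proof (rule integral_cong)
      fix t :: real
      show "KK a k k (Z a k (uc t)) y * of_real (U k t) =
        zt a k y * (h k t / (c k t - (b k + y))) - uc t / (uc t - v) * of_real (U k t)"
      proof -
        have K: "KK a k k (Z a k (uc t)) y = uc t * zt a k y / (Z a k (uc t) - y) - uc t / (uc t - v)"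
          unfolding y_def by (rule KK_diag[OF a k v2 _ uv]) simp
        have cz: "c k t - (b k + y) = Z a k (uc t) - y" by (simp add: c_def)
        show ?thesis unfolding K cz h_def by (simp add: left_diff_distrib right_diff_distrib mult_ac)
      qed
    qed
    also have "\<dots> = ?J k - integral {0..1} (\<lambda>t. uc t / (uc t - v) * of_real (U k t))"
    proof (intro integral_diff integrable_continuous_real continuous_intros ch cc k cU)
      show "\<forall>t\<in>{0..1}. c k t - (b k + y) \<noteq> 0" using cnX[OF k] yX by (metis eq_iff_diff_eq_0)
      show "\<forall>t\<in>{0..1}. uc t - v \<noteq> 0" using uv by auto
    qed
    also have "integral {0..1} (\<lambda>t. uc t / (uc t - v) * of_real (U k t)) = cnj (V k 0) - cnj (V k (1 / cnj v))"
      unfolding U using Plemelj_outside[OF hV[OF k] _ v(1)] by simp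
    finally have diag: "?J k = ?K k + (cnj (V k 0) - cnj (V k (1 / cnj v)))" by simp
    have "psi (b k + y) * zt a k y = zt a k y - (\<Sum>j<n. ?J j)"
      unfolding psi_def by (simp only: integral_mult_right sum_distrib_left[symmetric]) (simp add: algebra_simps)
    also have "(\<Sum>j<n. ?J j) = ?J k + (\<Sum>j\<in>{..<n}-{k}. ?J j)"
      using k by (intro sum.remove) auto
    also have "\<dots> = (?K k + (\<Sum>j\<in>{..<n}-{k}. ?K j)) + (cnj (V k 0) - cnj (V k (1 / cnj v)))"
      using off diag by simp
    also have "?K k + (\<Sum>j\<in>{..<n}-{k}. ?K j) = (\<Sum>j<n. ?K j)"
      using k by (intro sum.remove[symmetric]) auto
    finally show ?thesis using eqV[OF k v(2)] by (simp add: Uh_def y_def)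
  qed
  \<comment> \<open>The residue theorem for \<open>g * psi\<close>. The term \<open>d * A\<close>
    comes from the coefficient of 1/z in \<open>psi\<close>; it has to be removed before competitors
    that do not vanish at infinity can be treated.\<close>
  have res: "(\<Sum>k<n. integral {0..1} (\<lambda>t. g (b k + Z a k (r * uc t)) * Uh k (r * uc t) * (r * uc t))) = g1 + d * A"
    if g: "g holomorphic_on X a" and lim: "((\<lambda>z. z * (g z - d)) \<longlongrightarrow> g1) at_infinity" and r: "1 < r" "r < 2"
    for g d g1 and r :: real
  proof -
    have "((\<lambda>z. (z * (g z - d)) * psi z + d * (z * (psi z - 1))) \<longlongrightarrow> g1 * 1 + d * A) at_infinity"
      by (intro tendsto_intros lim psi_lim psi_inf)
    moreover have "(\<lambda>z. (z * (g z - d)) * psi z + d * (z * (psi z - 1))) = (\<lambda>z. z * (g z * psi z - d))"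
      by (auto simp: algebra_simps)
    ultimately have L: "((\<lambda>z. z * (g z * psi z - d)) \<longlongrightarrow> g1 + d * A) at_infinity" by simp
    have "(\<Sum>k<n. integral {0..1} (\<lambda>t. g (b k + Z a k (r * uc t)) * psi (b k + Z a k (r * uc t)) * zt a k (Z a k (r * uc t)) * (r * uc t))) = g1 + d * A"
      by (rule residue_infinity[OF a _ L r]) (intro holomorphic_on_mult g hpsi)
    moreover have "g (b k + Z a k (r * uc t)) * psi (b k + Z a k (r * uc t)) * zt a k (Z a k (r * uc t)) * (r * uc t) =
        g (b k + Z a k (r * uc t)) * Uh k (r * uc t) * (r * uc t)" if "k < n" for k t
      using psi_Uh[OF that, of "r * uc t"] r by (simp add: norm_mult mult.assoc)
    ultimately show ?thesis by simp
  qed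
  have ffZ: "ff a (b k + Z a k (r * uc t)) = 1 / (r * uc t)" if "k < n" "1 < r" "r < 2" for k t and r :: real
    using ff_Z[OF a that(1), of "r * uc t"] that by (simp add: norm_mult)
  have cUh: "continuous_on ({1..3/2} \<times> {0..1}) (\<lambda>(r, t). Uh k (of_real r * uc t))" if k: "k < n" for k
  proof -
    have c1: "continuous_on ({1..3/2} \<times> {0..1}) (\<lambda>p. V k (of_real (fst p) * uc (snd p)))"
      by (rule continuous_on_compose2[OF holomorphic_on_imp_continuous_on[OF hV[OF k]]])
         (auto intro!: continuous_intros simp: norm_mult)
    have c2: "continuous_on ({1..3/2} \<times> {0..1}) (\<lambda>p. V k (1 / cnj (of_real (fst p) * uc (snd p))))"
      by (rule continuous_on_compose2[OF holomorphic_on_imp_continuous_on[OF hV[OF k]]])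
         (auto intro!: continuous_intros simp: norm_mult norm_divide divide_simps)
    show ?thesis unfolding Uh_def case_prod_unfold by (intro continuous_intros c1 c2)
  qed
  have Uh1: "Uh k (uc t) = of_real (U k t)" if "k < n" for k t
  proof -
    have "1 / cnj (uc t) = uc t" by (simp add: cis_cnj cis_divide flip: cis_zero)
    moreover have "cnj (V k 0) = of_real (Re (V k 0))" using V0[OF that] by (simp add: complex_eq_iff)
    ultimately show ?thesis by (simp add: Uh_def U complex_add_cnj)
  qed
  \<comment> \<open>Test with \<open>ff a\<close> squared, which vanishes to second order at
    infinity and equals \<open>1 / v^2\<close> on the collar. This gives that the integrals of
    \<open>U k t / uc t\<close> sum to zero, and since \<open>U\<close> is real, conjugation turns
    the sum into \<open>A\<close>.\<close>
  have A0: "A = 0"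
  proof -
    have c0: "continuous_on {1..3/2} (\<lambda>r. \<Sum>k<n. integral {0..1} (\<lambda>t. Uh k (of_real r * uc t) / (of_real r * uc t)))"
    proof (intro continuous_intros continuous_integral_01)
      fix k assume "k \<in> {..<n}"
      then show "continuous_on ({1..3/2} \<times> {0..1}) (\<lambda>(r, t). Uh k (of_real r * uc t) / (of_real r * uc t))"
        using cUh[of k] unfolding case_prod_unfold by (intro continuous_intros) auto
    qed
    have tl: "((\<lambda>z. z * (ff a z * ff a z - 0)) \<longlongrightarrow> 0) at_infinity"
    proof -
      have "((\<lambda>z. inverse z * ((z * ff a z) * (z * ff a z))) \<longlongrightarrow> 0 * (S * S)) at_infinity"
        unfolding S_def by (intro tendsto_mult tendsto_inverse_0 tendsto_ff)
      then have "((\<lambda>z. inverse z * ((z * ff a z) * (z * ff a z))) \<longlongrightarrow> 0) at_infinity" by simp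
      moreover have "inverse z * ((z * ff a z) * (z * ff a z)) = z * (ff a z * ff a z - 0)" for z
        by (cases "z = 0") auto
      ultimately show ?thesis by simp
    qed
    have "(\<Sum>k<n. integral {0..1} (\<lambda>t. Uh k (of_real r * uc t) / (of_real r * uc t))) = 0"
      if r: "1 < r" "r \<le> 3/2" for r
    proof -
      have "(\<Sum>k<n. integral {0..1} (\<lambda>t. (ff a (b k + Z a k (r * uc t)) * ff a (b k + Z a k (r * uc t))) * Uh k (r * uc t) * (r * uc t))) = 0"
        using res[OF _ tl, of r] r holomorphic_on_mult[OF ff_holo ff_holo] by simp
      moreover have "(ff a (b k + Z a k (r * uc t)) * ff a (b k + Z a k (r * uc t))) * Uh k (r * uc t) * (r * uc t) =
          Uh k (of_real r * uc t) / (of_real r * uc t)" if "k < n" for k t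
        using ffZ[OF that, of r t] r by simp
      ultimately show ?thesis by simp
    qed
    from limit_at_1_eq[OF c0 this]
    have "(\<Sum>k<n. integral {0..1} (\<lambda>t. of_real (U k t) / uc t)) = 0" using Uh1 by simp
    then have "cnj (\<Sum>k<n. integral {0..1} (\<lambda>t. of_real (U k t) / uc t)) = 0" by simp
    then have "(\<Sum>k<n. integral {0..1} (\<lambda>t. cnj (of_real (U k t) / uc t))) = 0"
      unfolding cnj_sum integral_cnj .
    moreover have "cnj (of_real (U k t) / uc t) = h k t" for k t
    proof -
      have "cnj (1 / uc t) = uc t" by (simp add: cis_cnj cis_divide flip: cis_zero)
      then show ?thesis by (simp add: h_def divide_inverse mult.commute)
    qed
    ultimately show ?thesis by (simp add: A_def)
  qed
  \<comment> \<open>Test with \<open>ff a\<close> itself: \<open>ff a * v = 1\<close> on the collar,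
    so the sum of the residues is the total mass of the density.\<close>
  have TS: "S = of_real T"
  proof -
    have c0: "continuous_on {1..3/2} (\<lambda>r. \<Sum>k<n. integral {0..1} (\<lambda>t. Uh k (of_real r * uc t)))"
      by (intro continuous_intros continuous_integral_01 cUh) auto
    have "(\<Sum>k<n. integral {0..1} (\<lambda>t. Uh k (of_real r * uc t))) = S" if r: "1 < r" "r \<le> 3/2" for r
    proof -
      have "(\<Sum>k<n. integral {0..1} (\<lambda>t. ff a (b k + Z a k (r * uc t)) * Uh k (r * uc t) * (r * uc t))) = S"
        using res[OF ff_holo, of 0 S r] tendsto_ff[of a] r by (simp add: S_def)
      moreover have "ff a (b k + Z a k (r * uc t)) * Uh k (r * uc t) * (r * uc t) =
          Uh k (of_real r * uc t)" if "k < n" for k t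
        using ffZ[OF that, of r t] r by simp
      ultimately show ?thesis by simp
    qed
    from limit_at_1_eq[OF c0 this]
    have "S = (\<Sum>k<n. integral {0..1} (\<lambda>t. of_real (U k t)))" using Uh1 by simp
    also have "\<dots> = of_real T" unfolding T_def of_real_sum
      using integral_linear[OF integrable_continuous_real[OF cU] bounded_linear_of_real]
      by (intro sum.cong refl) (simp add: o_def)
    finally show ?thesis .
  qed
  have T0: "0 \<le> T" unfolding T_def
    by (intro sum_nonneg integral_nonneg integrable_continuous_real cU pos) auto
  \<comment> \<open>A competitor's derivative is the integral of \<open>g * uc t\<close> against the
    nonnegative density in the limit, so the total mass bounds it.\<close>
  have le: "cmod (deriv_inf g d) \<le> T"
    if g: "holo_inf (X a) g d" and b1: "\<forall>z\<in>X a. cmod (g z) \<le> 1" for g d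
  proof -
    obtain D where D: "((\<lambda>z. z * (g z - d)) \<longlongrightarrow> D) at_infinity" "deriv_inf g d = D"
      using deriv_inf_eq[OF g] by blast
    have hg: "g holomorphic_on X a" using g by (simp add: holo_inf_def)
    have c0: "continuous_on {1..3/2} (\<lambda>r. \<Sum>k<n. integral {0..1} (\<lambda>t. cmod (Uh k (of_real r * uc t)) * r))"
    proof (intro continuous_intros continuous_integral_01)
      fix k assume "k \<in> {..<n}"
      then show "continuous_on ({1..3/2} \<times> {0..1}) (\<lambda>(r, t). cmod (Uh k (of_real r * uc t)) * r)"
        using cUh[of k] unfolding case_prod_unfold by (intro continuous_intros) auto
    qed
    have "cmod D \<le> (\<Sum>k<n. integral {0..1} (\<lambda>t. cmod (Uh k (of_real r * uc t)) * r))"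
      if r: "1 < r" "r \<le> 3/2" for r
    proof -
      have Deq: "D = (\<Sum>k<n. integral {0..1} (\<lambda>t. g (b k + Z a k (r * uc t)) * Uh k (r * uc t) * (r * uc t)))"
        using res[OF hg D(1), of r] r by (simp add: A0)
      show ?thesis unfolding Deq
      proof (rule sum_norm_le)
        fix k assume "k \<in> {..<n}"
        then have k: "k < n" by simp
        have zX: "b k + Z a k (r * uc t) \<in> X a" for t
          using X_local[OF a k, of "r * uc t"] r by (simp add: norm_mult)
        have cu: "continuous_on {0..1} (\<lambda>t. Uh k (of_real r * uc t))"
          using continuous_on_compose2[OF cUh[OF k] continuous_on_Pair[OF continuous_on_const continuous_on_id],
              of r "{0..1}"] r by (simp add: image_subset_iff)
        have cb: "continuous_on {0..1} (\<lambda>t. b k + Z a k (r * uc t))"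
          by (rule continuous_on_compose2[OF contin_bZ[OF a k]])
             (use r in \<open>auto intro!: continuous_intros simp: norm_mult\<close>)
        have cg: "continuous_on {0..1} (\<lambda>t. g (b k + Z a k (r * uc t)))"
          by (rule continuous_on_compose2[OF holomorphic_on_imp_continuous_on[OF hg] cb]) (use zX in auto)
        show "cmod (integral {0..1} (\<lambda>t. g (b k + Z a k (r * uc t)) * Uh k (r * uc t) * (r * uc t)))
           \<le> integral {0..1} (\<lambda>t. cmod (Uh k (of_real r * uc t)) * r)"
        proof (rule integral_norm_bound_integral)
          fix t :: real
          have "cmod (g (b k + Z a k (r * uc t))) * (cmod (Uh k (r * uc t)) * r) \<le> 1 * (cmod (Uh k (r * uc t)) * r)"
            using b1 zX r by (intro mult_right_mono) auto
          then show "cmod (g (b k + Z a k (r * uc t)) * Uh k (r * uc t) * (r * uc t)) \<le> cmod (Uh k (of_real r * uc t)) * r"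
            using r by (simp add: norm_mult mult.assoc)
        qed (intro integrable_continuous_real continuous_intros cu cg)+
      qed
    qed
    from limit_at_1_le[OF c0 this]
    have "cmod D \<le> (\<Sum>k<n. integral {0..1} (\<lambda>t. cmod (Uh k (uc t))))" by simp
    also have "\<dots> = T" unfolding T_def using Uh1 pos by (intro sum.cong refl integral_cong) auto
    finally show ?thesis using D(2) by simp
  qed
  have d0: "deriv_inf (ff a) 0 = of_real T" using deriv_inf_ff TS by (simp add: S_def)
  have "Sup {cmod (deriv_inf g d) | g d. holo_inf (X a) g d \<and> (\<forall>z\<in>X a. cmod (g z) \<le> 1) \<and> cmod d \<le> 1} = T"
  proof (rule cSup_eq_maximum)
    have "cmod (deriv_inf (ff a) 0) = T" using d0 T0 by simp
    then show "T \<in> {cmod (deriv_inf g d) | g d. holo_inf (X a) g d \<and> (\<forall>z\<in>X a. cmod (g z) \<le> 1) \<and> cmod d \<le> 1}"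
      using holo_inf_ff[OF a] by (auto simp: X_def intro!: exI[of _ "ff a"] exI[of _ 0])
  next
    fix x assume "x \<in> {cmod (deriv_inf g d) | g d. holo_inf (X a) g d \<and> (\<forall>z\<in>X a. cmod (g z) \<le> 1) \<and> cmod d \<le> 1}"
    then show "x \<le> T" using le by blast
  qed
  then show ?thesis
    using holo_inf_ff[OF a] d0 by (auto simp: is_ahlfors_def X_def)
qed

end

subsection \<open>Solving the integral equation\<close>

text \<open>The type \<open>nat\<close> is discrete, so the slices are open and continuity may be
  checked on each of them.\<close>

lemma continuous_on_nat_slices:
  fixes f :: "real \<times> nat \<times> real \<Rightarrow> real"
  assumes "\<And>k. continuous_on UNIV (\<lambda>(s, t). f (s, k, t))"
  shows "continuous_on UNIV f"
proof -
  have "continuous_on (\<Union>k\<in>UNIV. UNIV \<times> {k} \<times> UNIV) f"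
  proof (rule continuous_on_open_UN)
    fix k :: nat
    show "open ((UNIV :: real set) \<times> {k} \<times> (UNIV :: real set))"
      by (intro open_Times open_UNIV open_discrete)
    have "continuous_on (UNIV \<times> {k} \<times> UNIV) (\<lambda>p. (\<lambda>(s, t). f (s, k, t)) (fst p, snd (snd p)))"
      by (rule continuous_on_compose2[OF assms]) (auto intro!: continuous_intros)
    then show "continuous_on (UNIV \<times> {k} \<times> UNIV) f"
      by (rule continuous_on_eq) auto
  qed
  moreover have "(\<Union>k\<in>UNIV. (UNIV :: real set) \<times> {k::nat} \<times> (UNIV :: real set)) = UNIV" by auto
  ultimately show ?thesis by simp
qed

text \<open>The library proves completeness of \<open>bcontfun\<close> only over metric domains, and \<open>nat\<close> is not in class
  \<open>metric_space\<close>.\<close>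
lemma complete_bcontfun: "complete (UNIV :: ('a::topological_space \<Rightarrow>\<^sub>C 'b::complete_space) set)"
  unfolding complete_def
proof (intro allI impI)
  fix f :: "nat \<Rightarrow> ('a, 'b) bcontfun"
  assume "(\<forall>n. f n \<in> UNIV) \<and> Cauchy f"
  then obtain g where "uniform_limit UNIV f g sequentially"
    using uniformly_convergent_eq_cauchy[of "\<lambda>_. True" f]
    unfolding Cauchy_def uniform_limit_sequentially_iff
    by (metis dist_fun_lt_imp_dist_val_lt)
  from uniform_limit_bcontfunE[OF this sequentially_bot]
  obtain l where "f \<longlonglongrightarrow> l" by metis
  then show "\<exists>l\<in>UNIV. f \<longlonglongrightarrow> l" by blast
qed

lemma integral_reflect_01:
  fixes f :: "real \<Rightarrow> complex"
  assumes "continuous_on {0..1} f"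
  shows "integral {0..1} (\<lambda>t. f (1 - t)) = integral {0..1} f"
proof -
  have "(f has_integral integral {0..1} f) (cbox 0 1)"
    using integrable_integral[OF integrable_continuous_real[OF assms]] by simp
  from has_integral_affinity[OF this, of "-1" 1]
  have "((\<lambda>t. f (1 - t)) has_integral integral {0..1} f) ((\<lambda>x. 1 - x) ` {0..1})"
    by (simp add: algebra_simps)
  moreover have "(\<lambda>x::real. 1 - x) ` {0..1} = {0..1}"
    by (auto simp: image_iff intro!: bexI[of _ "1 - x" for x])
  ultimately show ?thesis by (simp add: integral_unique)
qed

context poles
begin

section \<open>Bounds and regularity of the kernel\<close>

lemma zt_close:
  assumes "adm a" "k < n" "cmod y \<le> 10 * e" shows "cmod (zt a k y - a k) \<le> e / 10"
proof -
  define p where "p = ph a k y - a k"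
  define q where "q = Gam a k y y - a k"
  have p: "cmod p \<le> e / 50" unfolding p_def by (rule ph_bounds(1)[OF assms])
  have q: "cmod q \<le> e / 1000" unfolding q_def by (rule Gam_bounds(1)[OF assms assms(3)])
  have a2: "cmod (a k) \<le> 2 * e" by (rule adm_bounds(2)[OF assms(1,2)])
  have G: "9/10 * e \<le> cmod (Gam a k y y)" "Gam a k y y \<noteq> 0" by (rule Gam_bounds[OF assms assms(3)])+
  have eqz: "zt a k y - a k = (2 * a k * p + p * p - a k * q) / Gam a k y y"
    unfolding zt_def p_def q_def using G(2) by (simp add: field_simps power2_eq_square)
  have bnd: "cmod (2 * a k * p + p * p - a k * q) \<le> 2 * (2 * e) * (e/50) + (e/50) * (e/50) + 2 * e * (e/1000)"
  proof -
    have "cmod (a k) * cmod p \<le> 2 * e * (e/50)" by (rule mult_mono[OF a2 p]) (use e_pos in auto)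
    moreover have "cmod p * cmod p \<le> (e/50) * (e/50)" by (rule mult_mono[OF p p]) (use e_pos in auto)
    moreover have "cmod (a k) * cmod q \<le> 2 * e * (e/1000)" by (rule mult_mono[OF a2 q]) (use e_pos in auto)
    moreover have "cmod (2 * a k * p + p * p - a k * q) \<le> 2 * (cmod (a k) * cmod p) + cmod p * cmod p + cmod (a k) * cmod q"
      using norm_triangle_ineq4[of "2 * a k * p + p * p" "a k * q"] norm_triangle_ineq[of "2 * a k * p" "p * p"]
      by (simp add: norm_mult)
    ultimately show ?thesis by linarith
  qed
  have "cmod (zt a k y - a k) \<le> (2 * (2 * e) * (e/50) + (e/50) * (e/50) + 2 * e * (e/1000)) / (9/10 * e)"
    unfolding eqz by (rule quot_bound[OF bnd G(1)]) (use e_pos in simp)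
  also have "\<dots> \<le> e / 10" using e_pos by (simp add: field_simps)
  finally show ?thesis .
qed

lemma zt_0 [simp]: "adm a \<Longrightarrow> k < n \<Longrightarrow> zt a k 0 = a k"
  using adm_bounds(3) by (simp add: zt_def ph_def Gam_def power2_eq_square)

lemma zt_bound:
  assumes "adm a" "k < n" "cmod y \<le> 10 * e" shows "cmod (zt a k y) \<le> 21/10 * e"
  using zt_close[OF assms] adm_bounds(2)[OF assms(1,2)] norm_triangle_ineq[of "zt a k y - a k" "a k"] by simp

text \<open>On the diagonal the powers of e cancel up to one: the prefactor has size 1/e and the
  bracket size n e^2. The constants multiply to about 485, rounded up to 500. Off the diagonal the
  denominator is at least 1/2, which leaves less than 50 e.\<close>

lemma KK_bound:
  assumes a: "adm a" and k: "k < n" and j: "j < n" and x: "cmod x \<le> 10 * e" and y: "cmod y \<le> 10 * e"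
  shows "cmod (KK a k j x y) \<le> 500 * (real n * e)"
proof (cases "j = k")
  case True
  define N where "N = real n * e"
  have N: "0 \<le> N" using e_pos by (simp add: N_def)
  note px = ph_bounds[OF a k x] and py = ph_bounds[OF a k y] and G1 = Gam_bounds[OF a k x y] and G2 = Gam_bounds[OF a k y y]
  have b1: "cmod (ph a k y * (y * m2 a k x y)) \<le> 21/10 * e * (10 * e * (16 * N))"
    unfolding norm_mult N_def using py y m2_bound[OF a k small_half[OF x] small_half[OF y]] e_pos
    by (intro mult_mono) auto
  have b2: "cmod (Gam a k y y * m1 a k x y) \<le> 21/10 * e * (8 * N)"
    unfolding norm_mult N_def using G2 m1_bound[OF a k small_half[OF x] small_half[OF y]] e_pos
    by (intro mult_mono) auto
  have br: "cmod (ph a k y * (y * m2 a k x y) - Gam a k y y * m1 a k x y) \<le> 21/10 * e * (10 * e * (16 * N)) + 21/10 * e * (8 * N)"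
    by (rule order_trans[OF norm_triangle_ineq4 add_mono[OF b1 b2]])
  have den: "9/10 * e * (9/10 * e) * (9/10 * e) \<le> cmod (ph a k x * Gam a k y y * Gam a k x y)"
    unfolding norm_mult using px G1 G2 e_pos by (intro mult_mono) auto
  have num: "cmod (x * ph a k y) \<le> 10 * e * (21/10 * e)"
    unfolding norm_mult using x py e_pos by (intro mult_mono) auto
  have q: "cmod (x * ph a k y / (ph a k x * Gam a k y y * Gam a k x y)) \<le> 10 * e * (21/10 * e) / (9/10 * e * (9/10 * e) * (9/10 * e))"
    by (rule quot_bound[OF num den]) (use e_pos in auto)
  have "cmod (KK a k j x y) \<le> (10 * e * (21/10 * e) / (9/10 * e * (9/10 * e) * (9/10 * e))) *
      (21/10 * e * (10 * e * (16 * N)) + 21/10 * e * (8 * N))"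
  proof -
    have "KK a k j x y = (x * ph a k y / (ph a k x * Gam a k y y * Gam a k x y)) *
        (ph a k y * (y * m2 a k x y) - Gam a k y y * m1 a k x y)"
      using True by (simp add: KK_def)
    then show ?thesis
      by (simp only: norm_mult[of "x * ph a k y / (ph a k x * Gam a k y y * Gam a k x y)"])
         (rule mult_mono[OF q br], use e_pos N in auto)
  qed
  also have "\<dots> = (10 * (21/10) / (9/10)^3 * (21/10)) * ((160 * e + 8) * N)"
    using e_pos by (simp add: field_simps power3_eq_cube)
  also have "\<dots> \<le> (10 * (21/10) / (9/10)^3 * (21/10)) * ((160 * (1/20000) + 8) * N)"
    using e_small N by (intro mult_left_mono mult_right_mono add_right_mono) auto
  also have "\<dots> \<le> 500 * N" using N by (simp add: power3_eq_cube)
  finally show ?thesis by (simp add: N_def)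
next
  case False
  have d: "1/2 \<le> cmod (b j + x - (b k + y))"
  proof -
    have "1 \<le> cmod (b j - b k)" using sep[OF j k False] .
    also have "b j - b k = (b j + x - (b k + y)) + (y - x)" by simp
    also have "cmod \<dots> \<le> cmod (b j + x - (b k + y)) + (cmod y + cmod x)"
      by (rule order_trans[OF norm_triangle_ineq add_left_mono[OF norm_triangle_ineq4]])
    finally show ?thesis using x y e_small by linarith
  qed
  have "cmod (x / ph a j x) \<le> 10 * e / (9/10 * e)"
    using ph_bounds[OF a j x] x e_pos by (intro quot_bound) auto
  then have "cmod (x / ph a j x * zt a k y) \<le> 10 * e / (9/10 * e) * (21/10 * e)"
    unfolding norm_mult using zt_bound[OF a k y] e_pos by (intro mult_mono) auto
  from quot_bound[OF this d] have "cmod (KK a k j x y) \<le> 10 * e / (9/10 * e) * (21/10 * e) / (1/2)"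
    using False by (simp add: KK_def)
  also have "\<dots> \<le> 500 * (1 * e)" using e_pos by (simp add: field_simps)
  also have "\<dots> \<le> 500 * (real n * e)" using n_pos e_pos by (intro mult_left_mono mult_right_mono) auto
  finally show ?thesis .
qed

lemma continuous_parts:
  fixes A :: "'p::topological_space \<Rightarrow> nat \<Rightarrow> complex"
  assumes k: "k < n" and A: "\<And>j. j < n \<Longrightarrow> continuous_on S (\<lambda>p. A p j)"
    and x: "continuous_on S x" "\<And>p. p \<in> S \<Longrightarrow> cmod (x p) \<le> 10 * e"
    and y: "continuous_on S y" "\<And>p. p \<in> S \<Longrightarrow> cmod (y p) \<le> 10 * e"
  shows "continuous_on S (\<lambda>p. ph (A p) k (x p))" "continuous_on S (\<lambda>p. Gam (A p) k (x p) (y p))"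
    "continuous_on S (\<lambda>p. m1 (A p) k (x p) (y p))" "continuous_on S (\<lambda>p. m2 (A p) k (x p) (y p))"
proof -
  have dx: "x p + b k - b j \<noteq> 0" if "p \<in> S" "j \<in> {..<n} - {k}" for p j
    using dist_lower(3)[OF k that(2) small_half[OF x(2)[OF that(1)]]] .
  have dy: "y p + b k - b j \<noteq> 0" if "p \<in> S" "j \<in> {..<n} - {k}" for p j
    using dist_lower(3)[OF k that(2) small_half[OF y(2)[OF that(1)]]] .
  show "continuous_on S (\<lambda>p. ph (A p) k (x p))" unfolding ph_def gg_def
    by (intro continuous_intros A k x) (use dx in auto)
  show "continuous_on S (\<lambda>p. Gam (A p) k (x p) (y p))" unfolding Gam_def mm_def
    by (intro continuous_intros A k x y) (use dx dy in auto)
  show "continuous_on S (\<lambda>p. m1 (A p) k (x p) (y p))" unfolding m1_def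
    by (intro continuous_intros A k x y) (use dx dy in auto)
  show "continuous_on S (\<lambda>p. m2 (A p) k (x p) (y p))" unfolding m2_def
    by (intro continuous_intros A k x y) (use dx dy in auto)
qed

lemma continuous_zt_KK:
  fixes A :: "'p::topological_space \<Rightarrow> nat \<Rightarrow> complex"
  assumes k: "k < n" and j: "j < n" and adm: "\<And>p. p \<in> S \<Longrightarrow> adm (A p)"
    and A: "\<And>j. j < n \<Longrightarrow> continuous_on S (\<lambda>p. A p j)"
    and x: "continuous_on S x" "\<And>p. p \<in> S \<Longrightarrow> cmod (x p) \<le> 10 * e"
    and y: "continuous_on S y" "\<And>p. p \<in> S \<Longrightarrow> cmod (y p) \<le> 10 * e"
  shows "continuous_on S (\<lambda>p. zt (A p) k (y p))" "continuous_on S (\<lambda>p. KK (A p) k j (x p) (y p))"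
proof -
  note cy = continuous_parts[OF k A y y] and cxy = continuous_parts[OF k A x y]
  show z: "continuous_on S (\<lambda>p. zt (A p) k (y p))" unfolding zt_def
    by (intro continuous_intros cy) (use Gam_bounds(4)[OF adm k y(2) y(2)] in auto)
  show "continuous_on S (\<lambda>p. KK (A p) k j (x p) (y p))"
  proof (cases "j = k")
    case True
    show ?thesis unfolding KK_def if_P[OF True]
      by (intro continuous_intros cy cxy x y)
         (use Gam_bounds(4)[OF adm k y(2) y(2)] Gam_bounds(4)[OF adm k x(2) y(2)] ph_bounds(4)[OF adm k x(2)] in auto)
  next
    case False
    have "b j + x p - (b k + y p) \<noteq> 0" if p: "p \<in> S" for p
    proof
      assume "b j + x p - (b k + y p) = 0"
      then have "b j - b k = y p - x p" by (simp add: algebra_simps)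
      moreover have "cmod (y p - x p) \<le> 20 * e"
        using norm_triangle_ineq4[of "y p" "x p"] x(2)[OF p] y(2)[OF p] by linarith
      ultimately show False using sep[OF j k False] e_small by simp
    qed
    then show ?thesis unfolding KK_def if_not_P[OF False]
      by (intro continuous_intros z x y continuous_parts(1)[OF j A x x])
         (use ph_bounds(4)[OF adm j x(2)] in auto)
  qed
qed

lemma holomorphic_KK:
  assumes a: "adm a" and k: "k < n" and j: "j < n" and x: "cmod x \<le> 10 * e"
  shows "(\<lambda>y. KK a k j x y) holomorphic_on ball 0 (10 * e)"
proof -
  have yl: "cmod y \<le> 10 * e" if "y \<in> ball 0 (10 * e)" for y using that by simp
  have dx: "x + b k - b j \<noteq> 0" if "j \<in> {..<n} - {k}" for j
    using dist_lower(3)[OF k that small_half[OF x]] .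
  have dy: "y + b k - b j \<noteq> 0" if "y \<in> ball 0 (10 * e)" "j \<in> {..<n} - {k}" for y j
    using dist_lower(3)[OF k that(2) small_half[OF yl[OF that(1)]]] .
  have p: "ph a k holomorphic_on ball 0 (10 * e)" unfolding ph_def gg_def
    by (intro holomorphic_intros) (use dy in auto)
  have G1: "(\<lambda>y. Gam a k x y) holomorphic_on ball 0 (10 * e)" unfolding Gam_def mm_def
    by (intro holomorphic_intros) (use dx dy in auto)
  have G2: "(\<lambda>y. Gam a k y y) holomorphic_on ball 0 (10 * e)" unfolding Gam_def mm_def
    by (intro holomorphic_intros) (use dx dy in auto)
  have M: "(\<lambda>y. m1 a k x y) holomorphic_on ball 0 (10 * e)" "(\<lambda>y. m2 a k x y) holomorphic_on ball 0 (10 * e)"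
    unfolding m1_def m2_def by (intro holomorphic_intros; use dx dy in auto)+
  have z: "zt a k holomorphic_on ball 0 (10 * e)" unfolding zt_def
    by (intro holomorphic_intros p G2) (use Gam_bounds(4)[OF a k yl yl] in auto)
  show ?thesis
  proof (cases "j = k")
    case True
    show ?thesis unfolding KK_def if_P[OF True]
      by (intro holomorphic_intros p G1 G2 M)
         (use Gam_bounds(4)[OF a k yl yl] Gam_bounds(4)[OF a k x yl] ph_bounds(4)[OF a k x] in auto)
  next
    case False
    have "b j + x - (b k + y) \<noteq> 0" if y: "y \<in> ball 0 (10 * e)" for y
    proof
      assume "b j + x - (b k + y) = 0"
      then have "b j - b k = y - x" by (simp add: algebra_simps)
      moreover have "cmod (y - x) \<le> 20 * e"
        using norm_triangle_ineq4[of y x] x yl[OF y] by linarith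
      ultimately show False using sep[OF j k False] e_small by simp
    qed
    then show ?thesis unfolding KK_def if_not_P[OF False]
      by (intro holomorphic_intros z) auto
  qed
qed

text \<open>The parameter is clamped so that bounded continuous functions on all of \<open>\<real>\<close> can be used; putting it into
  the domain of the unknown makes the fixed point depend continuously on it.\<close>
definition cl :: "real \<Rightarrow> real" where "cl s = max (-1/2) (min (1/2) s)"

text \<open>Only the residues of the conjugate pair with indices 0 and 1 are turned, and in opposite
  directions, so that the residues remain symmetric under conjugation together with the
  poles.\<close>

definition as :: "real \<Rightarrow> nat \<Rightarrow> complex" where
  "as s j = Complex e (e * cl s * (if j = 0 then 1 else if j = 1 then -1 else 0))"

lemma adm_as [simp]: "adm (as s)"
proof -
  have "\<bar>cl s\<bar> \<le> 1/2" by (auto simp: cl_def)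
  then have "e * \<bar>cl s\<bar> \<le> e * (1/2)" using e_pos by (intro mult_left_mono) auto
  then show ?thesis using e_pos by (auto simp: adm_def as_def abs_mult)
qed

lemma continuous_on_as: "continuous_on S s \<Longrightarrow> continuous_on S (\<lambda>p. as (s p) j)"
  unfolding as_def cl_def Complex_eq by (intro continuous_intros)

text \<open>The right-hand side of the integral equation in \<open>extremal\<close>, with an
  arbitrary density \<open>W\<close> in place of the one built from \<open>V\<close>.\<close>

definition VV :: "((real \<times> nat \<times> real) \<Rightarrow>\<^sub>C real) \<Rightarrow> real \<Rightarrow> nat \<Rightarrow> complex \<Rightarrow> complex" where
  "VV W s k v = zt (as s) k (Z (as s) k v) -
    (\<Sum>j<n. integral {0..1} (\<lambda>t. KK (as s) k j (Z (as s) j (uc t)) (Z (as s) k v)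
       * of_real (apply_bcontfun W (s, j, t))))"

lemma continuous_KKW:
  fixes W :: "(real \<times> nat \<times> real) \<Rightarrow>\<^sub>C real"
  assumes k: "k < n" and j: "j < n"
  shows "continuous_on ((UNIV \<times> cball 0 2) \<times> UNIV) (\<lambda>((s, v), t). KK (as s) k j (Z (as s) j (uc t)) (Z (as s) k v)
       * of_real (apply_bcontfun W (s, j, t)))"
proof -
  have cW: "continuous_on S (\<lambda>p. apply_bcontfun W (fst (fst p), j, snd p))" for S
    by (rule continuous_on_compose2[OF continuous_on_apply_bcontfun[of UNIV]]) (auto intro!: continuous_intros)
  show ?thesis unfolding case_prod_unfold
    by (intro continuous_intros cW continuous_zt_KK(2)[OF k j] continuous_on_Z[OF _ j] continuous_on_Z[OF _ k] continuous_on_as)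
       (auto intro!: Z_le j k)
qed

lemma continuous_VV:
  assumes k: "k < n"
  shows "continuous_on (UNIV \<times> cball 0 2) (\<lambda>(s, v). VV W s k v)"
proof -
  have c1: "continuous_on (UNIV \<times> cball 0 2) (\<lambda>(s, v). zt (as s) k (Z (as s) k v))"
    unfolding case_prod_unfold
    by (intro continuous_zt_KK(1)[OF k k, where x = "\<lambda>_. 0"] continuous_on_Z[OF _ k] continuous_on_as continuous_intros)
       (use e_pos in \<open>auto intro!: Z_le k\<close>)
  have c2: "continuous_on (UNIV \<times> cball 0 2) (\<lambda>p. integral {0..1} (\<lambda>t.
      KK (as (fst p)) k j (Z (as (fst p)) j (uc t)) (Z (as (fst p)) k (snd p)) * of_real (apply_bcontfun W (fst p, j, t))))"
    if "j < n" for j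
    by (rule continuous_integral_01[where f = "\<lambda>p t. KK (as (fst p)) k j (Z (as (fst p)) j (uc t)) (Z (as (fst p)) k (snd p))
          * of_real (apply_bcontfun W (fst p, j, t))"], unfold case_prod_unfold,
        rule continuous_on_subset[OF continuous_KKW[OF k that, of W, unfolded case_prod_unfold]]) auto
  show ?thesis using c1 c2 unfolding VV_def case_prod_unfold
    by (intro continuous_on_diff continuous_on_sum) auto
qed

lemma VV_bound:
  assumes k: "k < n" and v: "cmod v \<le> 2" and B: "\<And>j t. j < n \<Longrightarrow> \<bar>apply_bcontfun W (s, j, t)\<bar> \<le> B"
  shows "cmod (VV W s k v - zt (as s) k (Z (as s) k v)) \<le> B / 40"
proof -
  have B0: "0 \<le> B" using B[OF k, of 0] by linarith
  have "cmod (\<Sum>j<n. integral {0..1} (\<lambda>t. KK (as s) k j (Z (as s) j (uc t)) (Z (as s) k v)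
       * of_real (apply_bcontfun W (s, j, t)))) \<le> real (card {..<n}) * (500 * (real n * e) * B)"
  proof (rule sum_norm_bound)
    fix j assume "j \<in> {..<n}"
    then have j: "j < n" by simp
    have "continuous_on {0..1} (\<lambda>t. (\<lambda>((s, v), t). KK (as s) k j (Z (as s) j (uc t)) (Z (as s) k v)
       * of_real (apply_bcontfun W (s, j, t))) ((s, v), t))"
      by (rule continuous_on_compose2[OF continuous_KKW[OF k j]])
         (use v in \<open>auto intro!: continuous_on_Pair continuous_on_const continuous_on_id\<close>)
    then have c: "continuous_on {0..1} (\<lambda>t. KK (as s) k j (Z (as s) j (uc t)) (Z (as s) k v)
       * of_real (apply_bcontfun W (s, j, t)))" by simp
    have "cmod (integral {0..1} (\<lambda>t. KK (as s) k j (Z (as s) j (uc t)) (Z (as s) k v)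
       * of_real (apply_bcontfun W (s, j, t)))) \<le> integral {0..1} (\<lambda>t::real. 500 * (real n * e) * B)"
    proof (rule integral_norm_bound_integral)
      fix t :: real
      show "cmod (KK (as s) k j (Z (as s) j (uc t)) (Z (as s) k v) * of_real (apply_bcontfun W (s, j, t)))
          \<le> 500 * (real n * e) * B"
        unfolding norm_mult
        using KK_bound[OF adm_as k j Z_le[OF adm_as j] Z_le[OF adm_as k v]] B[OF j] e_pos
        by (intro mult_mono) auto
    qed (use c in \<open>auto intro: integrable_continuous_real\<close>)
    then show "cmod (integral {0..1} (\<lambda>t. KK (as s) k j (Z (as s) j (uc t)) (Z (as s) k v)
       * of_real (apply_bcontfun W (s, j, t)))) \<le> 500 * (real n * e) * B" by simp
  qed
  also have "\<dots> = (real n * (real n * e)) * (500 * B)" by simp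
  also have "\<dots> \<le> (1/20000) * (500 * B)" using n2e B0 by (intro mult_right_mono) auto
  finally show ?thesis by (simp add: VV_def)
qed

text \<open>The density that \<open>extremal\<close> attaches to \<open>VV W\<close>; its fixed
  points solve the integral equation. Indices from n on get the value 0 because the function space
  ranges over all of \<open>nat\<close>.\<close>

definition TT :: "((real \<times> nat \<times> real) \<Rightarrow>\<^sub>C real) \<Rightarrow> real \<times> nat \<times> real \<Rightarrow> real" where
  "TT W = (\<lambda>(s, k, t). if k < n then 2 * Re (VV W s k (uc t)) - Re (VV W s k 0) else 0)"

lemma apply_le_dist0: "\<bar>apply_bcontfun W p\<bar> \<le> dist W (const_bcontfun 0)"
  for W :: "(real \<times> nat \<times> real) \<Rightarrow>\<^sub>C real"
  using dist_bounded[of W p "const_bcontfun 0"] by (simp add: const_bcontfun.rep_eq dist_real_def)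

text \<open>At the centre \<open>zt\<close> equals the residue exactly, so its deviation e/10 enters
  only through the circle value, which is doubled. The integral term, at most B/40, enters three
  times: twice from the circle and once from the centre.\<close>

lemma TT_bound:
  assumes k: "k < n" and B: "\<And>j t. j < n \<Longrightarrow> \<bar>apply_bcontfun W (s, j, t)\<bar> \<le> B"
  shows "\<bar>TT W (s, k, t) - e\<bar> \<le> 1/5 * e + 3/40 * B"
proof -
  have v: "cmod (uc t) \<le> 2" "cmod (0::complex) \<le> 2" by auto
  have e1: "\<bar>Re (as s k) - e\<bar> = 0" by (simp add: as_def)
  have z: "cmod (zt (as s) k (Z (as s) k (uc t)) - as s k) \<le> e / 10"
    by (intro zt_close adm_as k Z_le) auto
  have z0: "zt (as s) k (Z (as s) k 0) = as s k" using k by simp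
  note B1 = VV_bound[where W = W, OF k v(1) B] and B2 = VV_bound[where W = W, OF k v(2) B]
  have "\<bar>Re (VV W s k (uc t)) - e\<bar> \<le> e/10 + B / 40"
    using B1 z e1 abs_Re_le_cmod[of "VV W s k (uc t) - zt (as s) k (Z (as s) k (uc t))"]
      abs_Re_le_cmod[of "zt (as s) k (Z (as s) k (uc t)) - as s k"] by auto
  moreover have "\<bar>Re (VV W s k 0) - e\<bar> \<le> B / 40"
    using B2 e1 abs_Re_le_cmod[of "VV W s k 0 - zt (as s) k (Z (as s) k 0)"] unfolding z0 by auto
  moreover have "TT W (s, k, t) = 2 * Re (VV W s k (uc t)) - Re (VV W s k 0)" using k by (simp add: TT_def)
  ultimately show ?thesis by linarith
qed

lemma TT_bcontfun: "TT W \<in> bcontfun"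
proof -
  have "continuous_on UNIV (TT W)"
  proof (rule continuous_on_nat_slices)
    fix k
    show "continuous_on UNIV (\<lambda>(s, t). TT W (s, k, t))"
    proof (cases "k < n")
      case True
      have c1: "continuous_on UNIV (\<lambda>p::real\<times>real. VV W (fst p) k (uc (snd p)))"
      proof -
        have "continuous_on UNIV (\<lambda>p::real\<times>real. (\<lambda>(s, v). VV W s k v) (fst p, uc (snd p)))"
          by (rule continuous_on_compose2[OF continuous_VV[OF True]]) (auto intro!: continuous_intros)
        then show ?thesis by simp
      qed
      have c2: "continuous_on UNIV (\<lambda>p::real\<times>real. VV W (fst p) k 0)"
      proof -
        have "continuous_on UNIV (\<lambda>p::real\<times>real. (\<lambda>(s, v). VV W s k v) (fst p, 0))"
          by (rule continuous_on_compose2[OF continuous_VV[OF True]]) (auto intro!: continuous_intros)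
        then show ?thesis by simp
      qed
      show ?thesis unfolding TT_def case_prod_unfold using True
        by (auto intro!: continuous_intros c1 c2)
    qed (simp add: TT_def)
  qed
  moreover have "bounded (range (TT W))"
  proof -
    define B where "B = dist W (const_bcontfun 0)"
    have "\<bar>TT W p\<bar> \<le> 2 * e + 3/40 * B" for p
    proof -
      obtain s k t where p: "p = (s, k, t)" by (cases p)
      have "\<bar>TT W (s, k, t) - e\<bar> \<le> 1/5 * e + 3/40 * B" if "k < n"
        by (rule TT_bound[OF that]) (simp only: B_def apply_le_dist0)
      moreover have "0 \<le> B" by (simp add: B_def)
      ultimately show ?thesis unfolding p using e_pos by (cases "k < n") (auto simp: TT_def)
    qed
    then show ?thesis by (auto simp: bounded_iff)
  qed
  ultimately show ?thesis by (simp add: bcontfun_def)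
qed

lemma VV_diff:
  assumes k: "k < n" and v: "cmod v \<le> 2"
  shows "cmod (VV W s k v - VV W' s k v) \<le> dist W W' / 40"
proof -
  have "VV W s k v - VV W' s k v = VV (W - W') s k v - zt (as s) k (Z (as s) k v)"
  proof -
    have i: "(\<lambda>t. KK (as s) k j (Z (as s) j (uc t)) (Z (as s) k v) * of_real (apply_bcontfun W (s, j, t))) integrable_on {0..1}"
      if j: "j < n" for j and W :: "(real \<times> nat \<times> real) \<Rightarrow>\<^sub>C real"
    proof -
      have "continuous_on {0..1} (\<lambda>t. (\<lambda>((s, v), t). KK (as s) k j (Z (as s) j (uc t)) (Z (as s) k v)
         * of_real (apply_bcontfun W (s, j, t))) ((s, v), t))"
        by (rule continuous_on_compose2[OF continuous_KKW[OF k j]])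
           (use v in \<open>auto intro!: continuous_on_Pair continuous_on_const continuous_on_id\<close>)
      then show ?thesis by (auto intro: integrable_continuous_real)
    qed
    have "(\<Sum>j<n. integral {0..1} (\<lambda>t. KK (as s) k j (Z (as s) j (uc t)) (Z (as s) k v) * of_real (apply_bcontfun (W - W') (s, j, t))))
      = (\<Sum>j<n. integral {0..1} (\<lambda>t. KK (as s) k j (Z (as s) j (uc t)) (Z (as s) k v) * of_real (apply_bcontfun W (s, j, t)))
        - integral {0..1} (\<lambda>t. KK (as s) k j (Z (as s) j (uc t)) (Z (as s) k v) * of_real (apply_bcontfun W' (s, j, t))))"
      by (intro sum.cong refl) (simp add: minus_bcontfun.rep_eq right_diff_distrib integral_diff i)
    then show ?thesis by (simp add: VV_def sum_subtractf)
  qed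
  also have "cmod \<dots> \<le> dist W W' / 40"
  proof (rule VV_bound[OF k v])
    fix j t
    show "\<bar>apply_bcontfun (W - W') (s, j, t)\<bar> \<le> dist W W'"
      using dist_bounded[of W "(s, j, t)" W'] by (simp add: minus_bcontfun.rep_eq dist_real_def)
  qed
  finally show ?thesis .
qed

text \<open>\<open>TT\<close> is affine in \<open>W\<close> and contracts the supremum norm by 3/40,
  again three times 1/40. Uniqueness is wanted as much as existence, since it transfers the
  conjugation symmetry to the solution.\<close>

lemma fixed_point_ex1: "\<exists>!W. Bcontfun (TT W) = W"
proof -
  have "dist (Bcontfun (TT W)) (Bcontfun (TT W')) \<le> 3/40 * dist W W'" for W W'
  proof (rule dist_bound)
    fix p :: "real \<times> nat \<times> real"
    obtain s k t where p: "p = (s, k, t)" by (cases p)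
    have "\<bar>TT W (s, k, t) - TT W' (s, k, t)\<bar> \<le> 3/40 * dist W W'"
    proof (cases "k < n")
      case True
      have "cmod (VV W s k (uc t) - VV W' s k (uc t)) \<le> dist W W' / 40" "cmod (VV W s k 0 - VV W' s k 0) \<le> dist W W' / 40"
        by (rule VV_diff[OF True], simp)+
      moreover have "TT W (s, k, t) = 2 * Re (VV W s k (uc t)) - Re (VV W s k 0)"
        "TT W' (s, k, t) = 2 * Re (VV W' s k (uc t)) - Re (VV W' s k 0)" using True by (simp_all add: TT_def)
      ultimately show ?thesis
        using abs_Re_le_cmod[of "VV W s k (uc t) - VV W' s k (uc t)", unfolded minus_complex.sel]
          abs_Re_le_cmod[of "VV W s k 0 - VV W' s k 0", unfolded minus_complex.sel] by linarith
    qed (simp add: TT_def)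
    then show "dist (apply_bcontfun (Bcontfun (TT W)) p) (apply_bcontfun (Bcontfun (TT W')) p) \<le> 3/40 * dist W W'"
      by (simp add: Bcontfun_inverse TT_bcontfun p dist_real_def)
  qed
  then have "\<exists>!W. W \<in> UNIV \<and> Bcontfun (TT W) = W"
    by (intro Banach_fix[OF complete_bcontfun, of "3/40"]) auto
  then show ?thesis by simp
qed

lemma holomorphic_VV:
  assumes k: "k < n" shows "VV W s k holomorphic_on ball 0 2"
proof -
  have "(\<lambda>v. integral {0..1} (\<lambda>t. KK (as s) k j (Z (as s) j (uc t)) (Z (as s) k v)
       * of_real (apply_bcontfun W (s, j, t)))) holomorphic_on ball 0 2" if j: "j < n" for j
  proof (rule holomorphic_on_integral_param)
    have "continuous_on (ball 0 2 \<times> {0..1}) (\<lambda>p. (\<lambda>((s, v), t). KK (as s) k j (Z (as s) j (uc t)) (Z (as s) k v)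
       * of_real (apply_bcontfun W (s, j, t))) ((s, fst p), snd p))"
      by (rule continuous_on_compose2[OF continuous_KKW[OF k j]]) (auto intro!: continuous_intros)
    then show "continuous_on (ball 0 2 \<times> {0..1}) (\<lambda>(v, t). KK (as s) k j (Z (as s) j (uc t)) (Z (as s) k v)
       * of_real (apply_bcontfun W (s, j, t)))" by (simp add: case_prod_unfold)
    fix t :: real
    have "((\<lambda>y. KK (as s) k j (Z (as s) j (uc t)) y) \<circ> Z (as s) k) holomorphic_on ball 0 2"
      by (rule holomorphic_on_compose_gen[OF Z_holo[OF adm_as k] holomorphic_KK[OF adm_as k j]])
         (use Z_props(1)[OF adm_as k] Z_le[OF adm_as j] in auto)
    then show "(\<lambda>v. KK (as s) k j (Z (as s) j (uc t)) (Z (as s) k v)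
       * of_real (apply_bcontfun W (s, j, t))) holomorphic_on ball 0 2"
      by (intro holomorphic_intros) (simp add: o_def)
  qed simp
  then show ?thesis unfolding VV_def[abs_def]
    by (intro holomorphic_on_diff holomorphic_on_sum holo_ztZ adm_as k) auto
qed

end

section \<open>Conjugation symmetry\<close>

definition sg :: "nat \<Rightarrow> nat" where "sg j = (if j = 0 then 1 else if j = 1 then 0 else j)"

lemma sg_sg [simp]: "sg (sg j) = j" by (simp add: sg_def)

lemma sg_eq_iff [simp]: "sg j = sg k \<longleftrightarrow> j = k" by (metis sg_sg)

lemma cnj_uc: "cnj (uc t) = uc (1 - t)"
  by (simp add: complex_eq_iff cos_diff sin_diff right_diff_distrib)

text \<open>The transposition \<open>sg\<close> describes how complex conjugation permutes the
  poles: 0 and 1 form the conjugate pair and all other poles are real.\<close>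

locale sym_poles = poles +
  assumes n2: "2 \<le> n" and b_sym: "\<And>j. j < n \<Longrightarrow> b (sg j) = cnj (b j)"
begin

lemma sg_less [simp]: "sg j < n \<longleftrightarrow> j < n"
  using n2 by (auto simp: sg_def)

lemma sum_sg: "(\<Sum>j<n. F j) = (\<Sum>j<n. F (sg j))"
  by (rule sum.reindex_bij_witness[of _ sg sg]) auto

lemma sum_sg_remove: "(\<Sum>j\<in>{..<n}-{sg k}. F j) = (\<Sum>j\<in>{..<n}-{k}. F (sg j))"
  by (rule sum.reindex_bij_witness[of _ sg sg]) auto

lemma as_sg: "as s (sg j) = cnj (as s j)"
  by (simp add: as_def sg_def complex_eq_iff)

lemma parts_sg:
  assumes k: "k < n"
  shows "ph (as s) (sg k) (cnj x) = cnj (ph (as s) k x)" "Gam (as s) (sg k) (cnj x) (cnj y) = cnj (Gam (as s) k x y)"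
    "m1 (as s) (sg k) (cnj x) (cnj y) = cnj (m1 (as s) k x y)" "m2 (as s) (sg k) (cnj x) (cnj y) = cnj (m2 (as s) k x y)"
  by (simp_all add: ph_def gg_def Gam_def mm_def m1_def m2_def sum_sg_remove as_sg b_sym k cong: sum.cong_simp)

lemma zt_sg: "k < n \<Longrightarrow> zt (as s) (sg k) (cnj y) = cnj (zt (as s) k y)"
  by (simp add: zt_def parts_sg)

lemma KK_sg: "k < n \<Longrightarrow> j < n \<Longrightarrow> KK (as s) (sg k) (sg j) (cnj x) (cnj y) = cnj (KK (as s) k j x y)"
  by (simp add: KK_def parts_sg zt_sg b_sym)

lemma Z_sg: assumes "k < n" "cmod v \<le> 2" shows "Z (as s) (sg k) (cnj v) = cnj (Z (as s) k v)"
proof (rule Z_eqI)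
  have "cnj (Z (as s) k v) = cnj (v * ph (as s) k (Z (as s) k v))"
    using Z_props(2)[OF adm_as assms] by simp
  then show "cnj (Z (as s) k v) = cnj v * ph (as s) (sg k) (cnj (Z (as s) k v))"
    unfolding parts_sg[OF assms(1)] complex_cnj_mult .
qed (use assms Z_le[OF adm_as assms] in auto)

text \<open>The reflected density \<open>apply_bcontfun W (s, sg k, 1 - t)\<close> is again a fixed
  point, because conjugation sends \<open>uc t\<close> to \<open>uc (1 - t)\<close> and hole k to
  hole \<open>sg k\<close>. By uniqueness it equals \<open>W\<close>.\<close>

lemma fixed_point_symmetric:
  assumes W: "Bcontfun (TT W) = W" and k: "k < n" and v: "cmod v \<le> 2"
  shows "VV W s k v = cnj (VV W s (sg k) (cnj v))"
proof -
  define w' where "w' = (\<lambda>(s, k, t). apply_bcontfun W (s, sg k, 1 - t))"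
  have "w' \<in> bcontfun"
    unfolding bcontfun_def
  proof (intro CollectI conjI)
    show "continuous_on UNIV w'"
    proof (rule continuous_on_nat_slices)
      fix k
      show "continuous_on UNIV (\<lambda>(s, t). w' (s, k, t))"
        unfolding w'_def case_prod_unfold fst_conv snd_conv
        by (rule continuous_on_compose2[OF continuous_on_apply_bcontfun[of UNIV]]) (auto intro!: continuous_intros)
    qed
    have "range w' \<subseteq> range (apply_bcontfun W)" by (auto simp: w'_def)
    then show "bounded (range w')" using bounded_apply_bcontfun bounded_subset by blast
  qed
  then obtain W' where W': "w' = apply_bcontfun W'" by (rule bcontfunE)
  have VV': "VV W' s k v = cnj (VV W s (sg k) (cnj v))" if k: "k < n" and v: "cmod v \<le> 2" for s k v
  proof -
    let ?f = "\<lambda>j t. KK (as s) k j (Z (as s) j (uc t)) (Z (as s) k v) * of_real (apply_bcontfun W (s, sg j, 1 - t))"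
    have cf: "continuous_on {0..1} (?f j)" if j: "j < n" for j
    proof -
      have "continuous_on {0..1} (\<lambda>t. (\<lambda>((s, v), t). KK (as s) k j (Z (as s) j (uc t)) (Z (as s) k v)
         * of_real (apply_bcontfun W' (s, j, t))) ((s, v), t))"
        by (rule continuous_on_compose2[OF continuous_KKW[OF k j]])
           (use v in \<open>auto intro!: continuous_on_Pair continuous_on_const continuous_on_id\<close>)
      then show ?thesis by (simp add: W'[symmetric] w'_def)
    qed
    have trm: "cnj (KK (as s) (sg k) (sg j) (Z (as s) (sg j) (uc t)) (Z (as s) (sg k) (cnj v)) * of_real (apply_bcontfun W (s, sg j, t)))
        = ?f j (1 - t)" if j: "j < n" for j t
    proof -
      have "Z (as s) (sg j) (uc t) = cnj (Z (as s) j (uc (1 - t)))"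
        using Z_sg[OF j, of "uc (1 - t)" s] cnj_uc[of "1 - t"] by simp
      then show ?thesis using Z_sg[OF k v] KK_sg[OF k j] by simp
    qed
    have "cnj (VV W s (sg k) (cnj v)) = zt (as s) k (Z (as s) k v) -
      (\<Sum>j<n. integral {0..1} (\<lambda>t. cnj (KK (as s) (sg k) j (Z (as s) j (uc t)) (Z (as s) (sg k) (cnj v)) * of_real (apply_bcontfun W (s, j, t)))))"
      unfolding VV_def complex_cnj_diff cnj_sum integral_cnj using Z_sg[OF k v] zt_sg[OF k] by simp
    also have "(\<Sum>j<n. integral {0..1} (\<lambda>t. cnj (KK (as s) (sg k) j (Z (as s) j (uc t)) (Z (as s) (sg k) (cnj v)) * of_real (apply_bcontfun W (s, j, t)))))
      = (\<Sum>j<n. integral {0..1} (\<lambda>t. ?f j (1 - t)))"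
      by (subst sum_sg) (intro sum.cong refl integral_cong, simp only: trm lessThan_iff)
    also have "\<dots> = (\<Sum>j<n. integral {0..1} (?f j))"
      by (intro sum.cong refl integral_reflect_01 cf) simp
    finally show ?thesis by (simp add: VV_def W'[symmetric] w'_def)
  qed
  have "Bcontfun (TT W') = W'"
  proof (rule bcontfun_eqI)
    fix p :: "real \<times> nat \<times> real"
    obtain s k t where p: "p = (s, k, t)" by (cases p)
    have "TT W' (s, k, t) = TT W (s, sg k, 1 - t)"
      using VV'[of k "uc t" s] VV'[of k 0 s] by (cases "k < n") (simp_all add: TT_def cnj_uc)
    also have "\<dots> = apply_bcontfun W (s, sg k, 1 - t)" using W Bcontfun_inverse[OF TT_bcontfun, of W] by simp
    also have "\<dots> = apply_bcontfun W' p" unfolding W'[symmetric] by (simp add: w'_def p)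
    finally show "apply_bcontfun (Bcontfun (TT W')) p = apply_bcontfun W' p"
      by (simp add: Bcontfun_inverse[OF TT_bcontfun] p)
  qed
  then have "W' = W" using W fixed_point_ex1 by blast
  then show ?thesis using VV'[OF k v] by simp
qed

lemma ex_ahlfors: "\<exists>s\<in>{-1/2..1/2}. is_ahlfors (X (as s)) (ff (as s)) 0"
proof -
  obtain W where W: "Bcontfun (TT W) = W" using fixed_point_ex1 by blast
  have TW: "apply_bcontfun W p = TT W p" for p using W Bcontfun_inverse[OF TT_bcontfun, of W] by simp
  define N where "N = dist W (const_bcontfun 0)"
  have N0: "0 \<le> N" by (simp add: N_def)
  have WN: "\<bar>apply_bcontfun W p\<bar> \<le> N" for p unfolding N_def by (rule apply_le_dist0)
  \<comment> \<open>An a priori bound from the fixed-point equation itself. It gives N <= 2 e, after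
    which \<open>TT_bound\<close> keeps the density within 7/20 e of e, hence positive.\<close>
  have "N \<le> 6/5 * e + 3/40 * N"
    unfolding N_def
  proof (rule dist_bound)
    fix p :: "real \<times> nat \<times> real"
    obtain s k t where p: "p = (s, k, t)" by (cases p)
    have "\<bar>TT W (s, k, t)\<bar> \<le> 6/5 * e + 3/40 * N"
    proof (cases "k < n")
      case True
      from TT_bound[where W = W and s = s and t = t, OF True WN] show ?thesis using e_pos by linarith
    qed (use e_pos N0 in \<open>simp add: TT_def\<close>)
    then show "dist (apply_bcontfun W p) (apply_bcontfun (const_bcontfun 0) p) \<le> 6/5 * e + 3/40 * dist W (const_bcontfun 0)"
      by (simp add: TW p dist_real_def const_bcontfun.rep_eq N_def)
  qed
  then have "N \<le> 2 * e" using e_pos by linarith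
  then have B: "\<bar>apply_bcontfun W p\<bar> \<le> 2 * e" for p using WN[of p] by linarith
  have pos: "0 \<le> TT W (s, k, t)" if "k < n" for s k t
    using TT_bound[where W = W and s = s and t = t, OF that B] e_pos by linarith
  have n0: "0 < n" "1 < n" using n2 by auto
  have c0: "continuous_on {-1/2..1/2} (\<lambda>s. Im (VV W s 0 0))"
  proof -
    have "continuous_on {-1/2..1/2} (\<lambda>s. (\<lambda>(s, v). VV W s 0 v) (s, 0))"
      by (rule continuous_on_compose2[OF continuous_VV[OF n0(1)]]) (auto intro!: continuous_intros)
    then show ?thesis by (auto intro!: continuous_intros)
  qed
  \<comment> \<open>The kernel term moves the obstruction by at most e/20, whereas the turned
    residue contributes -e/2 and e/2 at the two ends of the interval; this forces the sign
    change.\<close>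
  have close: "\<bar>Im (VV W s 0 0) - e * cl s\<bar> \<le> e / 20" for s
  proof -
    have "cmod (VV W s 0 0 - zt (as s) 0 (Z (as s) 0 0)) \<le> 2 * e / 40"
      by (rule VV_bound[OF n0(1) _ B]) simp
    then have "cmod (VV W s 0 0 - as s 0) \<le> e / 20" using n0 by simp
    then show ?thesis using abs_Im_le_cmod[of "VV W s 0 0 - as s 0"] by (simp add: as_def)
  qed
  have cl: "cl (-1/2) = -1/2" "cl (1/2) = 1/2" by (simp_all add: cl_def)
  note close[of "-1/2", unfolded cl] close[of "1/2", unfolded cl]
  then have "Im (VV W (-1/2) 0 0) \<le> 0" "0 \<le> Im (VV W (1/2) 0 0)"
    using e_pos by (linarith, linarith)
  from IVT'[OF this _ c0] obtain s where s: "s \<in> {-1/2..1/2}" "Im (VV W s 0 0) = 0" by auto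
  have sy: "VV W s k 0 = cnj (VV W s (sg k) 0)" if "k < n" for k
    using fixed_point_symmetric[OF W that, of 0 s] by simp
  have "is_ahlfors (X (as s)) (ff (as s)) 0"
  proof (rule extremal[where V = "VV W s" and U = "\<lambda>k t. 2 * Re (VV W s k (uc t)) - Re (VV W s k 0)"])
    show "Im (VV W s k 0) = 0" if "k < n" for k
    proof -
      consider "k = 0" | "k = 1" | "sg k = k" by (metis sg_def)
      then show ?thesis
      proof cases
        case 2
        then have "Im (VV W s k 0) = - Im (VV W s 0 0)" using sy[OF that] by (simp add: sg_def)
        then show ?thesis using s by simp
      next
        case 3
        then have "VV W s k 0 = cnj (VV W s k 0)" using sy[OF that] by simp
        then show ?thesis by (simp add: complex_eq_iff)
      qed (use s in simp)
    qed
    show "0 \<le> 2 * Re (VV W s k (uc t)) - Re (VV W s k 0)" if "k < n" for k t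
      using pos[OF that, of s t] that by (simp add: TT_def)
    show "VV W s k v = zt (as s) k (Z (as s) k v) - (\<Sum>j<n. integral {0..1} (\<lambda>t. KK (as s) k j (Z (as s) j (uc t)) (Z (as s) k v)
        * of_real (2 * Re (VV W s j (uc t)) - Re (VV W s j 0))))" for k v
      unfolding VV_def[of W s k v] by (simp add: TW TT_def)
  qed (auto intro: holomorphic_VV)
  with s(1) show ?thesis by blast
qed

end

subsection \<open>A variation of equal residues\<close>

locale variation =
  fixes n :: nat and b :: "nat \<Rightarrow> complex" and \<beta> \<eta> :: "nat \<Rightarrow> real"
  assumes inj: "\<And>i j. i < n \<Longrightarrow> j < n \<Longrightarrow> i \<noteq> j \<Longrightarrow> b i \<noteq> b j"
begin

text \<open>The competitor has residues \<open>e (1 + \<delta> (\<i> \<beta> j - e\<^sup>2 \<eta> j))\<close>. The coefficients \<open>p2\<close> and \<open>p3\<close> of the higher poles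
  cancel the real parts of the terms of frequency 1 and 2 on the boundary circles, which leaves
  \<open>e\<^sup>2 (2 Re (cnj (SS k) * AA k 0) - \<eta> k) + O(e\<^sup>3)\<close>.\<close>
definition SS where "SS k = (\<Sum>j\<in>{..<n}-{k}. \<i> * of_real (\<beta> j - \<beta> k) / (b k - b j))"
text \<open>The first-order Taylor remainder of \<open>SS\<close>: the sum with denominators
  \<open>x + (b k - b j)\<close> equals \<open>SS k - x * TT k x\<close>. It is unrelated to the
  fixed-point operator of the same name in \<open>poles\<close>.\<close>

definition TT where "TT k x = (\<Sum>j\<in>{..<n}-{k}. \<i> * of_real (\<beta> j - \<beta> k) / ((b k - b j) * (x + (b k - b j))))"
definition AA where "AA k x = (\<Sum>j\<in>{..<n}-{k}. 1 / (x + (b k - b j)))"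
definition HH where "HH k x = (\<Sum>j\<in>{..<n}-{k}. of_real (\<eta> j - \<eta> k) / (x + (b k - b j)))"
definition QQ where "QQ k e x = (\<Sum>j\<in>{..<n}-{k}. - cnj (SS j) / (x + (b k - b j))^2
   + of_real e^2 * cnj (TT j 0) / (x + (b k - b j))^3)"
definition p1 :: "real \<Rightarrow> nat \<Rightarrow> complex" where "p1 e j = of_real e * (\<i> * of_real (\<beta> j) - of_real e^2 * of_real (\<eta> j))"
definition p2 :: "real \<Rightarrow> nat \<Rightarrow> complex" where "p2 e j = - (of_real e^3) * cnj (SS j)"
definition p3 :: "real \<Rightarrow> nat \<Rightarrow> complex" where "p3 e j = of_real e^5 * cnj (TT j 0)"
definition FF :: "real \<Rightarrow> complex \<Rightarrow> complex" where "FF e z = (\<Sum>j<n. of_real e / (z - b j))"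
definition GG :: "real \<Rightarrow> complex \<Rightarrow> complex" where
  "GG e z = (\<Sum>j<n. p1 e j / (z - b j) + p2 e j / (z - b j)^2 + p3 e j / (z - b j)^3)"

text \<open>An exact identity in e. On the boundary w is unimodular, so \<open>w * GG\<close> is
  \<open>GG * cnj (FF)\<close>, the first variation of the squared modulus up to a factor 2.
  \<open>p2\<close> is chosen so that the term of order e is purely imaginary; \<open>p3\<close>
  does the same for the frequency-2 part of order e^2 once y is replaced by w.\<close>

lemma expansion:
  fixes e :: real
  assumes k: "k < n" and e: "0 < e" and x: "x \<noteq> 0" and d: "\<And>j. j \<in> {..<n} - {k} \<Longrightarrow> x + (b k - b j) \<noteq> 0"
    and F: "FF e (b k + x) \<noteq> 0" and w: "w = 1 / FF e (b k + x)" and y: "y = x / of_real e"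
  shows "y = w + w * x * AA k x"
    "w * GG e (b k + x) = \<i> * of_real (\<beta> k) - of_real e^2 * of_real (\<eta> k) + of_real e * (w * SS k - cnj (SS k) / w)
      + of_real e^2 * (- w * y * TT k x + 2 * cnj (SS k) * AA k x + cnj (TT k 0) * w / y^3)
      + of_real e^3 * (- w * HH k x - w * cnj (SS k) * (AA k x)^2 + w * QQ k e x)"
proof -
  let ?e = "of_real e :: complex"
  define A where "A = AA k x"
  define Y where "Y = 1 / y"
  define u where "u = 1 / w"
  define h where "h = \<i> * of_real (\<beta> k) - ?e^2 * of_real (\<eta> k)"
  have e0: "?e \<noteq> 0" using e by simp
  have y0: "y \<noteq> 0" using x e0 y by simp
  have w0: "w \<noteq> 0" using F w by simp
  have xy: "x = ?e * y" using e0 y by simp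
  have FA: "FF e (b k + x) = Y + ?e * A"
  proof -
    have "FF e (b k + x) = ?e / (b k + x - b k) + (\<Sum>j\<in>{..<n}-{k}. ?e / (b k + x - b j))"
      unfolding FF_def using k by (intro sum.remove) auto
    also have "(\<Sum>j\<in>{..<n}-{k}. ?e / (b k + x - b j)) = ?e * A"
      unfolding A_def AA_def sum_distrib_left by (intro sum.cong refl) (simp add: algebra_simps)
    finally show ?thesis using e0 x by (simp add: Y_def y)
  qed
  have uY: "Y = u - ?e * A" using FA w F by (simp add: u_def)
  have wu: "w * u = 1" using w0 by (simp add: u_def)
  have Yy: "Y * y = 1" using y0 by (simp add: Y_def)
  have "w * (Y + ?e * A) = 1" using wu uY by simp
  then have "y = w * (Y + ?e * A) * y" by simp
  also have "\<dots> = w * (Y * y) + w * (?e * y) * A" by (simp add: algebra_simps)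
  finally show "y = w + w * x * AA k x" unfolding Yy xy[symmetric] A_def by simp
  have s1: "(\<Sum>j\<in>{..<n}-{k}. p1 e j / (x + (b k - b j))) = ?e * (h * A + (SS k - x * TT k x) - ?e^2 * HH k x)"
  proof -
    have "?e * (h * A + (SS k - x * TT k x) - ?e^2 * HH k x) =
      (\<Sum>j\<in>{..<n}-{k}. ?e * (h * (1 / (x + (b k - b j))) + (\<i> * of_real (\<beta> j - \<beta> k) / (b k - b j)
         - x * (\<i> * of_real (\<beta> j - \<beta> k) / ((b k - b j) * (x + (b k - b j)))))
         - ?e^2 * (of_real (\<eta> j - \<eta> k) / (x + (b k - b j)))))"
      unfolding A_def AA_def SS_def TT_def HH_def
      by (simp only: sum_distrib_left distrib_left right_diff_distrib sum.distrib sum_subtractf)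
    also have "\<dots> = (\<Sum>j\<in>{..<n}-{k}. p1 e j / (x + (b k - b j)))"
    proof (rule sum.cong[OF refl])
      fix j assume j: "j \<in> {..<n} - {k}"
      have dj: "b k - b j \<noteq> 0" using inj[of k j] j k by auto
      define D where "D = b k - b j"
      define q where "q = \<i> * of_real (\<beta> j - \<beta> k)"
      have D: "D \<noteq> 0" "x + D \<noteq> 0" using dj d[OF j] by (auto simp: D_def)
      have q1: "q / D - x * (q / (D * (x + D))) = q / (x + D)" using D by (simp add: divide_simps) (simp add: algebra_simps)
      have q2: "p1 e j = ?e * (h + q - ?e^2 * of_real (\<eta> j - \<eta> k))"
        by (simp add: p1_def h_def q_def algebra_simps)
      show "?e * (h * (1 / (x + (b k - b j))) + (\<i> * of_real (\<beta> j - \<beta> k) / (b k - b j)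
         - x * (\<i> * of_real (\<beta> j - \<beta> k) / ((b k - b j) * (x + (b k - b j)))))
         - ?e^2 * (of_real (\<eta> j - \<eta> k) / (x + (b k - b j)))) = p1 e j / (x + (b k - b j))"
        unfolding q_def[symmetric] D_def[symmetric] q1 q2 using D(2)
        by (simp add: divide_simps)
    qed
    finally show ?thesis by simp
  qed
  have s2: "(\<Sum>j\<in>{..<n}-{k}. p2 e j / (x + (b k - b j))^2 + p3 e j / (x + (b k - b j))^3) = ?e^3 * QQ k e x"
    unfolding QQ_def sum_distrib_left
  proof (rule sum.cong[OF refl])
    fix j assume j: "j \<in> {..<n} - {k}"
    have "?e^5 = ?e^3 * ?e^2" by (simp add: eval_nat_numeral)
    then show "p2 e j / (x + (b k - b j))^2 + p3 e j / (x + (b k - b j))^3 =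
       ?e^3 * (- cnj (SS j) / (x + (b k - b j))^2 + ?e^2 * cnj (TT j 0) / (x + (b k - b j))^3)"
      by (simp add: p2_def p3_def distrib_left mult.assoc right_diff_distrib)
  qed
  have "GG e (b k + x) = (p1 e k / x + p2 e k / x^2 + p3 e k / x^3) +
      (\<Sum>j\<in>{..<n}-{k}. p1 e j / (x + (b k - b j)) + (p2 e j / (x + (b k - b j))^2 + p3 e j / (x + (b k - b j))^3))"
    unfolding GG_def using k by (subst sum.remove[of _ k]) (auto simp: algebra_simps)
  also have "\<dots> = (p1 e k / x + p2 e k / x^2 + p3 e k / x^3) +
     (?e * (h * A + (SS k - x * TT k x) - ?e^2 * HH k x) + ?e^3 * QQ k e x)"
    by (simp only: sum.distrib[of "\<lambda>j. p1 e j / (x + (b k - b j))"] s1 s2)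
  also have "p1 e k / x + p2 e k / x^2 + p3 e k / x^3 = h * Y - ?e * cnj (SS k) * Y^2 + ?e^2 * cnj (TT k 0) * Y^3"
    unfolding xy p1_def p2_def p3_def Y_def h_def using e0 y0
    by (simp add: field_simps power2_eq_square power3_eq_cube eval_nat_numeral)
  finally have G: "GG e (b k + x) = h * Y - ?e * cnj (SS k) * Y^2 + ?e^2 * cnj (TT k 0) * Y^3 +
     (?e * (h * A + (SS k - x * TT k x) - ?e^2 * HH k x) + ?e^3 * QQ k e x)" .
  have w1: "w * Y = 1 - ?e * w * A" unfolding uY using wu by (simp add: algebra_simps)
  have w2: "w * Y^2 = u - 2 * ?e * A + ?e^2 * w * A^2"
  proof -
    have "w * Y^2 = (w * u) * u - 2 * ?e * A * (w * u) + ?e^2 * w * A^2"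
      unfolding uY by (simp add: power2_eq_square algebra_simps)
    then show ?thesis by (simp add: wu)
  qed
  have "w * GG e (b k + x) = h * (w * Y) - ?e * cnj (SS k) * (w * Y^2) + ?e^2 * cnj (TT k 0) * w * Y^3 +
     (?e * (h * (w * A) + w * SS k - w * x * TT k x - ?e^2 * (w * HH k x)) + ?e^3 * (w * QQ k e x))"
    unfolding G by (simp add: algebra_simps)
  also have "\<dots> = h * (w * Y) - ?e * cnj (SS k) * (w * Y^2) + ?e^2 * cnj (TT k 0) * w * Y^3 +
     (?e * (h * (w * A) + w * SS k - w * (?e * y) * TT k x - ?e^2 * (w * HH k x)) + ?e^3 * (w * QQ k e x))"
    by (simp only: xy[symmetric])
  also have "\<dots> = h + ?e * (w * SS k - cnj (SS k) * u)
      + ?e^2 * (- w * y * TT k x + 2 * cnj (SS k) * A + cnj (TT k 0) * w * Y^3)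
      + ?e^3 * (- w * HH k x - w * cnj (SS k) * A^2 + w * QQ k e x)"
    unfolding w1 w2 by (simp add: algebra_simps power2_eq_square power3_eq_cube)
  finally show "w * GG e (b k + x) = \<i> * of_real (\<beta> k) - ?e^2 * of_real (\<eta> k) + ?e * (w * SS k - cnj (SS k) / w)
      + ?e^2 * (- w * y * TT k x + 2 * cnj (SS k) * AA k x + cnj (TT k 0) * w / y^3)
      + ?e^3 * (- w * HH k x - w * cnj (SS k) * (AA k x)^2 + w * QQ k e x)"
    by (simp add: h_def u_def A_def Y_def power_divide)
qed

lemma cnj_inverse_unit: assumes "cmod w = 1" shows "cnj w = 1 / w"
proof -
  have "w * cnj w = 1" using assms by (simp flip: complex_norm_square)
  moreover have "w \<noteq> 0" using assms by auto
  ultimately show ?thesis by (simp add: field_simps)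
qed

lemma Re_anti: assumes "cmod w = 1" shows "Re (w * s - cnj s / w) = 0"
proof -
  have "cnj s / w = cnj (w * s)" using cnj_inverse_unit[OF assms] by simp
  then show ?thesis by simp
qed

text \<open>Compactness replaces uniform error bounds. Counterexamples with e tending to 0 have
  unimodular w, so a subsequence converges to some \<open>W\<close>; x tends to 0 and y to the same
  \<open>W\<close>. Dividing the real part of \<open>expansion\<close> by e^2 and passing to the
  limit contradicts the strict inequality for \<open>\<eta> k\<close>.\<close>

lemma eventually_negative_at:
  assumes k: "k < n" and eta: "2 * Re (cnj (SS k) * AA k 0) < \<eta> k"
  shows "\<forall>\<^sub>F e in at_right 0. \<forall>x. x \<noteq> 0 \<and> cmod x \<le> real n * e \<and> cmod (FF e (b k + x)) = 1 \<longrightarrow>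
      Re (GG e (b k + x) * cnj (FF e (b k + x))) < 0"
proof (rule ccontr)
  let ?P = "\<lambda>e. \<forall>x. x \<noteq> 0 \<and> cmod x \<le> real n * e \<and> cmod (FF e (b k + x)) = 1 \<longrightarrow>
      Re (GG e (b k + x) * cnj (FF e (b k + x))) < 0"
  assume np: "\<not> (\<forall>\<^sub>F e in at_right 0. ?P e)"
  have "\<exists>e x. 0 < e \<and> e < 1 / real (Suc m) \<and> x \<noteq> 0 \<and> cmod x \<le> real n * e \<and> cmod (FF e (b k + x)) = 1
       \<and> 0 \<le> Re (GG e (b k + x) * cnj (FF e (b k + x)))" for m
  proof -
    have "0 < 1 / real (Suc m)" by simp
    then have "\<exists>e>0. e < 1 / real (Suc m) \<and> \<not> ?P e"
      using np unfolding eventually_at_right_field by blast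
    then show ?thesis by (meson not_less)
  qed
  then obtain e x where ex: "\<And>m. 0 < e m" "\<And>m. e m < 1 / real (Suc m)" "\<And>m. x m \<noteq> 0" "\<And>m. cmod (x m) \<le> real n * e m"
     "\<And>m. cmod (FF (e m) (b k + x m)) = 1" "\<And>m. 0 \<le> Re (GG (e m) (b k + x m) * cnj (FF (e m) (b k + x m)))"
    by metis
  define w where "w m = 1 / FF (e m) (b k + x m)" for m
  have w1: "cmod (w m) = 1" for m using ex(5) by (simp add: w_def norm_divide)
  have "\<forall>m. w m \<in> sphere 0 1" using w1 by simp
  then obtain W r where r: "W \<in> sphere 0 1" "strict_mono r" "(w \<circ> r) \<longlonglongrightarrow> W"
    using compact_sphere[of "0::complex" 1, unfolded compact_def] by blast
  have W1: "cmod W = 1" using r by simp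
  then have W0: "W \<noteq> 0" by auto
  have "(\<lambda>m. 1 / real (Suc m)) \<longlonglongrightarrow> 0" by (rule LIMSEQ_Suc[OF lim_1_over_n])
  then have e0: "e \<longlonglongrightarrow> 0"
    by (rule tendsto_sandwich[OF _ _ tendsto_const, rotated 2])
       (use ex(1,2) less_imp_le in \<open>auto intro!: always_eventually\<close>)
  have er: "(\<lambda>m. e (r m)) \<longlonglongrightarrow> 0" using LIMSEQ_subseq_LIMSEQ[OF e0 r(2)] by (simp add: o_def)
  have ner: "(\<lambda>m. real n * e (r m)) \<longlonglongrightarrow> 0" using tendsto_mult_right_zero[OF er] by simp
  have xr: "(\<lambda>m. x (r m)) \<longlonglongrightarrow> 0"
    by (rule Lim_null_comparison[OF _ ner]) (use ex(4) in auto)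
  have wr: "(\<lambda>m. w (r m)) \<longlonglongrightarrow> W" using r(3) by (simp add: o_def)
  have dn: "b k - b j \<noteq> 0" if "j \<in> {..<n} - {k}" for j using inj[of k j] that k by auto
  have lA: "(\<lambda>m. AA k (x (r m))) \<longlonglongrightarrow> AA k 0"
    unfolding AA_def by (intro tendsto_intros xr) (use dn in auto)
  have lT: "(\<lambda>m. TT k (x (r m))) \<longlonglongrightarrow> TT k 0"
    unfolding TT_def by (intro tendsto_intros xr) (use dn in auto)
  have lH: "(\<lambda>m. HH k (x (r m))) \<longlonglongrightarrow> HH k 0"
    unfolding HH_def by (intro tendsto_intros xr) (use dn in auto)
  have lQ: "(\<lambda>m. QQ k (e (r m)) (x (r m))) \<longlonglongrightarrow> QQ k 0 0"
    unfolding QQ_def by (intro tendsto_intros xr er) (use dn in auto)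
  define y where "y m = x m / of_real (e m)" for m
  have "(\<forall>\<^sub>F m in sequentially. \<forall>j\<in>{..<n}-{k}. x (r m) + (b k - b j) \<noteq> 0)"
  proof (intro eventually_ball_finite ballI)
    fix j assume j: "j \<in> {..<n} - {k}"
    have "(\<lambda>m. x (r m) + (b k - b j)) \<longlonglongrightarrow> 0 + (b k - b j)" by (intro tendsto_intros xr)
    then show "\<forall>\<^sub>F m in sequentially. x (r m) + (b k - b j) \<noteq> 0"
      by (rule tendsto_imp_eventually_ne) (use dn[OF j] in simp)
  qed simp
  then have ev: "\<forall>\<^sub>F m in sequentially. y (r m) = w (r m) + w (r m) * x (r m) * AA k (x (r m)) \<and>
    w (r m) * GG (e (r m)) (b k + x (r m)) = \<i> * of_real (\<beta> k) - of_real (e (r m))^2 * of_real (\<eta> k)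
      + of_real (e (r m)) * (w (r m) * SS k - cnj (SS k) / w (r m))
      + of_real (e (r m))^2 * (- w (r m) * y (r m) * TT k (x (r m)) + 2 * cnj (SS k) * AA k (x (r m)) + cnj (TT k 0) * w (r m) / (y (r m))^3)
      + of_real (e (r m))^3 * (- w (r m) * HH k (x (r m)) - w (r m) * cnj (SS k) * (AA k (x (r m)))^2 + w (r m) * QQ k (e (r m)) (x (r m)))"
  proof eventually_elim
    case (elim m)
    have F0: "FF (e (r m)) (b k + x (r m)) \<noteq> 0" using ex(5)[of "r m"] by auto
    have d0: "\<And>j. j \<in> {..<n} - {k} \<Longrightarrow> x (r m) + (b k - b j) \<noteq> 0" using elim by blast
    from expansion[OF k ex(1)[of "r m"] ex(3)[of "r m"] d0 F0 w_def[of "r m"] y_def[of "r m"]]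
    show ?case by (rule conjI)
  qed
  have yr: "(\<lambda>m. y (r m)) \<longlonglongrightarrow> W"
  proof (rule Lim_transform_eventually)
    have "(\<lambda>m. w (r m) + w (r m) * x (r m) * AA k (x (r m))) \<longlonglongrightarrow> W + W * 0 * AA k 0"
      by (intro tendsto_intros wr xr lA)
    then show "(\<lambda>m. w (r m) + w (r m) * x (r m) * AA k (x (r m))) \<longlonglongrightarrow> W" by simp
    show "\<forall>\<^sub>F m in sequentially. w (r m) + w (r m) * x (r m) * AA k (x (r m)) = y (r m)"
      using ev by eventually_elim simp
  qed
  define B where "B m = - w (r m) * y (r m) * TT k (x (r m)) + 2 * cnj (SS k) * AA k (x (r m)) + cnj (TT k 0) * w (r m) / (y (r m))^3" for m
  define C where "C m = - w (r m) * HH k (x (r m)) - w (r m) * cnj (SS k) * (AA k (x (r m)))^2 + w (r m) * QQ k (e (r m)) (x (r m))" for m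
  have lB: "B \<longlonglongrightarrow> - W * W * TT k 0 + 2 * cnj (SS k) * AA k 0 + cnj (TT k 0) * W / W^3"
    unfolding B_def by (intro tendsto_intros wr yr lT lA) (use W0 in auto)
  have lC: "C \<longlonglongrightarrow> - W * HH k 0 - W * cnj (SS k) * (AA k 0)^2 + W * QQ k 0 0"
    unfolding C_def by (intro tendsto_intros wr lH lA lQ)
  have lim: "(\<lambda>m. - \<eta> k + Re (B m) + e (r m) * Re (C m)) \<longlonglongrightarrow>
     - \<eta> k + Re (- W * W * TT k 0 + 2 * cnj (SS k) * AA k 0 + cnj (TT k 0) * W / W^3)
     + 0 * Re (- W * HH k 0 - W * cnj (SS k) * (AA k 0)^2 + W * QQ k 0 0)"
    by (intro tendsto_intros lB lC er)
  have "\<forall>\<^sub>F m in sequentially. 0 \<le> - \<eta> k + Re (B m) + e (r m) * Re (C m)"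
    using ev
  proof eventually_elim
    case (elim m)
    define a where "a = w (r m) * SS k - cnj (SS k) / w (r m)"
    have a0: "Re a = 0" unfolding a_def by (rule Re_anti[OF w1])
    have "cnj (FF (e (r m)) (b k + x (r m))) = w (r m)"
      using cnj_inverse_unit[OF ex(5)[of "r m"]] by (simp add: w_def)
    then have "0 \<le> Re (w (r m) * GG (e (r m)) (b k + x (r m)))" using ex(6)[of "r m"] by (simp only: mult.commute)
    also have "w (r m) * GG (e (r m)) (b k + x (r m)) = \<i> * of_real (\<beta> k) - of_real ((e (r m))\<^sup>2 * \<eta> k)
      + of_real (e (r m)) * a + of_real ((e (r m))\<^sup>2) * B m + of_real ((e (r m))^3) * C m"
      using elim unfolding a_def B_def C_def by simp
    also have "Re \<dots> = (e (r m))\<^sup>2 * (- \<eta> k + Re (B m) + e (r m) * Re (C m))"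
    proof -
      have rc: "Re (of_real c * z) = c * Re z" for c :: real and z by simp
      have "Re (\<i> * of_real (\<beta> k)) = 0" by simp
      then show ?thesis
        by (simp only: plus_complex.sel minus_complex.sel rc Re_complex_of_real a0)
           (simp add: algebra_simps power2_eq_square power3_eq_cube)
    qed
    finally show ?case using ex(1)[of "r m"] by (simp add: zero_le_mult_iff)
  qed
  from tendsto_lowerbound[OF lim this]
  have "0 \<le> - \<eta> k + Re (- W * W * TT k 0 + 2 * cnj (SS k) * AA k 0 + cnj (TT k 0) * W / W^3)" by simp
  \<comment> \<open>In the limit the \<open>TT k 0\<close> terms are a number minus its conjugate,
    by \<open>Re_anti\<close> at \<open>W * W\<close>, and only the frequency-0 term has a real
    part.\<close>
  moreover have "- W * W * TT k 0 + 2 * cnj (SS k) * AA k 0 + cnj (TT k 0) * W / W^3 =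
      of_real 2 * (cnj (SS k) * AA k 0) - ((W * W) * TT k 0 - cnj (TT k 0) / (W * W))"
    using W0 by (simp add: power3_eq_cube)
  moreover have "Re ((W * W) * TT k 0 - cnj (TT k 0) / (W * W)) = 0"
    by (rule Re_anti) (simp add: norm_mult W1)
  moreover have "Re (of_real 2 * (cnj (SS k) * AA k 0)) = 2 * Re (cnj (SS k) * AA k 0)" by simp
  ultimately show False using eta by (simp only: minus_complex.sel[of "of_real 2 * (cnj (SS k) * AA k 0)"])
qed

text \<open>Every point with \<open>cmod (FF e z) = 1\<close> is within \<open>n * e\<close> of some
  pole: otherwise each of the n summands would have modulus below 1/n. So the local statements cover
  the whole level curve.\<close>

lemma eventually_negative:
  assumes eta: "\<And>k. k < n \<Longrightarrow> 2 * Re (cnj (SS k) * AA k 0) < \<eta> k"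
  shows "\<forall>\<^sub>F e in at_right 0. \<forall>z. (\<forall>k<n. z \<noteq> b k) \<and> cmod (FF e z) = 1 \<longrightarrow> Re (GG e z * cnj (FF e z)) < 0"
proof -
  have "\<forall>\<^sub>F e in at_right 0. \<forall>k\<in>{..<n}. \<forall>x. x \<noteq> 0 \<and> cmod x \<le> real n * e \<and> cmod (FF e (b k + x)) = 1 \<longrightarrow>
      Re (GG e (b k + x) * cnj (FF e (b k + x))) < 0"
    by (intro eventually_ball_finite ballI eventually_negative_at eta) auto
  moreover have "\<forall>\<^sub>F e in at_right 0. (0::real) < e" by (simp add: eventually_at_right_less)
  ultimately show ?thesis
  proof eventually_elim
    case (elim e)
    show ?case
    proof (intro allI impI, elim conjE)
      fix z assume z: "\<forall>k<n. z \<noteq> b k" "cmod (FF e z) = 1"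
      have "\<exists>k<n. cmod (z - b k) \<le> real n * e"
      proof (rule ccontr)
        assume "\<not> ?thesis"
        then have far: "real n * e < cmod (z - b k)" if "k < n" for k using that by force
        have n0: "0 < n"
        proof (rule ccontr)
          assume "\<not> 0 < n"
          then have "FF e z = 0" unfolding FF_def by simp
          then show False using z(2) by simp
        qed
        have "cmod (FF e z) < (\<Sum>j<n. 1 / real n)" unfolding FF_def
        proof (rule le_less_trans[OF norm_sum], rule sum_strict_mono)
          fix j assume "j \<in> {..<n}"
          then have j: "j < n" by simp
          have n1: "0 < real n" using n0 by simp
          have "0 < real n * e" using n0 elim(2) by simp
          then have "e / cmod (z - b j) < e / (real n * e)"
            using far[OF j] elim(2) by (intro divide_strict_left_mono mult_pos_pos) (use n1 in linarith)+
          then show "cmod (of_real e / (z - b j)) < 1 / real n"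
            using elim by (simp add: norm_divide)
        qed (use n0 in auto)
        then show False using z(2) n0 by simp
      qed
      then obtain k where k: "k < n" "cmod (z - b k) \<le> real n * e" by blast
      have "Re (GG e (b k + (z - b k)) * cnj (FF e (b k + (z - b k)))) < 0"
        using elim(1)[rule_format, of k "z - b k"] k z by simp
      then show "Re (GG e z * cnj (FF e z)) < 0" by simp
    qed
  qed
qed

end

subsection \<open>Equal residues are not extremal\<close>

lemma cmod_add_sq: "(cmod (x + y))\<^sup>2 = (cmod x)\<^sup>2 + 2 * Re (y * cnj x) + (cmod y)\<^sup>2"
  unfolding cmod_power2 by (simp add: power2_eq_square algebra_simps)

context poles
begin

text \<open>A common form for the variation and for the competitor, whose coefficients are those of
  \<open>ff a\<close> plus a small multiple of those of the variation.\<close>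

definition RR where "RR c1 c2 c3 z = (\<Sum>j<n. c1 j / (z - b j) + c2 j / (z - b j)^2 + c3 j / (z - b j)^3)"

lemma RR_holo: "(\<And>k. k < n \<Longrightarrow> b k \<notin> S) \<Longrightarrow> RR c1 c2 c3 holomorphic_on S"
  unfolding RR_def by (intro holomorphic_intros) auto

lemma RR_at_inverse:
  assumes "w \<noteq> 0"
  shows "RR c1 c2 c3 (1 / w) = (\<Sum>j<n. c1 j * w / (1 - b j * w) + c2 j * w^2 / (1 - b j * w)^2 + c3 j * w^3 / (1 - b j * w)^3)"
proof -
  have "1 / w - b j = (1 - b j * w) / w" for j using assms by (simp add: field_simps)
  then show ?thesis using assms by (simp add: RR_def power_divide)
qed

lemma RR_holo_inf: assumes "adm a" shows "holo_inf (X a) (RR c1 c2 c3) 0"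
proof -
  obtain r where r: "0 < r" "\<And>w. 0 < cmod w \<Longrightarrow> cmod w < r \<Longrightarrow> 1 / w \<in> X a"
    "\<And>w j. cmod w < r \<Longrightarrow> j < n \<Longrightarrow> 1 - b j * w \<noteq> 0" using X_nhd_infinity[OF assms] by metis
  have "(\<lambda>w. \<Sum>j<n. c1 j * w / (1 - b j * w) + c2 j * w^2 / (1 - b j * w)^2 + c3 j * w^3 / (1 - b j * w)^3) holomorphic_on ball 0 r"
    using r(3) by (intro holomorphic_intros) auto
  then have "(\<lambda>w. if w = 0 then 0 else RR c1 c2 c3 (1 / w)) holomorphic_on ball 0 r"
    by (rule holomorphic_transform) (auto simp: RR_at_inverse)
  moreover have "RR c1 c2 c3 holomorphic_on X a" by (rule RR_holo) (auto simp: X_def)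
  ultimately show ?thesis using r by (auto simp: holo_inf_def)
qed

lemma tendsto_RR: "((\<lambda>z. z * RR c1 c2 c3 z) \<longlongrightarrow> (\<Sum>j<n. c1 j)) at_infinity"
proof -
  have "((\<lambda>w. \<Sum>j<n. c1 j / (1 - b j * w) + c2 j * w / (1 - b j * w)^2 + c3 j * w^2 / (1 - b j * w)^3) \<longlongrightarrow>
     (\<Sum>j<n. c1 j / (1 - b j * 0) + c2 j * 0 / (1 - b j * 0)^2 + c3 j * 0^2 / (1 - b j * 0)^3)) (at 0)"
    by (intro tendsto_intros) auto
  then have "((\<lambda>w. \<Sum>j<n. c1 j / (1 - b j * w) + c2 j * w / (1 - b j * w)^2 + c3 j * w^2 / (1 - b j * w)^3) \<longlongrightarrow> (\<Sum>j<n. c1 j)) (at 0)"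
    by simp
  then have "((\<lambda>w. inverse w * RR c1 c2 c3 (inverse w)) \<longlongrightarrow> (\<Sum>j<n. c1 j)) (at 0)"
  proof (rule Lim_transform_eventually)
    have "(\<Sum>j<n. c1 j / (1 - b j * w) + c2 j * w / (1 - b j * w)^2 + c3 j * w^2 / (1 - b j * w)^3) = inverse w * RR c1 c2 c3 (inverse w)"
      if "w \<noteq> 0" for w
    proof -
      have "inverse w * RR c1 c2 c3 (1 / w) = (\<Sum>j<n. c1 j / (1 - b j * w) + c2 j * w / (1 - b j * w)^2 + c3 j * w^2 / (1 - b j * w)^3)"
      proof -
        have i: "inverse w * (c * w / D) = c / D" for c D
        proof -
          have "inverse w * (c * w / D) = (inverse w * w) * (c / D)" by (simp only: divide_inverse mult_ac)
          then show ?thesis using that by simp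
        qed
        have i2: "inverse w * (c * w^2 / D) = c * w / D" "inverse w * (c * w^3 / D) = c * w^2 / D" for c D
          using i[of "c * w" D] i[of "c * w^2" D] by (simp_all add: power2_eq_square power3_eq_cube mult.assoc)
        show ?thesis unfolding RR_at_inverse[OF that] sum_distrib_left distrib_left i i2 ..
      qed
      then show ?thesis by (simp add: inverse_eq_divide)
    qed
    then show "\<forall>\<^sub>F w in at 0. (\<Sum>j<n. c1 j / (1 - b j * w) + c2 j * w / (1 - b j * w)^2 + c3 j * w^2 / (1 - b j * w)^3)
        = inverse w * RR c1 c2 c3 (inverse w)"
      by (auto simp: eventually_at_filter)
  qed
  then show ?thesis unfolding lim_at_infinity_0 by (simp add: o_def)
qed

text \<open>Makes the supremum in \<open>is_ahlfors\<close> a genuine upper bound. The radius in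
  \<open>holo_inf\<close> depends on g, but together with holomorphy on \<open>X a\<close> it
  extends g to one fixed disc at infinity, where Cauchy's inequality gives a uniform bound.\<close>

lemma deriv_inf_bounded:
  assumes a: "adm a"
  obtains C where "\<And>g d. holo_inf (X a) g d \<Longrightarrow> \<forall>z\<in>X a. cmod (g z) \<le> 1 \<Longrightarrow> cmod d \<le> 1 \<Longrightarrow> cmod (deriv_inf g d) \<le> C"
proof -
  obtain r where r: "0 < r" "\<And>w. 0 < cmod w \<Longrightarrow> cmod w < r \<Longrightarrow> 1 / w \<in> X a" using X_nhd_infinity[OF a] by metis
  have "cmod (deriv_inf g d) \<le> 1 / (r / 2)" if g: "holo_inf (X a) g d" "\<forall>z\<in>X a. cmod (g z) \<le> 1" "cmod d \<le> 1" for g d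
  proof -
    let ?G = "\<lambda>w. if w = 0 then d else g (1 / w)"
    obtain D where D: "deriv_inf g d = D" "(?G has_field_derivative D) (at 0)" using deriv_inf_eq[OF g(1)] by blast
    obtain r' where r': "0 < r'" "?G holomorphic_on ball 0 r'" using g(1) by (auto simp: holo_inf_def)
    have hg: "g holomorphic_on X a" using g(1) by (simp add: holo_inf_def)
    have "(g \<circ> (\<lambda>w. 1 / w)) holomorphic_on (ball 0 r - {0})"
    proof (rule holomorphic_on_compose_gen[OF _ hg])
      show "(\<lambda>w. 1 / w) ` (ball 0 r - {0}) \<subseteq> X a"
      proof (rule image_subsetI)
        fix w :: complex assume "w \<in> ball 0 r - {0}"
        then show "1 / w \<in> X a" by (intro r(2)) auto
      qed
    qed (auto intro!: holomorphic_intros)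
    then have h1: "?G holomorphic_on (ball 0 r - {0})"
      by (rule holomorphic_transform) auto
    have "?G holomorphic_on (ball 0 r - {0}) \<union> ball 0 r'"
      by (rule holomorphic_on_Un[OF h1 r'(2)]) auto
    then have h: "?G holomorphic_on ball 0 r"
      by (rule holomorphic_on_subset) (use r'(1) in auto)
    have "cmod ((deriv ^^ 1) ?G 0) \<le> fact 1 * 1 / (r/2)^1"
    proof (rule Cauchy_inequality)
      show "?G holomorphic_on ball 0 (r/2)" by (rule holomorphic_on_subset[OF h]) (use r(1) in auto)
      have "cball 0 (r/2) \<subseteq> ball (0::complex) r" using r(1) by auto
      then show "continuous_on (cball 0 (r/2)) ?G" using h holomorphic_on_imp_continuous_on continuous_on_subset by blast
      fix x :: complex assume "cmod (0 - x) = r / 2"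
      then show "cmod (?G x) \<le> 1" using r g(2,3) by auto
    qed (use r in auto)
    moreover have "deriv ?G 0 = D" by (rule DERIV_imp_deriv[OF D(2)])
    ultimately show ?thesis using D(1) by simp
  qed
  then show ?thesis using that by blast
qed

lemma frontier_X_abs: assumes a: "adm a" and z: "z \<in> frontier (X a)"
  shows "\<And>k. k < n \<Longrightarrow> z \<noteq> b k" "cmod (ff a z) = 1"
proof -
  obtain k v where kv: "k < n" "cmod v = 1" "z = b k + Z a k v" using z frontier_X[OF a] by auto
  have v0: "v \<noteq> 0" using kv by auto
  show "z \<noteq> b j" if "j < n" for j
    using Z_disjoint[OF a kv(1) that, of v 0] kv a v0 that by auto
  show "cmod (ff a z) = 1" using ff_Z[OF a kv(1) _ v0] kv by (simp add: norm_divide)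
qed

lemma compact_frontier_X: assumes a: "adm a" shows "compact (frontier (X a))"
  unfolding frontier_X[OF a]
proof (intro compact_UN)
  fix k assume "k \<in> {..<n}"
  then show "compact ((\<lambda>v. b k + Z a k v) ` sphere 0 1)"
    by (intro compact_continuous_image continuous_on_subset[OF contin_bZ[OF a]]) auto
qed simp

lemma not_ahlfors:
  assumes a: "adm a" and S0: "(\<Sum>j<n. a j) = of_real S0"
    and neg: "\<And>z. (\<forall>k<n. z \<noteq> b k) \<Longrightarrow> cmod (ff a z) = 1 \<Longrightarrow> Re (RR c1 c2 c3 z * cnj (ff a z)) < 0"
    and pos: "0 < Re (\<Sum>j<n. c1 j)"
  shows "\<not> is_ahlfors (X a) (ff a) 0"
proof
  assume ah: "is_ahlfors (X a) (ff a) 0"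
  let ?K = "frontier (X a)" and ?G = "RR c1 c2 c3"
  have bK: "b k \<notin> ?K" if "k < n" for k using frontier_X_abs(1)[OF a _ that, of "b k"] by blast
  have bcl: "b k \<notin> closure (X a)" if "k < n" for k
    using bK[OF that] that open_X[OF a] by (auto simp: frontier_def interior_open X_def)
  have hffG: "ff a holomorphic_on - (b ` {..<n})" "?G holomorphic_on - (b ` {..<n})"
    unfolding ff_def by (intro holomorphic_intros, force) (rule RR_holo, auto)
  have cK: "continuous_on ?K (ff a)" "continuous_on ?K ?G"
    using bK by (auto intro!: holomorphic_on_imp_continuous_on holomorphic_on_subset[OF hffG(1)] holomorphic_on_subset[OF hffG(2)])
  have Kne: "?K \<noteq> {}" unfolding frontier_X[OF a] using n_pos by auto
  have "\<exists>z0\<in>?K. \<forall>z\<in>?K. Re (?G z * cnj (ff a z)) \<le> Re (?G z0 * cnj (ff a z0))"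
    by (intro continuous_attains_sup compact_frontier_X a Kne continuous_intros cK)
  then obtain z0 where z0: "z0 \<in> ?K" "\<And>z. z \<in> ?K \<Longrightarrow> Re (?G z * cnj (ff a z)) \<le> Re (?G z0 * cnj (ff a z0))"
    by blast
  have "\<exists>z1\<in>?K. \<forall>z\<in>?K. cmod (?G z) \<le> cmod (?G z1)"
    by (intro continuous_attains_sup compact_frontier_X a Kne continuous_intros cK)
  then obtain z1 where z1: "\<And>z. z \<in> ?K \<Longrightarrow> cmod (?G z) \<le> cmod (?G z1)"
    by blast
  define m where "m = - Re (?G z0 * cnj (ff a z0))"
  define B where "B = cmod (?G z1)"
  have m: "0 < m" unfolding m_def using neg[of z0] frontier_X_abs[OF a z0(1)] by auto
  \<comment> \<open>On the frontier \<open>(cmod (g z))^2\<close> is at most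
    \<open>1 - 2 * dl * m + dl^2 * B^2\<close>, and this choice makes the quadratic term at most
    half of the linear gain. The summand 1 guards against B = 0.\<close>
  define dl where "dl = m / (B\<^sup>2 + 1)"
  have B1: "0 < B\<^sup>2 + 1" by (simp add: add_nonneg_pos)
  have dl: "0 < dl" "dl * B\<^sup>2 \<le> m"
  proof -
    show "0 < dl" using m B1 by (simp add: dl_def)
    have "dl * B\<^sup>2 \<le> dl * (B\<^sup>2 + 1)" using \<open>0 < dl\<close> by (intro mult_left_mono) auto
    also have "\<dots> = m" using B1 by (simp add: dl_def)
    finally show "dl * B\<^sup>2 \<le> m" .
  qed
  define g where "g = RR (\<lambda>j. a j + of_real dl * c1 j) (\<lambda>j. of_real dl * c2 j) (\<lambda>j. of_real dl * c3 j)"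
  have geq: "g z = ff a z + of_real dl * ?G z" for z
    by (simp add: g_def RR_def ff_def sum_distrib_left add_divide_distrib distrib_left add.assoc flip: sum.distrib)
  have gK: "cmod (g z) \<le> 1" if z: "z \<in> ?K" for z
  proof -
    have "(cmod (g z))\<^sup>2 = 1 + 2 * (dl * Re (?G z * cnj (ff a z))) + (dl * cmod (?G z))\<^sup>2"
      unfolding geq cmod_add_sq frontier_X_abs(2)[OF a z] using dl(1) by (simp add: norm_mult distrib_left mult.assoc)
    also have "(dl * cmod (?G z))\<^sup>2 \<le> (dl * B)\<^sup>2"
      using z1[OF z] dl(1) by (intro power_mono mult_left_mono) (auto simp: B_def)
    also have "(dl * B)\<^sup>2 = dl * (dl * B\<^sup>2)" by (simp add: power2_eq_square)
    also have "\<dots> \<le> dl * m" using dl by (intro mult_left_mono) auto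
    also have "dl * Re (?G z * cnj (ff a z)) \<le> dl * (- m)"
      using z0(2)[OF z] dl(1) by (intro mult_left_mono) (auto simp: m_def)
    finally have "(cmod (g z))\<^sup>2 \<le> 1 - dl * m" by simp
    also have "\<dots> \<le> 1\<^sup>2" using dl(1) m by simp
    finally show ?thesis by (rule power2_le_imp_le) simp
  qed
  have hg: "g holomorphic_on - (b ` {..<n})" unfolding g_def by (rule RR_holo) auto
  have tg: "((\<lambda>z. z * g z) \<longlongrightarrow> of_real S0 + of_real dl * (\<Sum>j<n. c1 j)) at_infinity"
    unfolding g_def using tendsto_RR[of "\<lambda>j. a j + of_real dl * c1 j" "\<lambda>j. of_real dl * c2 j" "\<lambda>j. of_real dl * c3 j"]
    by (simp add: sum.distrib S0 sum_distrib_left)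
  have "((\<lambda>z. inverse z * (z * g z)) \<longlongrightarrow> 0 * (of_real S0 + of_real dl * (\<Sum>j<n. c1 j))) at_infinity"
    by (intro tendsto_mult tendsto_inverse_0 tg)
  then have "((\<lambda>z. inverse z * (z * g z)) \<longlongrightarrow> 0) at_infinity" by simp
  then have "\<forall>\<^sub>F z in at_infinity. cmod (inverse z * (z * g z)) < 1"
    by (rule order_tendstoD(2)[OF tendsto_norm_zero]) simp
  then obtain R0 where R0: "\<And>z. R0 \<le> cmod z \<Longrightarrow> cmod (inverse z * (z * g z)) < 1"
    by (auto simp: eventually_at_infinity)
  have gbig: "cmod (g z) \<le> 1" if "max R0 1 \<le> cmod z" for z
  proof -
    have "z \<noteq> 0" using that by auto
    then have eq: "inverse z * (z * g z) = g z" by (simp flip: mult.assoc)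
    have "cmod (g z) < 1" using R0[of z, unfolded eq] that by simp
    then show ?thesis by simp
  qed
  have gX: "cmod (g z) \<le> 1" if z: "z \<in> X a" for z
  proof -
    \<comment> \<open>The domain is unbounded, so the maximum principle is applied inside a disc so
      large that its boundary lies where g is already small.\<close>
    define R where "R = max R0 1 + cmod z"
    have Rz: "cmod z < R" "max R0 1 \<le> R" unfolding R_def by auto
    let ?S = "X a \<inter> ball 0 R"
    have cl: "closure ?S \<subseteq> - (b ` {..<n})" using closure_mono[of ?S "X a"] bcl by auto
    show ?thesis
    proof (rule maximum_modulus_frontier[of g ?S])
      show "g holomorphic_on interior ?S"
        by (rule holomorphic_on_subset[OF hg]) (use cl interior_subset closure_subset in blast)
      show "continuous_on (closure ?S) g"
        by (rule continuous_on_subset[OF holomorphic_on_imp_continuous_on[OF hg] cl])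
      show "bounded ?S" by (rule bounded_subset[of "ball 0 R"]) auto
      show "z \<in> ?S" using z Rz by simp
      fix x assume "x \<in> frontier ?S"
      then have "x \<in> frontier (X a) \<or> x \<in> frontier (ball 0 R)" using frontier_Int_subset by blast
      moreover have "R \<noteq> 0" using Rz by auto
      ultimately show "cmod (g x) \<le> 1" using gK gbig Rz by auto
    qed
  qed
  have hig: "holo_inf (X a) g 0" unfolding g_def by (rule RR_holo_inf[OF a])
  have dg: "deriv_inf g 0 = of_real S0 + of_real dl * (\<Sum>j<n. c1 j)"
    using tendsto_Lim[OF trivial_limit_at_infinity tg] by (simp add: deriv_inf_def)
  let ?M = "{cmod (deriv_inf g d) | g d. holo_inf (X a) g d \<and> (\<forall>z\<in>X a. cmod (g z) \<le> 1) \<and> cmod d \<le> 1}"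
  obtain C where C: "\<And>g d. holo_inf (X a) g d \<Longrightarrow> \<forall>z\<in>X a. cmod (g z) \<le> 1 \<Longrightarrow> cmod d \<le> 1 \<Longrightarrow> cmod (deriv_inf g d) \<le> C"
    using deriv_inf_bounded[OF a] by blast
  have "cmod (deriv_inf g 0) \<le> Sup ?M"
  proof (rule cSup_upper)
    show "cmod (deriv_inf g 0) \<in> ?M" using hig gX by (intro CollectI exI[of _ g] exI[of _ 0]) auto
    show "bdd_above ?M" using C by (intro bdd_aboveI[of _ C]) blast
  qed
  moreover have "of_real S0 = complex_of_real (Sup ?M)"
    using ah deriv_inf_ff[of a] S0 by (simp add: is_ahlfors_def)
  then have "Sup ?M = S0" by (simp only: of_real_eq_iff)
  moreover have "S0 + dl * Re (\<Sum>j<n. c1 j) \<le> cmod (deriv_inf g 0)"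
    using complex_Re_le_cmod[of "deriv_inf g 0"] unfolding dg by simp
  moreover have "0 < dl * Re (\<Sum>j<n. c1 j)" using dl(1) pos by (rule mult_pos_pos)
  ultimately show False by linarith
qed

end

text \<open>The pair of poles \<open>\<i>\<close>, \<open>- \<i>\<close> and the integers from 2 to
  n - 1: symmetric under conjugation, 1-separated, and with all integer poles on one side of the
  pair. Recentring in \<open>bb\<close> meets the condition that the poles sum to zero.\<close>

definition cc :: "nat \<Rightarrow> complex" where "cc k = (if k = 0 then \<i> else if k = 1 then - \<i> else of_nat k)"

definition bb :: "nat \<Rightarrow> nat \<Rightarrow> complex" where "bb n k = cc k - (\<Sum>j<n. cc j) / of_nat n"

lemma cc_sg: "cc (sg j) = cnj (cc j)"
  by (simp add: cc_def sg_def)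

lemma cc_sep: assumes "i \<noteq> j" shows "1 \<le> cmod (cc i - cc j)"
proof -
  have 1: "1 \<le> cmod (of_nat i - of_nat j :: complex)"
  proof -
    have "1 \<le> \<bar>real i - real j\<bar>" using assms by linarith
    then show ?thesis using complex_Re_le_cmod abs_Re_le_cmod[of "of_nat i - of_nat j :: complex"] by simp
  qed
  have 2: "1 \<le> cmod (of_nat k - \<i>)" "1 \<le> cmod (\<i> - of_nat k)" "1 \<le> cmod (of_nat k + \<i>)" "1 \<le> cmod (- \<i> - of_nat k)" for k
    using abs_Im_le_cmod[of "of_nat k - \<i>"] abs_Im_le_cmod[of "\<i> - of_nat k"]
      abs_Im_le_cmod[of "of_nat k + \<i>"] abs_Im_le_cmod[of "- \<i> - of_nat k"] by simp_all
  have 3: "1 \<le> cmod (\<i> + \<i>)" "1 \<le> cmod (- \<i> - \<i>)"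
    using abs_Im_le_cmod[of "\<i> + \<i>"] abs_Im_le_cmod[of "- \<i> - \<i>"] by simp_all
  show ?thesis using assms 1 2 3 by (auto simp: cc_def)
qed

lemma bb_diff: "bb n i - bb n j = cc i - cc j"
  by (simp add: bb_def)

lemma sum_bb: "0 < n \<Longrightarrow> (\<Sum>j<n. bb n j) = 0"
  by (simp add: bb_def sum_subtractf)

lemma bb_sg: assumes "2 \<le> n" shows "bb n (sg j) = cnj (bb n j)"
proof -
  have "(\<Sum>j<n. cc j) = (\<Sum>j<n. cc (sg j))"
    by (rule sum.reindex_bij_witness[of _ sg sg]) (use assms in \<open>auto simp: sg_def\<close>)
  also have "\<dots> = cnj (\<Sum>j<n. cc j)" by (simp add: cc_sg)
  finally have "cnj (\<Sum>j<n. cc j) = (\<Sum>j<n. cc j)" by simp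
  then show ?thesis by (simp add: bb_def cc_sg del: cnj_sum)
qed

text \<open>Symmetrising in k and l turns the summands into difference quotients of a decreasing
  function.\<close>

lemma pair_sum_nonpos:
  fixes t :: "nat \<Rightarrow> real"
  assumes t: "\<And>i j. i \<in> I \<Longrightarrow> j \<in> I \<Longrightarrow> i < j \<Longrightarrow> t j \<le> t i" and I: "finite I"
  shows "(\<Sum>k\<in>I. \<Sum>l\<in>I-{k}. t k / (real k - real l)) \<le> 0"
proof -
  define F where "F k l = (if k = l then 0 else t k / (real k - real l))" for k l
  have e: "(\<Sum>k\<in>I. \<Sum>l\<in>I-{k}. t k / (real k - real l)) = (\<Sum>k\<in>I. \<Sum>l\<in>I. F k l)"
  proof (rule sum.cong[OF refl])
    fix k assume k: "k \<in> I"
    have "(\<Sum>l\<in>I. F k l) = F k k + (\<Sum>l\<in>I-{k}. F k l)" using k I by (intro sum.remove) auto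
    also have "\<dots> = (\<Sum>l\<in>I-{k}. t k / (real k - real l))" by (simp add: F_def)
    finally show "(\<Sum>l\<in>I-{k}. t k / (real k - real l)) = (\<Sum>l\<in>I. F k l)" by simp
  qed
  have "2 * (\<Sum>k\<in>I. \<Sum>l\<in>I. F k l) = (\<Sum>k\<in>I. \<Sum>l\<in>I. F k l) + (\<Sum>l\<in>I. \<Sum>k\<in>I. F k l)"
    using sum.swap[of F I I] by simp
  also have "\<dots> = (\<Sum>k\<in>I. \<Sum>l\<in>I. F k l + F l k)" by (simp add: sum.distrib)
  also have "\<dots> \<le> 0"
  proof (intro sum_nonpos)
    fix k l assume kl: "k \<in> I" "l \<in> I"
    show "F k l + F l k \<le> 0"
    proof (cases "k = l")
      case False
      have "F k l + F l k = (t k - t l) / (real k - real l)"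
      proof -
        have "t l / (real l - real k) = - (t l / (real k - real l))"
          by (metis minus_diff_eq minus_divide_right)
        then show ?thesis using False by (simp add: F_def diff_divide_distrib)
      qed
      also have "\<dots> \<le> 0"
        using t[OF kl] t[OF kl(2,1)] False by (cases "k < l") (auto simp: divide_le_0_iff)
      finally show ?thesis .
    qed (simp add: F_def)
  qed
  finally show ?thesis using e by simp
qed

text \<open>Only the residue at \<open>\<i>\<close> is turned. Hole 0 contributes nothing because
  its \<open>SS\<close> is \<open>\<i>\<close> times its \<open>AA\<close>. Each integer pole k
  contributes -k/(2(1+k^2)) through hole 1 and 2k/(1+k^2)^2 through its own hole, and the first
  outweighs the second since 1 + k^2 >= 5. The mutual terms of the integer poles sum to at most 0.
  For n >= 3 there is at least one integer pole, whence strictness.\<close>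

lemma residue_imbalance:
  assumes n: "3 \<le> n"
  shows "(\<Sum>k<n. Re (cnj (variation.SS n (bb n) (\<lambda>j. if j = 0 then -1 else 0) k) * variation.AA n (bb n) k 0)) < 0"
proof -
  interpret v: variation n "bb n" "\<lambda>j. if j = 0 then -1 else 0" "\<lambda>_. 0"
  proof
    fix i j :: nat assume "i \<noteq> j"
    then show "bb n i \<noteq> bb n j" using cc_sep[of i j] bb_diff[of n i j] by auto
  qed
  define I where "I = {2..<n}"
  define t where "t k = 1 / (1 + (real k)\<^sup>2)" for k
  define R where "R k = (\<Sum>l\<in>I-{k}. 1 / (real k - real l))" for k
  have tp: "0 < 1 + (real k)\<^sup>2" for k by (simp add: add_pos_nonneg)
  have A: "v.AA k 0 = (\<Sum>j\<in>{..<n}-{k}. 1 / (cc k - cc j))" for k by (simp add: v.AA_def bb_diff)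
  have T0: "Re (cnj (v.SS 0) * v.AA 0 0) = 0"
  proof -
    have "v.SS 0 = \<i> * v.AA 0 0"
      unfolding v.SS_def A sum_distrib_left bb_diff by (intro sum.cong refl) auto
    then show ?thesis by simp
  qed
  have S: "v.SS k = - \<i> / (cc k - cc 0)" if k: "k < n" "k \<noteq> 0" for k
  proof -
    have "v.SS k = \<i> * of_real ((if (0::nat) = 0 then -1 else 0) - (if k = 0 then -1 else 0)) / (bb n k - bb n 0)
      + (\<Sum>j\<in>{..<n}-{k}-{0}. \<i> * of_real ((if j = 0 then -1 else 0) - (if k = 0 then -1 else 0)) / (bb n k - bb n j))"
      unfolding v.SS_def using k by (intro sum.remove) auto
    also have "(\<Sum>j\<in>{..<n}-{k}-{0}. \<i> * of_real ((if j = 0 then -1 else 0) - (if k = 0 then -1 else 0)) / (bb n k - bb n j)) = 0"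
      using k by (intro sum.neutral) auto
    finally show ?thesis using k by (simp add: bb_diff)
  qed
  have T1: "Re (cnj (v.SS 1) * v.AA 1 0) = (\<Sum>k\<in>I. - (1/2) * (real k * t k))"
  proof -
    have S1: "v.SS 1 = 1/2" using S[of 1] n by (simp add: cc_def divide_simps)
    have "{..<n}-{1} = insert 0 I" using n by (auto simp: I_def)
    then have "v.AA 1 0 = 1 / (cc 1 - cc 0) + (\<Sum>j\<in>I. 1 / (cc 1 - cc j))"
      unfolding A by (simp add: I_def)
    moreover have "Re (1 / (cc 1 - cc j)) = - (real j * t j)" if "j \<in> I" for j
    proof -
      have "cc 1 - cc j = Complex (- real j) (-1)" using that by (simp add: cc_def I_def complex_eq_iff)
      then show ?thesis by (simp add: t_def Re_divide add.commute)
    qed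
    moreover have "Re (1 / (cc 1 - cc 0)) = 0" by (simp add: cc_def Re_divide)
    ultimately have A1: "Re (v.AA 1 0) = (\<Sum>j\<in>I. - (real j * t j))" by simp
    have "Re (cnj (v.SS 1) * v.AA 1 0) = 1/2 * Re (v.AA 1 0)" unfolding S1 by simp
    then show ?thesis unfolding A1 sum_distrib_left by simp
  qed
  have Tk: "Re (cnj (v.SS k) * v.AA k 0) = 2 * real k * t k * t k + R k * t k" if k: "k \<in> I" for k
  proof -
    have kn: "k < n" "2 \<le> k" using k by (auto simp: I_def)
    have ck: "cc k = of_nat k" "cc 0 = \<i>" "cc 1 = - \<i>" using kn by (auto simp: cc_def)
    have set: "{..<n}-{k} = insert 0 (insert 1 (I - {k}))" using kn by (auto simp: I_def)
    have "v.AA k 0 = 1 / (cc k - cc 0) + (1 / (cc k - cc 1) + (\<Sum>j\<in>I-{k}. 1 / (cc k - cc j)))"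
      unfolding A set by (simp add: I_def)
    also have "(\<Sum>j\<in>I-{k}. 1 / (cc k - cc j)) = of_real (R k)"
      unfolding R_def of_real_sum
    proof (rule sum.cong[OF refl])
      fix j assume "j \<in> I - {k}"
      then have "cc j = of_nat j" by (simp add: cc_def I_def)
      then show "1 / (cc k - cc j) = of_real (1 / (real k - real j))" unfolding ck by simp
    qed
    also have "1 / (cc k - cc 0) + (1 / (cc k - cc 1) + of_real (R k)) = of_real (2 * real k * t k + R k)"
    proof -
      have "1 / (of_nat k - \<i>) + 1 / (of_nat k + \<i>) = of_real (2 * real k * t k)"
        by (simp add: complex_eq_iff Re_divide Im_divide t_def power2_eq_square add.commute)
      then show ?thesis unfolding ck by (simp add: add.assoc[symmetric])
    qed
    finally have Ak: "v.AA k 0 = of_real (2 * real k * t k + R k)" .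
    have "Re (cnj (v.SS k)) = t k"
      using S[of k] kn by (simp add: ck Re_divide t_def power2_eq_square add.commute)
    then show ?thesis unfolding Ak by (simp add: algebra_simps)
  qed
  have "{..<n} = insert 0 (insert 1 I)" using n by (auto simp: I_def)
  then have "(\<Sum>k<n. Re (cnj (v.SS k) * v.AA k 0)) = Re (cnj (v.SS 0) * v.AA 0 0) + (Re (cnj (v.SS 1) * v.AA 1 0)
      + (\<Sum>k\<in>I. Re (cnj (v.SS k) * v.AA k 0)))"
    by (simp only:) (simp add: I_def)
  also have "\<dots> = (\<Sum>k\<in>I. - (1/2) * (real k * t k)) + (\<Sum>k\<in>I. 2 * real k * t k * t k + R k * t k)"
    unfolding T0 T1 using Tk by simp
  also have "\<dots> = (\<Sum>k\<in>I. real k * t k * (2 * t k - 1/2)) + (\<Sum>k\<in>I. R k * t k)"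
    by (simp add: sum.distrib[symmetric] algebra_simps)
  also have "(\<Sum>k\<in>I. R k * t k) \<le> 0"
  proof -
    have "(\<Sum>k\<in>I. \<Sum>l\<in>I-{k}. t k / (real k - real l)) \<le> 0"
    proof (rule pair_sum_nonpos)
      fix i j :: nat assume "i < j"
      then have "(real i)\<^sup>2 \<le> (real j)\<^sup>2" by (intro power_mono) auto
      then show "t j \<le> t i" unfolding t_def using tp by (intro divide_left_mono mult_pos_pos) auto
    qed (simp add: I_def)
    then show ?thesis by (simp add: R_def sum_distrib_right)
  qed
  also have "(\<Sum>k\<in>I. real k * t k * (2 * t k - 1/2)) < (\<Sum>k\<in>I. 0)"
  proof (rule sum_strict_mono)
    fix k assume "k \<in> I"
    then have k: "2 \<le> real k" by (simp add: I_def)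
    then have "2^2 \<le> (real k)\<^sup>2" by (intro power_mono) auto
    then have "t k \<le> 1 / 5" unfolding t_def by (intro divide_left_mono) (auto intro!: mult_pos_pos tp)
    moreover have "0 < real k * t k" using k tp by (simp add: t_def)
    ultimately show "real k * t k * (2 * t k - 1/2) < 0" by (intro mult_pos_neg) auto
  qed (use n in \<open>auto simp: I_def\<close>)
  finally show ?thesis by simp
qed

theorem mainTheorem18:
  fixes n :: nat
  assumes "n \<ge> 3"
  shows "\<not> (Rplus n \<subseteq> Aset n) \<and> \<not> (Aset n \<subseteq> Rplus n)"
proof -
  define \<beta> :: "nat \<Rightarrow> real" where "\<beta> j = (if j = 0 then -1 else 0)" for j
  define Q where "Q k = Re (cnj (variation.SS n (bb n) \<beta> k) * variation.AA n (bb n) k 0)" for k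
  define \<eta> where "\<eta> k = 2 * Q k - (\<Sum>k<n. Q k) / real n" for k
  have Q: "(\<Sum>k<n. Q k) < 0"
    using residue_imbalance[OF assms] unfolding Q_def \<beta>_def[abs_def] .
  have n0: "0 < real n" using assms by simp
  have eta_sum: "(\<Sum>k<n. \<eta> k) < 0"
    using Q n0 by (simp add: \<eta>_def sum_subtractf flip: sum_distrib_left)
  have sepb: "1 \<le> cmod (bb n i - bb n j)" if "i \<noteq> j" for i j
    unfolding bb_diff by (rule cc_sep[OF that])
  interpret v: variation n "bb n" \<beta> \<eta>
    by unfold_locales (use sepb in fastforce)
  have "2 * Re (cnj (v.SS k) * v.AA k 0) < \<eta> k" for k
    using divide_neg_pos[OF Q n0] unfolding \<eta>_def Q_def[symmetric] by linarith
  then have "\<forall>\<^sub>F e in at_right 0. \<forall>z. (\<forall>k<n. z \<noteq> bb n k) \<and> cmod (v.FF e z) = 1 \<longrightarrow> Re (v.GG e z * cnj (v.FF e z)) < 0"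
    by (rule v.eventually_negative)
  moreover have "\<forall>\<^sub>F e in at_right 0. e < 1 / (20000 * (real n * real n))"
    using n0 by (intro eventually_at_right_real[THEN eventually_mono]) auto
  moreover have "\<forall>\<^sub>F e in at_right 0. (0::real) < e" by (simp add: eventually_at_right_less)
  ultimately have "\<forall>\<^sub>F e in at_right 0. (0::real) < e \<and> e < 1 / (20000 * (real n * real n)) \<and>
      (\<forall>z. (\<forall>k<n. z \<noteq> bb n k) \<and> cmod (v.FF e z) = 1 \<longrightarrow> Re (v.GG e z * cnj (v.FF e z)) < 0)"
    by eventually_elim blast
  then obtain e :: real where e: "0 < e" "e < 1 / (20000 * (real n * real n))"
     and neg: "\<And>z. (\<forall>k<n. z \<noteq> bb n k) \<Longrightarrow> cmod (v.FF e z) = 1 \<Longrightarrow> Re (v.GG e z * cnj (v.FF e z)) < 0"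
    using eventually_happens'[OF trivial_limit_at_right_real] by blast
  interpret P: sym_poles n "bb n" e
  proof
    show "real n * (real n * e) \<le> 1 / 20000"
      using e n0 by (simp add: field_simps)
  qed (use assms e sepb bb_sg[of n] in auto)
  define a0 :: "nat \<Rightarrow> complex" where "a0 j = of_real e" for j
  have adm0: "P.adm a0" using e by (simp add: P.adm_def a0_def)
  have F0: "v.FF e = P.ff a0" by (simp add: fun_eq_iff v.FF_def P.ff_def a0_def)
  have G0: "v.GG e = P.RR (v.p1 e) (v.p2 e) (v.p3 e)" by (simp add: fun_eq_iff v.GG_def P.RR_def)
  have na: "\<not> is_ahlfors (P.X a0) (P.ff a0) 0"
  proof (rule P.not_ahlfors[OF adm0, of "real n * e" "v.p1 e" "v.p2 e" "v.p3 e"])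
    have "Re (\<Sum>j<n. v.p1 e j) = - (e^3 * (\<Sum>j<n. \<eta> j))"
    proof -
      have "v.p1 e j = \<i> * of_real (e * \<beta> j) - of_real (e^3 * \<eta> j)" for j
        by (simp add: v.p1_def right_diff_distrib power2_eq_square power3_eq_cube mult_ac)
      then have "Re (v.p1 e j) = - (e^3 * \<eta> j)" for j by simp
      then show ?thesis by (simp add: sum_negf sum_distrib_left)
    qed
    moreover have "e^3 * (\<Sum>j<n. \<eta> j) < 0" using e eta_sum by (intro mult_pos_neg) auto
    ultimately show "0 < Re (\<Sum>j<n. v.p1 e j)" by linarith
  qed (use neg in \<open>auto simp: a0_def F0 G0\<close>)
  have sb: "(\<Sum>j<n. bb n j) = 0" using sum_bb assms by simp
  have R: "Rab (P.al a) P.bl = P.ff a" for a using P.Rab_eq by auto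
  have "(P.al a0, P.bl) \<in> Rplus n"
    using P.mem_Rset[OF adm0 sb] e by (simp add: Rplus_def a0_def)
  moreover have "(P.al a0, P.bl) \<notin> Aset n"
    using na by (simp add: Aset_def P.preimage_disk_eq R)
  moreover obtain s where s: "s \<in> {-1/2..1/2}" "is_ahlfors (P.X (P.as s)) (P.ff (P.as s)) 0"
    using P.ex_ahlfors by blast
  have "(P.al (P.as s), P.bl) \<in> Aset n"
    using P.mem_Rset[OF P.adm_as sb] s(2) by (simp add: Aset_def P.preimage_disk_eq R)
  moreover have "(P.al (P.as s), P.bl) \<notin> Rplus n"
  proof
    assume "(P.al (P.as s), P.bl) \<in> Rplus n"
    then have "P.as s 0 \<in> \<real>" using assms by (auto simp: Rplus_def)
    then have "e * P.cl s = 0" by (simp add: P.as_def complex_is_Real_iff)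
    then have "P.cl s = 0" using e by simp
    then have "P.as s = a0" by (simp add: fun_eq_iff P.as_def a0_def complex_eq_iff)
    then show False using na s(2) by simp
  qed
  ultimately show ?thesis by blast
qed

end
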